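(* The second-order field $\Gamma$ represents (locally) a dissipative system, i.e. there exist (locally) a regular function $L$ and a function $D$ such that the equations $$\frac{d}{dt}\left(\frac{\partial L}{\partial \dot q^i}\right)-\frac{\partial L}{\partial q^i}=\frac{\partial D}{\partial \dot q^i}$$ are equivalent to $\ddot q^i=f^i(q,\dot q)$, if and only if there exists (locally) a non-singular symmetric type $(0,2)$ tensor field $g$ along $\tau$ such that both $D^Vg$ and $D^Hg$ are symmetric and $$\sum_{X,Y,Z}g(R(X,Y),Z)=0$$ for all vector fields $X,Y,Z$ along $\tau$.
   Context: All objects are smooth; the summation convention is used. $Q$ is an $n$-dimensional manifold, $\tau:TQ\to Q$ its tangent bundle, with local coordinates $q^i$ on $Q$ and induced coordinates $(q^i,v^i)$ on $TQ$ ($v^i=\dot q^i$ along curves). $\Gamma=v^i\frac{\partial}{\partial q^i}+f^i(q,v)\frac{\partial}{\partial v^i}$ is a given second-order vector field on $TQ$, corresponding to $\ddot q^i=f^i(q,\dot q)$. Two systems of equations are equivalent if they have the same solutions. A function $L$ is regular if the matrix $\left(\frac{\partial^2L}{\partial v^i\partial v^j}\right)$ is everywhere non-singular. "Locally" means: every point of $Q$ has an open neighbourhood $U$ such that the objects in question exist on $TU$ (tensor fields along $\tau|_{TU}$). Tensor fields along $\tau$ are sections over $TQ$ of the pull-backs by $\tau$ of the tensor bundles of $Q$; in coordinates they are expressed in terms of $\frac{\partial}{\partial q^i}$, $dq^i$ with coefficients that are functions on $TQ$. Put $\Gamma^j_i=-\frac12\frac{\partial f^j}{\partial v^i}$, $V_i=\frac{\partial}{\partial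 v^i}$, $H_i=\frac{\partial}{\partial q^i}-\Gamma^j_i\frac{\partial}{\partial v^j}$. For $X=X^i\frac{\partial}{\partial q^i}$ along $\tau$, the vertical and horizontal covariant derivatives are the degree 0 tensor derivations determined by $$D^V_XF=X^iV_i(F),\quad D^V_X\tfrac{\partial}{\partial q^i}=0,\quad D^V_Xdq^i=0,$$ $$D^H_XF=X^iH_i(F),\quad D^H_X\tfrac{\partial}{\partial q^i}=X^jV_j(\Gamma^k_i)\tfrac{\partial}{\partial q^k},\quad D^H_Xdq^i=-X^jV_j(\Gamma^i_k)dq^k .$$ $D^Vg(X,Y,Z)=(D^V_Xg)(Y,Z)$ and $D^Hg(X,Y,Z)=(D^H_Xg)(Y,Z)$; "symmetric" for $D^Vg$, $D^Hg$ means symmetric in all arguments. Curvature: $R$ is the vector-valued 2-form along $\tau$ with $R\left(\frac{\partial}{\partial q^i},\frac{\partial}{\partial q^j}\right)=R^k_{ij}\frac{\partial}{\partial q^k}$, $R^k_{ij}=H_j(\Gamma^k_i)-H_i(\Gamma^k_j)$. $\sum_{X,Y,Z}$ denotes the cyclic sum over the indicated arguments. *)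

theory Defs
  imports "HOL-Analysis.Analysis"
begin

section \<open>Smooth maps on open sets\<close>

text \<open>These notions are only used for open \<open>S\<close> in a finite-dimensional domain, where
  differentiability of all orders in every direction is the usual notion of smoothness.\<close>

primrec Ck_on ::
  "nat \<Rightarrow> 'a::real_normed_vector set \<Rightarrow> ('a \<Rightarrow> 'b::real_normed_vector) \<Rightarrow> bool" where
  "Ck_on 0 S f \<longleftrightarrow> continuous_on S f"
| "Ck_on (Suc k) S f \<longleftrightarrow> (\<forall>x\<in>S. f differentiable (at x)) \<and>
     (\<forall>v. Ck_on k S (\<lambda>x. frechet_derivative f (at x) v))"

definition smooth_on ::
  "'a::real_normed_vector set \<Rightarrow> ('a \<Rightarrow> 'b::real_normed_vector) \<Rightarrow> bool" where
  "smooth_on S f \<longleftrightarrow> (\<forall>k. Ck_on k S f)"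

section \<open>Manifolds, tangent vectors and the tangent bundle\<close>

text \<open>A chart is a pair of its domain and its coordinate map; values of the coordinate map
  outside the domain carry no meaning.\<close>

type_synonym ('m, 'e) chart = "'m set \<times> ('m \<Rightarrow> 'e)"

abbreviation cdom :: "('m, 'e) chart \<Rightarrow> 'm set" where "cdom \<equiv> fst"
abbreviation cmap :: "('m, 'e) chart \<Rightarrow> 'm \<Rightarrow> 'e" where "cmap \<equiv> snd"

definition chart_inv :: "('m, 'e) chart \<Rightarrow> 'e \<Rightarrow> 'm" where
  "chart_inv c = inv_into (cdom c) (cmap c)"

definition smooth_atlas ::
  "('m::topological_space, 'e::euclidean_space) chart set \<Rightarrow> bool" where
  "smooth_atlas A \<longleftrightarrow>
     (\<Union>c\<in>A. cdom c) = UNIV \<and>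
     (\<forall>c\<in>A. open (cdom c) \<and> open (cmap c ` cdom c) \<and>
        homeomorphism (cdom c) (cmap c ` cdom c) (cmap c) (chart_inv c)) \<and>
     (\<forall>c\<in>A. \<forall>c'\<in>A. smooth_on (cmap c ` (cdom c \<inter> cdom c')) (cmap c' \<circ> chart_inv c))"

text \<open>A tangent vector at \<open>p\<close> is the family of its coordinate expressions in all charts of
  the atlas around \<open>p\<close>, which are related by the Jacobians of the coordinate changes. The
  entries for all other charts are \<open>0\<close>, so that a tangent vector is determined by its
  coordinates.\<close>

type_synonym ('m, 'e) tvector = "('m, 'e) chart \<Rightarrow> 'e"

definition tangent_space ::
  "('m, 'e::euclidean_space) chart set \<Rightarrow> 'm \<Rightarrow> ('m, 'e) tvector set" where
  "tangent_space A p = {w.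
     (\<forall>c\<in>A. \<forall>c'\<in>A. p \<in> cdom c \<inter> cdom c' \<longrightarrow>
        w c' = frechet_derivative (cmap c' \<circ> chart_inv c) (at (cmap c p)) (w c)) \<and>
     (\<forall>c. \<not> (c \<in> A \<and> p \<in> cdom c) \<longrightarrow> w c = 0)}"

text \<open>The tangent vector at \<open>p\<close> with coordinates \<open>x\<close> in the chart \<open>c\<close>.\<close>

definition tangent_vec ::
  "('m, 'e::euclidean_space) chart set \<Rightarrow> ('m, 'e) chart \<Rightarrow> 'm \<Rightarrow> 'e \<Rightarrow> ('m, 'e) tvector" where
  "tangent_vec A c p x = (\<lambda>c'. if c' \<in> A \<and> p \<in> cdom c'
     then frechet_derivative (cmap c' \<circ> chart_inv c) (at (cmap c p)) x else 0)"

text \<open>Points of the tangent bundle are pairs \<open>(p, w)\<close> with \<open>w\<close> tangent at \<open>p\<close>; the projection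
  is \<^const>\<open>fst\<close>.\<close>

type_synonym ('m, 'e) tpoint = "'m \<times> ('m, 'e) tvector"

definition tangent_bundle ::
  "('m, 'e::euclidean_space) chart set \<Rightarrow> 'm set \<Rightarrow> ('m, 'e) tpoint set" where
  "tangent_bundle A U = Sigma U (tangent_space A)"

definition induced_chart ::
  "('m, 'e::euclidean_space) chart set \<Rightarrow> ('m, 'e) chart \<Rightarrow> (('m, 'e) tpoint, 'e \<times> 'e) chart" where
  "induced_chart A c = (tangent_bundle A (cdom c), \<lambda>(p, w). (cmap c p, w c))"

definition tangent_atlas ::
  "('m, 'e::euclidean_space) chart set \<Rightarrow> (('m, 'e) tpoint, 'e \<times> 'e) chart set" where
  "tangent_atlas A = induced_chart A ` A"

definition smooth_function ::
  "('m, 'e::euclidean_space) chart set \<Rightarrow> 'm set \<Rightarrow> ('m \<Rightarrow> real) \<Rightarrow> bool" where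
  "smooth_function A W F \<longleftrightarrow> (\<forall>c\<in>A. smooth_on (cmap c ` (W \<inter> cdom c)) (F \<circ> chart_inv c))"

definition vector_field ::
  "('m, 'e::euclidean_space) chart set \<Rightarrow> ('m \<Rightarrow> ('m, 'e) tvector) \<Rightarrow> bool" where
  "vector_field A X \<longleftrightarrow>
     (\<forall>p \<in> (\<Union>c\<in>A. cdom c). X p \<in> tangent_space A p) \<and>
     (\<forall>c\<in>A. smooth_on (cmap c ` cdom c) ((\<lambda>p. X p c) \<circ> chart_inv c))"

section \<open>Second-order fields\<close>

text \<open>A vector field on the tangent bundle; in the chart induced by \<open>c\<close> it reads
  \<open>v\<^sup>i \<partial>/\<partial>q\<^sup>i + f\<^sup>i \<partial>/\<partial>v\<^sup>i\<close>, where \<open>f\<close> is \<open>force A \<Gamma> c\<close>.\<close>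

definition second_order_field ::
  "('m, 'e::euclidean_space) chart set
    \<Rightarrow> (('m, 'e) tpoint \<Rightarrow> (('m, 'e) tpoint, 'e \<times> 'e) tvector) \<Rightarrow> bool" where
  "second_order_field A \<Gamma> \<longleftrightarrow> vector_field (tangent_atlas A) \<Gamma> \<and>
     (\<forall>c\<in>A. \<forall>u \<in> tangent_bundle A (cdom c). fst (\<Gamma> u (induced_chart A c)) = snd u c)"

definition force ::
  "('m, 'e::euclidean_space) chart set
    \<Rightarrow> (('m, 'e) tpoint \<Rightarrow> (('m, 'e) tpoint, 'e \<times> 'e) tvector)
    \<Rightarrow> ('m, 'e) chart \<Rightarrow> ('m, 'e) tpoint \<Rightarrow> 'e" where
  "force A \<Gamma> c u = snd (\<Gamma> u (induced_chart A c))"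

text \<open>From here on the model space is \<open>real ^ 'n\<close>, so that coordinates carry indices.\<close>

type_synonym ('m, 'n) nchart = "('m, real ^ 'n) chart"
type_synonym ('m, 'n) nvector = "('m, real ^ 'n) tvector"
type_synonym ('m, 'n) npoint = "('m, real ^ 'n) tpoint"
type_synonym ('m, 'n) sode =
  "('m, 'n) npoint \<Rightarrow> (('m, 'n) npoint, (real ^ 'n) \<times> (real ^ 'n)) tvector"

section \<open>Coordinate derivatives of functions on the tangent bundle\<close>

text \<open>\<open>ddq A c i\<close> and \<open>ddv A c i\<close> are \<open>\<partial>/\<partial>q\<^sup>i\<close> and \<open>V\<^sub>i = \<partial>/\<partial>v\<^sup>i\<close> in the chart induced by \<open>c\<close>.\<close>

definition ddq ::
  "('m, 'n::finite) nchart set \<Rightarrow> ('m, 'n) nchart \<Rightarrow> 'n \<Rightarrow> (('m, 'n) npoint \<Rightarrow> real)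
    \<Rightarrow> ('m, 'n) npoint \<Rightarrow> real" where
  "ddq A c i F u = frechet_derivative (F \<circ> chart_inv (induced_chart A c))
     (at (cmap (induced_chart A c) u)) (axis i 1, 0)"

definition ddv ::
  "('m, 'n::finite) nchart set \<Rightarrow> ('m, 'n) nchart \<Rightarrow> 'n \<Rightarrow> (('m, 'n) npoint \<Rightarrow> real)
    \<Rightarrow> ('m, 'n) npoint \<Rightarrow> real" where
  "ddv A c i F u = frechet_derivative (F \<circ> chart_inv (induced_chart A c))
     (at (cmap (induced_chart A c) u)) (0, axis i 1)"

text \<open>\<open>conn A \<Gamma> c j i\<close> is \<open>\<Gamma>\<^sup>j\<^sub>i\<close>, \<open>ddh A \<Gamma> c i\<close> is \<open>H\<^sub>i\<close>, and \<open>curv A \<Gamma> c k i j\<close> is \<open>R\<^sup>k\<^sub>i\<^sub>j\<close>.\<close>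

definition conn ::
  "('m, 'n::finite) nchart set \<Rightarrow> ('m, 'n) sode \<Rightarrow> ('m, 'n) nchart \<Rightarrow> 'n \<Rightarrow> 'n
    \<Rightarrow> ('m, 'n) npoint \<Rightarrow> real" where
  "conn A \<Gamma> c j i u = - (1 / 2) * ddv A c i (\<lambda>u. force A \<Gamma> c u $ j) u"

definition ddh ::
  "('m, 'n::finite) nchart set \<Rightarrow> ('m, 'n) sode \<Rightarrow> ('m, 'n) nchart \<Rightarrow> 'n
    \<Rightarrow> (('m, 'n) npoint \<Rightarrow> real) \<Rightarrow> ('m, 'n) npoint \<Rightarrow> real" where
  "ddh A \<Gamma> c i F u = ddq A c i F u - (\<Sum>j\<in>UNIV. conn A \<Gamma> c j i u * ddv A c j F u)"

definition curv ::
  "('m, 'n::finite) nchart set \<Rightarrow> ('m, 'n) sode \<Rightarrow> ('m, 'n) nchart \<Rightarrow> 'n \<Rightarrow> 'n \<Rightarrow> 'n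
    \<Rightarrow> ('m, 'n) npoint \<Rightarrow> real" where
  "curv A \<Gamma> c k i j u = ddh A \<Gamma> c j (conn A \<Gamma> c k i) u - ddh A \<Gamma> c i (conn A \<Gamma> c k j) u"

section \<open>Tensor fields along the projection\<close>

text \<open>A vector field along the projection assigns to a point \<open>u\<close> of the tangent bundle over \<open>U\<close>
  a tangent vector to the base at \<open>fst u\<close>; a type (0,2) tensor field assigns to \<open>u\<close> a bilinear
  form on the tangent space to the base at \<open>fst u\<close>.\<close>

definition vector_field_along ::
  "('m, 'n::finite) nchart set \<Rightarrow> 'm set \<Rightarrow> (('m, 'n) npoint \<Rightarrow> ('m, 'n) nvector) \<Rightarrow> bool" where
  "vector_field_along A U X \<longleftrightarrow>
     (\<forall>u \<in> tangent_bundle A U. X u \<in> tangent_space A (fst u)) \<and>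
     (\<forall>c\<in>A. \<forall>i. smooth_function (tangent_atlas A) (tangent_bundle A (U \<inter> cdom c))
        (\<lambda>u. X u c $ i))"

type_synonym ('m, 'n) tensor02 =
  "('m, 'n) npoint \<Rightarrow> ('m, 'n) nvector \<Rightarrow> ('m, 'n) nvector \<Rightarrow> real"

definition comp02 ::
  "('m, 'n::finite) nchart set \<Rightarrow> ('m, 'n) nchart \<Rightarrow> ('m, 'n) tensor02 \<Rightarrow> 'n \<Rightarrow> 'n
    \<Rightarrow> ('m, 'n) npoint \<Rightarrow> real" where
  "comp02 A c g i j u =
     g u (tangent_vec A c (fst u) (axis i 1)) (tangent_vec A c (fst u) (axis j 1))"

definition tensor_field02_along ::
  "('m, 'n::finite) nchart set \<Rightarrow> 'm set \<Rightarrow> ('m, 'n) tensor02 \<Rightarrow> bool" where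
  "tensor_field02_along A U g \<longleftrightarrow>
     (\<forall>u \<in> tangent_bundle A U. \<forall>x \<in> tangent_space A (fst u). \<forall>y \<in> tangent_space A (fst u).
        \<forall>z \<in> tangent_space A (fst u). \<forall>a b.
          g u (\<lambda>c. a *\<^sub>R x c + b *\<^sub>R y c) z = a * g u x z + b * g u y z \<and>
          g u z (\<lambda>c. a *\<^sub>R x c + b *\<^sub>R y c) = a * g u z x + b * g u z y) \<and>
     (\<forall>c\<in>A. \<forall>i j. smooth_function (tangent_atlas A) (tangent_bundle A (U \<inter> cdom c))
        (comp02 A c g i j))"

definition symmetric02 ::
  "('m, 'n::finite) nchart set \<Rightarrow> 'm set \<Rightarrow> ('m, 'n) tensor02 \<Rightarrow> bool" where
  "symmetric02 A U g \<longleftrightarrow> (\<forall>u \<in> tangent_bundle A U.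
     \<forall>x \<in> tangent_space A (fst u). \<forall>y \<in> tangent_space A (fst u). g u x y = g u y x)"

definition nonsingular02 ::
  "('m, 'n::finite) nchart set \<Rightarrow> 'm set \<Rightarrow> ('m, 'n) tensor02 \<Rightarrow> bool" where
  "nonsingular02 A U g \<longleftrightarrow> (\<forall>c\<in>A. \<forall>u \<in> tangent_bundle A (U \<inter> cdom c).
     invertible (\<chi> i j. comp02 A c g i j u))"

section \<open>Covariant derivatives and curvature\<close>

text \<open>Given the action \<open>dF\<close> of a degree 0 tensor derivation on functions and its action on the
  coordinate 1-forms, \<open>dq i = D(dq\<^sup>i)\<close> (as a linear form on tangent vectors), the Leibniz rule
  gives its action on \<open>g = g\<^sub>i\<^sub>j dq\<^sup>i \<otimes> dq\<^sup>j\<close>; the result is evaluated at \<open>u\<close> on \<open>y\<close>, \<open>z\<close>.\<close>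

definition derivation02 ::
  "('m, 'n::finite) nchart set \<Rightarrow> ('m, 'n) nchart
    \<Rightarrow> ((('m, 'n) npoint \<Rightarrow> real) \<Rightarrow> ('m, 'n) npoint \<Rightarrow> real)
    \<Rightarrow> ('n \<Rightarrow> ('m, 'n) npoint \<Rightarrow> ('m, 'n) nvector \<Rightarrow> real)
    \<Rightarrow> ('m, 'n) tensor02 \<Rightarrow> ('m, 'n) tensor02" where
  "derivation02 A c dF dq g u y z = (\<Sum>i\<in>UNIV. \<Sum>j\<in>UNIV.
       dF (comp02 A c g i j) u * (y c $ i) * (z c $ j)
     + comp02 A c g i j u * dq i u y * (z c $ j)
     + comp02 A c g i j u * (y c $ i) * dq j u z)"

definition DV_fun ::
  "('m, 'n::finite) nchart set \<Rightarrow> ('m, 'n) nchart \<Rightarrow> (('m, 'n) npoint \<Rightarrow> ('m, 'n) nvector)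
    \<Rightarrow> (('m, 'n) npoint \<Rightarrow> real) \<Rightarrow> ('m, 'n) npoint \<Rightarrow> real" where
  "DV_fun A c X F u = (\<Sum>i\<in>UNIV. X u c $ i * ddv A c i F u)"

definition DV02 ::
  "('m, 'n::finite) nchart set \<Rightarrow> ('m, 'n) nchart \<Rightarrow> (('m, 'n) npoint \<Rightarrow> ('m, 'n) nvector)
    \<Rightarrow> ('m, 'n) tensor02 \<Rightarrow> ('m, 'n) tensor02" where
  "DV02 A c X = derivation02 A c (DV_fun A c X) (\<lambda>i u y. 0)"

definition DH_fun ::
  "('m, 'n::finite) nchart set \<Rightarrow> ('m, 'n) sode \<Rightarrow> ('m, 'n) nchart
    \<Rightarrow> (('m, 'n) npoint \<Rightarrow> ('m, 'n) nvector)
    \<Rightarrow> (('m, 'n) npoint \<Rightarrow> real) \<Rightarrow> ('m, 'n) npoint \<Rightarrow> real" where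
  "DH_fun A \<Gamma> c X F u = (\<Sum>i\<in>UNIV. X u c $ i * ddh A \<Gamma> c i F u)"

definition DH_dq ::
  "('m, 'n::finite) nchart set \<Rightarrow> ('m, 'n) sode \<Rightarrow> ('m, 'n) nchart
    \<Rightarrow> (('m, 'n) npoint \<Rightarrow> ('m, 'n) nvector)
    \<Rightarrow> 'n \<Rightarrow> ('m, 'n) npoint \<Rightarrow> ('m, 'n) nvector \<Rightarrow> real" where
  "DH_dq A \<Gamma> c X i u y =
     - (\<Sum>j\<in>UNIV. \<Sum>k\<in>UNIV. X u c $ j * ddv A c j (conn A \<Gamma> c i k) u * (y c $ k))"

definition DH02 ::
  "('m, 'n::finite) nchart set \<Rightarrow> ('m, 'n) sode \<Rightarrow> ('m, 'n) nchart
    \<Rightarrow> (('m, 'n) npoint \<Rightarrow> ('m, 'n) nvector)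
    \<Rightarrow> ('m, 'n) tensor02 \<Rightarrow> ('m, 'n) tensor02" where
  "DH02 A \<Gamma> c X = derivation02 A c (DH_fun A \<Gamma> c X) (DH_dq A \<Gamma> c X)"

text \<open>Symmetry in all three arguments of \<open>(X, Y, Z) \<mapsto> (D\<^sub>X g)(Y, Z)\<close>, for a covariant derivative
  \<open>D\<close> given by its expressions \<open>D c\<close> in the charts \<open>c\<close>: the two transpositions generate all
  permutations.\<close>

definition symmetric_derivative ::
  "('m, 'n::finite) nchart set \<Rightarrow> 'm set
    \<Rightarrow> (('m, 'n) nchart \<Rightarrow> (('m, 'n) npoint \<Rightarrow> ('m, 'n) nvector)
        \<Rightarrow> ('m, 'n) tensor02 \<Rightarrow> ('m, 'n) tensor02)
    \<Rightarrow> ('m, 'n) tensor02 \<Rightarrow> bool" where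
  "symmetric_derivative A U D g \<longleftrightarrow>
     (\<forall>X Y Z. vector_field_along A U X \<longrightarrow> vector_field_along A U Y \<longrightarrow>
        vector_field_along A U Z \<longrightarrow>
        (\<forall>c\<in>A. \<forall>u \<in> tangent_bundle A (U \<inter> cdom c).
           D c X g u (Y u) (Z u) = D c Y g u (X u) (Z u) \<and>
           D c X g u (Y u) (Z u) = D c X g u (Z u) (Y u)))"

text \<open>\<open>R(x, y)\<close> at \<open>u\<close>, computed in the chart \<open>c\<close>.\<close>

definition curvature ::
  "('m, 'n::finite) nchart set \<Rightarrow> ('m, 'n) sode \<Rightarrow> ('m, 'n) nchart \<Rightarrow> ('m, 'n) npoint
    \<Rightarrow> ('m, 'n) nvector \<Rightarrow> ('m, 'n) nvector \<Rightarrow> ('m, 'n) nvector" where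
  "curvature A \<Gamma> c u x y = tangent_vec A c (fst u)
     (\<chi> k. \<Sum>i\<in>UNIV. \<Sum>j\<in>UNIV. curv A \<Gamma> c k i j u * (x c $ i) * (y c $ j))"

definition cyclic_curvature_condition ::
  "('m, 'n::finite) nchart set \<Rightarrow> ('m, 'n) sode \<Rightarrow> 'm set \<Rightarrow> ('m, 'n) tensor02 \<Rightarrow> bool" where
  "cyclic_curvature_condition A \<Gamma> U g \<longleftrightarrow>
     (\<forall>X Y Z. vector_field_along A U X \<longrightarrow> vector_field_along A U Y \<longrightarrow>
        vector_field_along A U Z \<longrightarrow>
        (\<forall>c\<in>A. \<forall>u \<in> tangent_bundle A (U \<inter> cdom c).
             g u (curvature A \<Gamma> c u (X u) (Y u)) (Z u)
           + g u (curvature A \<Gamma> c u (Y u) (Z u)) (X u)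
           + g u (curvature A \<Gamma> c u (Z u) (X u)) (Y u) = 0))"

section \<open>Curves and dissipative systems\<close>

definition smooth_curve ::
  "('m::topological_space, 'n::finite) nchart set \<Rightarrow> real set \<Rightarrow> (real \<Rightarrow> 'm) \<Rightarrow> bool" where
  "smooth_curve A I \<gamma> \<longleftrightarrow> continuous_on I \<gamma> \<and>
     (\<forall>c\<in>A. smooth_on {t \<in> I. \<gamma> t \<in> cdom c} (cmap c \<circ> \<gamma>))"

text \<open>The lift \<open>t \<mapsto> (\<gamma> t, \<gamma>' t)\<close> of a curve to the tangent bundle.\<close>

definition lift_curve ::
  "('m, 'n::finite) nchart set \<Rightarrow> (real \<Rightarrow> 'm) \<Rightarrow> real \<Rightarrow> ('m, 'n) npoint" where
  "lift_curve A \<gamma> t = (\<gamma> t, \<lambda>c. if c \<in> A \<and> \<gamma> t \<in> cdom c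
     then vector_derivative (cmap c \<circ> \<gamma>) (at t) else 0)"

definition satisfies_sode ::
  "('m, 'n::finite) nchart set \<Rightarrow> ('m, 'n) sode \<Rightarrow> (real \<Rightarrow> 'm) \<Rightarrow> real \<Rightarrow> bool" where
  "satisfies_sode A \<Gamma> \<gamma> t \<longleftrightarrow> (\<forall>c\<in>A. \<gamma> t \<in> cdom c \<longrightarrow>
     vector_derivative (\<lambda>s. vector_derivative (cmap c \<circ> \<gamma>) (at s)) (at t)
       = force A \<Gamma> c (lift_curve A \<gamma> t))"

definition satisfies_dissipative_EL ::
  "('m, 'n::finite) nchart set \<Rightarrow> (('m, 'n) npoint \<Rightarrow> real) \<Rightarrow> (('m, 'n) npoint \<Rightarrow> real)
    \<Rightarrow> (real \<Rightarrow> 'm) \<Rightarrow> real \<Rightarrow> bool" where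
  "satisfies_dissipative_EL A L D \<gamma> t \<longleftrightarrow> (\<forall>c\<in>A. \<gamma> t \<in> cdom c \<longrightarrow> (\<forall>i.
     deriv (\<lambda>s. ddv A c i L (lift_curve A \<gamma> s)) t - ddq A c i L (lift_curve A \<gamma> t)
       = ddv A c i D (lift_curve A \<gamma> t)))"

definition regular_function ::
  "('m, 'n::finite) nchart set \<Rightarrow> 'm set \<Rightarrow> (('m, 'n) npoint \<Rightarrow> real) \<Rightarrow> bool" where
  "regular_function A U L \<longleftrightarrow> (\<forall>c\<in>A. \<forall>u \<in> tangent_bundle A (U \<inter> cdom c).
     invertible (\<chi> i j. ddv A c i (ddv A c j L) u))"

text \<open>Equivalence over \<open>U\<close>: the same smooth curves in \<open>U\<close>, on arbitrary open intervals (bounded or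
  not), solve both systems.\<close>

definition same_solutions ::
  "('m::topological_space, 'n::finite) nchart set \<Rightarrow> 'm set
    \<Rightarrow> ((real \<Rightarrow> 'm) \<Rightarrow> real \<Rightarrow> bool) \<Rightarrow> ((real \<Rightarrow> 'm) \<Rightarrow> real \<Rightarrow> bool) \<Rightarrow> bool" where
  "same_solutions A U E E' \<longleftrightarrow> (\<forall>I \<gamma>. open I \<longrightarrow> is_interval I \<longrightarrow> smooth_curve A I \<gamma> \<longrightarrow> \<gamma> ` I \<subseteq> U \<longrightarrow>
     (\<forall>t\<in>I. E \<gamma> t) = (\<forall>t\<in>I. E' \<gamma> t))"

definition locally_dissipative ::
  "('m::topological_space, 'n::finite) nchart set \<Rightarrow> ('m, 'n) sode \<Rightarrow> bool" where
  "locally_dissipative A \<Gamma> \<longleftrightarrow> (\<forall>p. \<exists>U. open U \<and> p \<in> U \<and> (\<exists>L D.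
     smooth_function (tangent_atlas A) (tangent_bundle A U) L \<and>
     smooth_function (tangent_atlas A) (tangent_bundle A U) D \<and>
     regular_function A U L \<and>
     same_solutions A U (satisfies_dissipative_EL A L D) (satisfies_sode A \<Gamma>)))"

end

theory Submission
  imports Defs
begin

text \<open>If \<open>g\<^sub>i\<^sub>j = V\<^sub>i V\<^sub>j L\<close>, the dissipative equations are equivalent to the given system exactly when
  \<open>\<Gamma>(V\<^sub>i L) - \<partial>L/\<partial>q\<^sup>i = V\<^sub>i D\<close>. The left-hand side is a \<open>V\<close>-gradient if and only if
  \<open>\<omega>\<^sub>j\<^sub>k = H\<^sub>j V\<^sub>k L - H\<^sub>k V\<^sub>j L\<close> vanishes. Now \<open>V\<^sub>j \<omega>\<^sub>k\<^sub>i\<close> is the defect of symmetry of \<open>D\<^sup>H g\<close>, and the cyclic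
  sum of \<open>H\<^sub>i \<omega>\<^sub>j\<^sub>k\<close> is the cyclic sum of \<open>g(R(X,Y),Z)\<close>, which gives necessity. Conversely, symmetry of
  \<open>D\<^sup>V g\<close> makes \<open>g\<close> a fibre Hessian; the other two conditions say that \<open>\<omega>\<close> is basic and closed, so
  \<open>\<omega> = d\<alpha>\<close> on a coordinate ball, and replacing \<open>L\<close> by \<open>L - \<alpha>\<^sub>i v\<^sup>i\<close> removes it.\<close>

section \<open>Calculus of smooth maps\<close>

text \<open>Two mismatches between the statement and this computation shape the proof. Equivalence
  speaks of solution curves, while the identity for \<open>L\<close> and \<open>D\<close> is wanted
  at every point of the tangent bundle; passing a smooth solution through each point takes a local
  existence theorem for ordinary differential equations. The conditions on \<open>g\<close> quantify
  over vector fields along the projection defined over all of \<open>U\<close>, while the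
  computation needs components at one point; bump functions extend prescribed values. Moreover all
  notions are required in every chart, so transformation laws are needed before a single chart may
  be chosen.

  Calling \<omega> basic rests on the fibres being whole vector spaces: a function with vanishing
  vertical derivatives is constant on them, and there \<open>H\<^sub>i\<close> acts as
  \<open>\<partial>/\<partial>q\<^sup>i\<close>, so the cyclic sum of
  \<open>H\<^sub>i \<omega>\<^sub>j\<^sub>k\<close> is an exterior derivative on the base.
  Subtracting \<open>\<alpha>\<^sub>i v\<^sup>i\<close> leaves \<open>g\<close> alone, being linear
  in the velocities.\<close>

definition pd :: "'a::real_normed_vector \<Rightarrow> ('a \<Rightarrow> 'b::real_normed_vector) \<Rightarrow> 'a \<Rightarrow> 'b" where
  "pd v f x = frechet_derivative f (at x) v"

lemma pd_eqI: "(f has_derivative f') (at x) \<Longrightarrow> pd v f x = f' v"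
  by (metis frechet_derivative_at pd_def)

lemma has_derivative_pd:
  "f differentiable (at x) \<Longrightarrow> (f has_derivative (\<lambda>v. pd v f x)) (at x)"
  unfolding pd_def by (simp add: frechet_derivative_works)

lemma linear_pd: "f differentiable (at x) \<Longrightarrow> linear (\<lambda>v. pd v f x)"
  unfolding pd_def by (rule linear_frechet_derivative)

text \<open>A derivative at an interior point depends only on the germ. No differentiability enters:
  \<open>frechet_derivative\<close> is a choice that depends only on the set of all derivatives, and
  the two maps have the same ones.\<close>

lemma pd_transform:
  assumes "open S" "x \<in> S" "\<And>y. y \<in> S \<Longrightarrow> f y = g y"
  shows "pd v f x = pd v g x"
proof -
  have "(f has_derivative D) (at x) \<longleftrightarrow> (g has_derivative D) (at x)" for D
    using has_derivative_transform_within_open[of f D x UNIV S g]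
      has_derivative_transform_within_open[of g D x UNIV S f] assms by auto
  then show ?thesis by (simp add: pd_def frechet_derivative_def)
qed

lemma pd_const [simp]: "pd v (\<lambda>x. c) x = 0"
  by (simp add: pd_def)

lemma pd_add:
  "\<lbrakk>f differentiable (at x); g differentiable (at x)\<rbrakk>
    \<Longrightarrow> pd v (\<lambda>x. f x + g x) x = pd v f x + pd v g x"
  by (rule pd_eqI) (intro has_derivative_add has_derivative_pd)

lemma pd_diff:
  "\<lbrakk>f differentiable (at x); g differentiable (at x)\<rbrakk>
    \<Longrightarrow> pd v (\<lambda>x. f x - g x) x = pd v f x - pd v g x"
  by (rule pd_eqI) (intro has_derivative_diff has_derivative_pd)

lemma pd_sum:
  "(\<And>i. i \<in> I \<Longrightarrow> f i differentiable (at x))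
    \<Longrightarrow> pd v (\<lambda>x. \<Sum>i\<in>I. f i x) x = (\<Sum>i\<in>I. pd v (f i) x)"
  by (rule pd_eqI) (intro has_derivative_sum has_derivative_pd)

lemma pd_mult:
  fixes f g :: "'a::real_normed_vector \<Rightarrow> real"
  assumes "f differentiable (at x)" "g differentiable (at x)"
  shows "pd v (\<lambda>x. f x * g x) x = pd v f x * g x + f x * pd v g x"
  using pd_eqI[OF has_derivative_mult[OF has_derivative_pd has_derivative_pd, OF assms], of v]
  by simp

lemma pd_cmult:
  fixes f :: "'a::real_normed_vector \<Rightarrow> real"
  assumes "f differentiable (at x)"
  shows "pd v (\<lambda>x. c * f x) x = c * pd v f x"
  using pd_mult[of "\<lambda>_. c" x f v] assms by simp

lemma pd_compose:
  assumes "f differentiable (at x)" "g differentiable (at (f x))"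
  shows "pd v (\<lambda>x. g (f x)) x = pd (pd v f x) g (f x)"
  by (rule pd_eqI) (use has_derivative_compose[OF has_derivative_pd has_derivative_pd, OF assms] in auto)

lemma pd_bounded_linear:
  assumes "f differentiable (at x)" "bounded_linear h"
  shows "pd v (\<lambda>x. h (f x)) x = h (pd v f x)"
  by (rule pd_eqI[OF bounded_linear.has_derivative[OF assms(2) has_derivative_pd[OF assms(1)]]])

section \<open>Maps of finite differentiability class: local character and closure
  properties\<close>

lemma Ck_on_Suc_pd:
  "Ck_on (Suc k) S f \<longleftrightarrow> (\<forall>x\<in>S. f differentiable (at x)) \<and> (\<forall>v. Ck_on k S (pd v f))"
  by (simp add: pd_def[abs_def])

declare Ck_on.simps(2) [simp del]

lemma Ck_on_cong:
  assumes "open S" "\<And>x. x \<in> S \<Longrightarrow> f x = g x"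
  shows "Ck_on k S f \<longleftrightarrow> Ck_on k S g"
  using assms(2)
proof (induction k arbitrary: f g)
  case 0
  then show ?case by (auto cong: continuous_on_cong)
next
  case (Suc k)
  have "f differentiable (at x) \<longleftrightarrow> g differentiable (at x)" if "x \<in> S" for x
    using has_derivative_transform_within_open[of f _ x UNIV S g]
      has_derivative_transform_within_open[of g _ x UNIV S f] assms(1) Suc.prems that
    unfolding differentiable_def by fastforce
  moreover have "Ck_on k S (pd v f) \<longleftrightarrow> Ck_on k S (pd v g)" for v
    by (rule Suc.IH) (rule pd_transform[OF assms(1) _ Suc.prems])
  ultimately show ?case by (simp add: Ck_on_Suc_pd)
qed

lemma Ck_on_subset: "Ck_on k S f \<Longrightarrow> T \<subseteq> S \<Longrightarrow> Ck_on k T f"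
proof (induction k arbitrary: f)
  case 0
  then show ?case by (auto intro: continuous_on_subset)
qed (auto simp: Ck_on_Suc_pd)

lemma Ck_on_imp_continuous_on: "Ck_on k S f \<Longrightarrow> continuous_on S f"
proof (cases k)
  case (Suc j)
  assume "Ck_on k S f"
  then show ?thesis
    unfolding Suc Ck_on_Suc_pd
    by (auto intro!: continuous_at_imp_continuous_on differentiable_imp_continuous_within)
qed auto

lemma Ck_on_SucD: "Ck_on (Suc k) S f \<Longrightarrow> Ck_on k S f"
proof (induction k arbitrary: f)
  case 0
  then show ?case using Ck_on_imp_continuous_on by (simp only: Ck_on.simps(1))
next
  case (Suc k)
  then show ?case by (metis Ck_on_Suc_pd)
qed

text \<open>All derivatives are taken with the full filter at the point, so membership can be tested
  on neighbourhoods. This serves for functions given by different formulas on different open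
  sets.\<close>

lemma Ck_on_local:
  assumes "\<And>x. x \<in> S \<Longrightarrow> \<exists>T. open T \<and> x \<in> T \<and> Ck_on k T f"
  shows "Ck_on k S f"
  using assms
proof (induction k arbitrary: f)
  case 0
  show ?case unfolding Ck_on.simps
  proof (rule continuous_at_imp_continuous_on, rule ballI)
    fix x assume "x \<in> S"
    then obtain T where "open T" "x \<in> T" "continuous_on T f" using 0 by auto
    then show "isCont f x" by (simp add: continuous_on_eq_continuous_at)
  qed
next
  case (Suc k)
  have "f differentiable (at x)" if x: "x \<in> S" for x
    using Suc.prems[OF x] by (auto simp: Ck_on_Suc_pd)
  moreover have "Ck_on k S (pd v f)" for v
  proof (rule Suc.IH)
    fix x assume "x \<in> S"
    from Suc.prems[OF this] show "\<exists>T. open T \<and> x \<in> T \<and> Ck_on k T (pd v f)"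
      by (auto simp: Ck_on_Suc_pd)
  qed
  ultimately show ?case by (simp add: Ck_on_Suc_pd)
qed

lemma Ck_on_const: "Ck_on k S (\<lambda>x. c)"
proof (induction k arbitrary: c)
  case (Suc k)
  have "pd v (\<lambda>x. c) = (\<lambda>x. 0)" for v :: 'a by (rule ext) simp
  then show ?case using Suc by (simp add: Ck_on_Suc_pd)
qed auto

lemma Ck_on_bounded_linear:
  assumes h: "bounded_linear h" and S: "open S" and "Ck_on k S f"
  shows "Ck_on k S (\<lambda>x. h (f x))"
  using assms(3)
proof (induction k arbitrary: f)
  case 0
  then show ?case using bounded_linear.continuous_on[OF h] by simp
next
  case (Suc k)
  have "pd v (\<lambda>x. h (f x)) x = h (pd v f x)" if "x \<in> S" for x v
    using pd_bounded_linear[OF _ h, of f] Suc.prems that by (simp add: Ck_on_Suc_pd)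
  then show ?case
    using Suc Ck_on_cong[OF S, of "pd v (\<lambda>x. h (f x))" "\<lambda>x. h (pd v f x)" k for v]
    by (auto simp: Ck_on_Suc_pd intro!: differentiableI[OF bounded_linear.has_derivative[OF h has_derivative_pd]])
qed

lemma Ck_on_add:
  assumes S: "open S" and "Ck_on k S f" "Ck_on k S g"
  shows "Ck_on k S (\<lambda>x. f x + g x)"
  using assms(2,3)
proof (induction k arbitrary: f g)
  case 0
  then show ?case by (simp add: continuous_on_add)
next
  case (Suc k)
  have "pd v (\<lambda>x. f x + g x) x = pd v f x + pd v g x" if "x \<in> S" for x v
    using pd_add[of f x g] Suc.prems that by (simp add: Ck_on_Suc_pd)
  then show ?case
    using Suc Ck_on_cong[OF S, of "pd v (\<lambda>x. f x + g x)" "\<lambda>x. pd v f x + pd v g x" k for v]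
    by (auto simp: Ck_on_Suc_pd)
qed

text \<open>The Leibniz rule writes the derivative as a sum of two terms of the same bilinear shape,
  in which the undifferentiated factor is merely weakened by one order. Products, scalings and inner
  products are all instances.\<close>

lemma Ck_on_bilinear:
  assumes h: "bounded_bilinear h" and S: "open S" and "Ck_on k S f" "Ck_on k S g"
  shows "Ck_on k S (\<lambda>x. h (f x) (g x))"
  using assms(3,4)
proof (induction k arbitrary: f g)
  case 0
  then show ?case using bounded_bilinear.continuous_on[OF h] by simp
next
  case (Suc k)
  have *: "((\<lambda>x. h (f x) (g x)) has_derivative (\<lambda>v. h (f x) (pd v g x) + h (pd v f x) (g x))) (at x)"
    if "x \<in> S" for x
    using bounded_bilinear.FDERIV[OF h has_derivative_pd has_derivative_pd, of f x g] Suc.prems that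
    by (auto simp: Ck_on_Suc_pd)
  have "Ck_on k S (pd v (\<lambda>x. h (f x) (g x)))" for v
  proof -
    have "Ck_on k S f" "Ck_on k S g" "Ck_on k S (pd v f)" "Ck_on k S (pd v g)"
      using Ck_on_SucD[OF Suc.prems(1)] Ck_on_SucD[OF Suc.prems(2)] Suc.prems
      by (simp_all add: Ck_on_Suc_pd)
    then have "Ck_on k S (\<lambda>x. h (f x) (pd v g x) + h (pd v f x) (g x))"
      by (intro Ck_on_add S Suc.IH)
    then show ?thesis using Ck_on_cong[OF S, of "pd v (\<lambda>x. h (f x) (g x))"] pd_eqI[OF *] by simp
  qed
  then show ?case
    unfolding Ck_on_Suc_pd using * by (auto simp: differentiable_def)
qed

lemma Ck_on_sum:
  assumes "open S" "\<And>i. i \<in> I \<Longrightarrow> Ck_on k S (f i)"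
  shows "Ck_on k S (\<lambda>x. \<Sum>i\<in>I. f i x)"
  using assms(2)
  by (induction I rule: infinite_finite_induct) (auto intro: Ck_on_const Ck_on_add[OF assms(1)])

text \<open>The chain rule differentiates \<open>g\<close> in the direction \<open>pd v f x\<close>,
  which varies with \<open>x\<close>, whereas \<open>Ck_on\<close> speaks of fixed directions.
  Expanding in a basis turns the result into a finite sum of products with fixed directions, to
  which the induction for compositions applies.\<close>

lemma pd_compose_Basis:
  fixes f :: "'a::real_normed_vector \<Rightarrow> 'b::euclidean_space"
  assumes "f differentiable (at x)" "g differentiable (at (f x))"
  shows "pd v (\<lambda>x. g (f x)) x = (\<Sum>b\<in>Basis. (pd v f x \<bullet> b) *\<^sub>R pd b g (f x))"
proof -
  interpret linear "\<lambda>w. pd w g (f x)" by (rule linear_pd[OF assms(2)])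
  have "pd v (\<lambda>x. g (f x)) x = pd (\<Sum>b\<in>Basis. (pd v f x \<bullet> b) *\<^sub>R b) g (f x)"
    unfolding pd_compose[OF assms] euclidean_representation ..
  then show ?thesis by (simp add: sum scale)
qed

lemma Ck_on_compose:
  fixes f :: "'a::real_normed_vector \<Rightarrow> 'b::euclidean_space"
  assumes S: "open S" and "Ck_on k S f" "Ck_on k T g" and fS: "f ` S \<subseteq> T"
  shows "Ck_on k S (\<lambda>x. g (f x))"
  using assms(2,3)
proof (induction k arbitrary: g)
  case 0
  then show ?case using continuous_on_compose2 fS by auto
next
  case (Suc k)
  have d: "f differentiable (at x)" "g differentiable (at (f x))" if "x \<in> S" for x
    using Suc.prems that fS by (auto simp: Ck_on_Suc_pd)
  have "Ck_on k S (pd v (\<lambda>x. g (f x)))" for v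
  proof -
    have "Ck_on k S (\<lambda>x. \<Sum>b\<in>Basis. (pd v f x \<bullet> b) *\<^sub>R pd b g (f x))"
      using Suc.prems Ck_on_SucD[OF Suc.prems(1)]
    by (intro Ck_on_sum Ck_on_bilinear[OF bounded_bilinear_scaleR] S
        Ck_on_bounded_linear[OF bounded_linear_inner_left] Suc.IH)
      (auto simp: Ck_on_Suc_pd)
    then show ?thesis
      using Ck_on_cong[OF S, of "pd v (\<lambda>x. g (f x))"] pd_compose_Basis[OF d] by simp
  qed
  then show ?case
    unfolding Ck_on_Suc_pd using d differentiable_chain_at[of f _ g] by (auto simp: o_def)
qed

section \<open>Smooth maps: closure properties\<close>

lemma smooth_on_imp_differentiable: "smooth_on S f \<Longrightarrow> x \<in> S \<Longrightarrow> f differentiable (at x)"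
  unfolding smooth_on_def by (meson Ck_on_Suc_pd)

lemma smooth_on_imp_continuous_on: "smooth_on S f \<Longrightarrow> continuous_on S f"
  unfolding smooth_on_def by (metis Ck_on.simps(1))

lemma smooth_on_pd: "smooth_on S f \<Longrightarrow> smooth_on S (pd v f)"
  unfolding smooth_on_def by (meson Ck_on_Suc_pd)

lemma smooth_onI_pd:
  "(\<And>x. x \<in> S \<Longrightarrow> f differentiable (at x)) \<Longrightarrow> (\<And>v. smooth_on S (pd v f)) \<Longrightarrow> smooth_on S f"
  unfolding smooth_on_def by (rule allI, rule Ck_on_SucD) (simp add: Ck_on_Suc_pd)

lemma smooth_on_cong:
  "open S \<Longrightarrow> (\<And>x. x \<in> S \<Longrightarrow> f x = g x) \<Longrightarrow> smooth_on S f \<longleftrightarrow> smooth_on S g"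
  unfolding smooth_on_def using Ck_on_cong by blast

lemma smooth_on_subset: "smooth_on S f \<Longrightarrow> T \<subseteq> S \<Longrightarrow> smooth_on T f"
  unfolding smooth_on_def using Ck_on_subset by blast

lemma smooth_on_local:
  "(\<And>x. x \<in> S \<Longrightarrow> \<exists>T. open T \<and> x \<in> T \<and> smooth_on T f) \<Longrightarrow> smooth_on S f"
  unfolding smooth_on_def by (rule allI, rule Ck_on_local) blast

lemma smooth_on_const [simp]: "smooth_on S (\<lambda>x. c)"
  unfolding smooth_on_def by (simp add: Ck_on_const)

lemma smooth_on_id: "smooth_on S (\<lambda>x. x)"
proof (rule smooth_onI_pd)
  have "pd v (\<lambda>x. x) = (\<lambda>x. v)" for v :: 'a by (auto simp: pd_def)
  then show "smooth_on S (pd v (\<lambda>x. x))" for v by simp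
qed simp

lemma smooth_on_bounded_linear:
  "bounded_linear h \<Longrightarrow> open S \<Longrightarrow> smooth_on S f \<Longrightarrow> smooth_on S (\<lambda>x. h (f x))"
  unfolding smooth_on_def using Ck_on_bounded_linear by blast

lemma smooth_on_add:
  "open S \<Longrightarrow> smooth_on S f \<Longrightarrow> smooth_on S g \<Longrightarrow> smooth_on S (\<lambda>x. f x + g x)"
  unfolding smooth_on_def using Ck_on_add by blast

lemma smooth_on_minus: "open S \<Longrightarrow> smooth_on S f \<Longrightarrow> smooth_on S (\<lambda>x. - f x)"
  by (rule smooth_on_bounded_linear[OF bounded_linear_minus[OF bounded_linear_ident]])

lemma smooth_on_diff:
  "open S \<Longrightarrow> smooth_on S f \<Longrightarrow> smooth_on S g \<Longrightarrow> smooth_on S (\<lambda>x. f x - g x)"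
  using smooth_on_add[of S f "\<lambda>x. - g x"] smooth_on_minus[of S g] by simp

lemma smooth_on_scaleR:
  "open S \<Longrightarrow> smooth_on S f \<Longrightarrow> smooth_on S g \<Longrightarrow> smooth_on S (\<lambda>x. f x *\<^sub>R g x)"
  unfolding smooth_on_def using Ck_on_bilinear[OF bounded_bilinear_scaleR] by blast

lemma smooth_on_mult:
  fixes f g :: "'a::real_normed_vector \<Rightarrow> real"
  shows "open S \<Longrightarrow> smooth_on S f \<Longrightarrow> smooth_on S g \<Longrightarrow> smooth_on S (\<lambda>x. f x * g x)"
  unfolding smooth_on_def using Ck_on_bilinear[OF bounded_bilinear_mult] by blast

lemma smooth_on_inner:
  "open S \<Longrightarrow> smooth_on S f \<Longrightarrow> smooth_on S g \<Longrightarrow> smooth_on S (\<lambda>x. f x \<bullet> g x)"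
  unfolding smooth_on_def using Ck_on_bilinear[OF bounded_bilinear_inner] by blast

lemma smooth_on_sum:
  "open S \<Longrightarrow> (\<And>i. i \<in> I \<Longrightarrow> smooth_on S (f i)) \<Longrightarrow> smooth_on S (\<lambda>x. \<Sum>i\<in>I. f i x)"
  unfolding smooth_on_def by (simp add: Ck_on_sum)

lemma smooth_on_compose:
  fixes f :: "'a::real_normed_vector \<Rightarrow> 'b::euclidean_space"
  shows "open S \<Longrightarrow> smooth_on S f \<Longrightarrow> smooth_on T g \<Longrightarrow> f ` S \<subseteq> T \<Longrightarrow> smooth_on S (\<lambda>x. g (f x))"
  unfolding smooth_on_def using Ck_on_compose[of S _ f T g] by simp

lemma smooth_on_fst: "open S \<Longrightarrow> smooth_on S f \<Longrightarrow> smooth_on S (\<lambda>x. fst (f x))"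
  by (rule smooth_on_bounded_linear[OF bounded_linear_fst])

lemma smooth_on_snd: "open S \<Longrightarrow> smooth_on S f \<Longrightarrow> smooth_on S (\<lambda>x. snd (f x))"
  by (rule smooth_on_bounded_linear[OF bounded_linear_snd])

lemma smooth_on_nth: "open S \<Longrightarrow> smooth_on S f \<Longrightarrow> smooth_on S (\<lambda>x. f x $ i)"
  by (rule smooth_on_bounded_linear[OF bounded_linear_vec_nth])

lemma smooth_on_Pair:
  assumes "open S" "smooth_on S f" "smooth_on S g"
  shows "smooth_on S (\<lambda>x. (f x, g x))"
proof -
  have "bounded_linear (\<lambda>y. (y, 0))" "bounded_linear (\<lambda>y. (0, y))"
    by (intro bounded_linear_Pair bounded_linear_ident bounded_linear_zero)+
  then have "smooth_on S (\<lambda>x. (f x, 0) + (0, g x))"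
    by (intro smooth_on_add assms smooth_on_bounded_linear[where h="\<lambda>y. (y, 0)"]
        smooth_on_bounded_linear[where h="\<lambda>y. (0, y)"])
  then show ?thesis by simp
qed

lemma vec_expand: "(\<Sum>i\<in>UNIV. (x $ i) *\<^sub>R axis i 1) = (x :: real ^ 'n)"
  using basis_expansion[of x] by (simp add: scalar_mult_eq_scaleR)

lemmas smooth_intros = smooth_on_const smooth_on_id smooth_on_add smooth_on_minus smooth_on_diff
  smooth_on_scaleR smooth_on_mult smooth_on_inner smooth_on_sum smooth_on_fst smooth_on_snd
  smooth_on_nth smooth_on_Pair smooth_on_pd

lemma pd_vec_expand:
  fixes f :: "real ^ 'n \<Rightarrow> 'b::real_normed_vector"
  assumes "f differentiable (at x)"
  shows "pd w f x = (\<Sum>i\<in>UNIV. (w $ i) *\<^sub>R pd (axis i 1) f x)"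
proof -
  interpret linear "\<lambda>v. pd v f x" by (rule linear_pd[OF assms])
  have "pd w f x = pd (\<Sum>i\<in>UNIV. (w $ i) *\<^sub>R axis i 1) f x"
    by (simp add: vec_expand)
  then show ?thesis by (simp add: sum scale)
qed

text \<open>The mean value theorem in each variable turns the second difference quotient over
  a small parallelogram into a value of either mixed derivative.\<close>

lemma pd_commute:
  fixes f :: "'a::real_normed_vector \<Rightarrow> real"
  assumes S: "open S" and f: "smooth_on S f" and x: "x \<in> S"
  shows "pd a (pd b f) x = pd b (pd a f) x"
proof (rule ccontr)
  assume ne: "pd a (pd b f) x \<noteq> pd b (pd a f) x"
  \<comment> \<open>Half the gap: one common value of the two mixed derivatives, each taken at a
    nearby point, cannot lie strictly within \<open>e\<close> of both of the values at
    \<open>x\<close>.\<close>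
  define e where "e = \<bar>pd a (pd b f) x - pd b (pd a f) x\<bar> / 2"
  have e: "e > 0" using ne by (simp add: e_def)
  have cont: "isCont (pd u (pd w f)) x" for u w
    using smooth_on_imp_continuous_on[OF smooth_on_pd[OF smooth_on_pd[OF f]]] S x
    by (simp add: continuous_on_eq_continuous_at)
  obtain d1 where d1: "d1 > 0" "\<And>y. dist y x < d1 \<Longrightarrow> \<bar>pd a (pd b f) y - pd a (pd b f) x\<bar> < e"
    using cont[of a b] e unfolding continuous_at_eps_delta dist_real_def by metis
  obtain d2 where d2: "d2 > 0" "\<And>y. dist y x < d2 \<Longrightarrow> \<bar>pd b (pd a f) y - pd b (pd a f) x\<bar> < e"
    using cont[of b a] e unfolding continuous_at_eps_delta dist_real_def by metis
  obtain d3 where d3: "d3 > 0" "ball x d3 \<subseteq> S" using S x open_contains_ball by blast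
  define d where "d = Min {d1, d2, d3}"
  have d: "d > 0" "d \<le> d1" "d \<le> d2" "d \<le> d3" using d1 d2 d3 by (auto simp: d_def)
  \<comment> \<open>With this side length the whole closed parallelogram spanned by
    \<open>h *\<^sub>R a\<close> and \<open>h *\<^sub>R b\<close> stays within distance
    \<open>d\<close> of \<open>x\<close>. The summand 1 keeps the denominator positive when both
    vectors vanish.\<close>
  define h where "h = d / (norm a + norm b + 1)"
  have pos: "norm a + norm b + 1 > 0" by (smt (verit) norm_ge_zero)
  have h: "h > 0" using d pos by (simp add: h_def)
  have near: "dist (x + s *\<^sub>R a + t *\<^sub>R b) x < d" if "0 \<le> s" "s \<le> h" "0 \<le> t" "t \<le> h" for s t
  proof -
    have "dist (x + s *\<^sub>R a + t *\<^sub>R b) x \<le> s * norm a + t * norm b"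
      using that norm_triangle_ineq[of "s *\<^sub>R a" "t *\<^sub>R b"] by (simp add: dist_norm add.assoc)
    also have "\<dots> \<le> h * (norm a + norm b)"
      using that by (simp add: distrib_left add_mono mult_right_mono)
    also have "\<dots> < h * (norm a + norm b + 1)" using h by simp
    also have "\<dots> = d" using pos by (simp add: h_def)
    finally show ?thesis .
  qed
  have inS: "x + s *\<^sub>R a + t *\<^sub>R b \<in> S" if "0 \<le> s" "s \<le> h" "0 \<le> t" "t \<le> h" for s t
    using near[OF that] d3 d by (auto simp: subset_iff dist_commute)
  have DA: "((\<lambda>s. F (x + s *\<^sub>R a + t *\<^sub>R b)) has_real_derivative pd a F (x + s *\<^sub>R a + t *\<^sub>R b)) (at s)"
    if "smooth_on S F" "0 \<le> s" "s \<le> h" "0 \<le> t" "t \<le> h" for F :: "'a \<Rightarrow> real" and s t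
  proof -
    have 1: "((\<lambda>s. x + s *\<^sub>R a + t *\<^sub>R b) has_derivative (\<lambda>r. r *\<^sub>R a)) (at s)"
      by (auto intro!: derivative_eq_intros)
    have F: "F differentiable (at (x + s *\<^sub>R a + t *\<^sub>R b))"
      using smooth_on_imp_differentiable[OF that(1) inS[OF that(2-)]] .
    interpret linear "\<lambda>v. pd v F (x + s *\<^sub>R a + t *\<^sub>R b)" by (rule linear_pd[OF F])
    show ?thesis
      using has_derivative_compose[OF 1 has_derivative_pd[OF F]]
      by (simp add: has_field_derivative_def scale mult.commute[of _ "pd a F _"])
  qed
  have DB: "((\<lambda>t. F (x + s *\<^sub>R a + t *\<^sub>R b)) has_real_derivative pd b F (x + s *\<^sub>R a + t *\<^sub>R b)) (at t)"
    if "smooth_on S F" "0 \<le> s" "s \<le> h" "0 \<le> t" "t \<le> h" for F :: "'a \<Rightarrow> real" and s t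
  proof -
    have 1: "((\<lambda>t. x + s *\<^sub>R a + t *\<^sub>R b) has_derivative (\<lambda>r. r *\<^sub>R b)) (at t)"
      by (auto intro!: derivative_eq_intros)
    have F: "F differentiable (at (x + s *\<^sub>R a + t *\<^sub>R b))"
      using smooth_on_imp_differentiable[OF that(1) inS[OF that(2-)]] .
    interpret linear "\<lambda>v. pd v F (x + s *\<^sub>R a + t *\<^sub>R b)" by (rule linear_pd[OF F])
    show ?thesis
      using has_derivative_compose[OF 1 has_derivative_pd[OF F]]
      by (simp add: has_field_derivative_def scale mult.commute[of _ "pd b F _"])
  qed
  have mvt: "\<exists>s. 0 < s \<and> s < h \<and> F h - F 0 = h * F' s"
    if "\<And>s. 0 \<le> s \<Longrightarrow> s \<le> h \<Longrightarrow> (F has_real_derivative F' s) (at s)" for F F'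
    using MVT2[OF h that] by auto
  \<comment> \<open>The terms with coefficient 0 are kept so that all four corners have the form
    required by \<open>DA\<close> and \<open>DB\<close>. The same second difference is grouped along
    \<open>a\<close> here and along \<open>b\<close> further down.\<close>
  have "\<exists>s. 0 < s \<and> s < h \<and> (f (x + h *\<^sub>R a + h *\<^sub>R b) - f (x + h *\<^sub>R a + 0 *\<^sub>R b))
      - (f (x + 0 *\<^sub>R a + h *\<^sub>R b) - f (x + 0 *\<^sub>R a + 0 *\<^sub>R b)) =
      h * (pd a f (x + s *\<^sub>R a + h *\<^sub>R b) - pd a f (x + s *\<^sub>R a + 0 *\<^sub>R b))"
    by (rule mvt[of "\<lambda>s. f (x + s *\<^sub>R a + h *\<^sub>R b) - f (x + s *\<^sub>R a + 0 *\<^sub>R b)"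
        "\<lambda>s. pd a f (x + s *\<^sub>R a + h *\<^sub>R b) - pd a f (x + s *\<^sub>R a + 0 *\<^sub>R b)"])
       (intro DERIV_diff DA[OF f]; use h in linarith)
  then obtain s where s: "0 < s" "s < h" and s1: "(f (x + h *\<^sub>R a + h *\<^sub>R b) - f (x + h *\<^sub>R a + 0 *\<^sub>R b))
      - (f (x + 0 *\<^sub>R a + h *\<^sub>R b) - f (x + 0 *\<^sub>R a + 0 *\<^sub>R b)) =
      h * (pd a f (x + s *\<^sub>R a + h *\<^sub>R b) - pd a f (x + s *\<^sub>R a + 0 *\<^sub>R b))"
    by blast
  have "\<exists>t. 0 < t \<and> t < h \<and> pd a f (x + s *\<^sub>R a + h *\<^sub>R b) - pd a f (x + s *\<^sub>R a + 0 *\<^sub>R b)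
      = h * pd b (pd a f) (x + s *\<^sub>R a + t *\<^sub>R b)"
    by (rule mvt[of "\<lambda>t. pd a f (x + s *\<^sub>R a + t *\<^sub>R b)" "\<lambda>t. pd b (pd a f) (x + s *\<^sub>R a + t *\<^sub>R b)"])
       (intro DB[OF smooth_on_pd[OF f]]; use s in linarith)
  then obtain t where t: "0 < t" "t < h" and t1:
    "pd a f (x + s *\<^sub>R a + h *\<^sub>R b) - pd a f (x + s *\<^sub>R a + 0 *\<^sub>R b) = h * pd b (pd a f) (x + s *\<^sub>R a + t *\<^sub>R b)"
    by blast
  have "\<exists>t. 0 < t \<and> t < h \<and> (f (x + h *\<^sub>R a + h *\<^sub>R b) - f (x + 0 *\<^sub>R a + h *\<^sub>R b))
      - (f (x + h *\<^sub>R a + 0 *\<^sub>R b) - f (x + 0 *\<^sub>R a + 0 *\<^sub>R b)) =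
      h * (pd b f (x + h *\<^sub>R a + t *\<^sub>R b) - pd b f (x + 0 *\<^sub>R a + t *\<^sub>R b))"
    by (rule mvt[of "\<lambda>t. f (x + h *\<^sub>R a + t *\<^sub>R b) - f (x + 0 *\<^sub>R a + t *\<^sub>R b)"
        "\<lambda>t. pd b f (x + h *\<^sub>R a + t *\<^sub>R b) - pd b f (x + 0 *\<^sub>R a + t *\<^sub>R b)"])
       (intro DERIV_diff DB[OF f]; use h in linarith)
  then obtain t' where t': "0 < t'" "t' < h" and t1': "(f (x + h *\<^sub>R a + h *\<^sub>R b) - f (x + 0 *\<^sub>R a + h *\<^sub>R b))
      - (f (x + h *\<^sub>R a + 0 *\<^sub>R b) - f (x + 0 *\<^sub>R a + 0 *\<^sub>R b)) =
      h * (pd b f (x + h *\<^sub>R a + t' *\<^sub>R b) - pd b f (x + 0 *\<^sub>R a + t' *\<^sub>R b))"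
    by blast
  have "\<exists>s. 0 < s \<and> s < h \<and> pd b f (x + h *\<^sub>R a + t' *\<^sub>R b) - pd b f (x + 0 *\<^sub>R a + t' *\<^sub>R b)
      = h * pd a (pd b f) (x + s *\<^sub>R a + t' *\<^sub>R b)"
    by (rule mvt[of "\<lambda>s. pd b f (x + s *\<^sub>R a + t' *\<^sub>R b)" "\<lambda>s. pd a (pd b f) (x + s *\<^sub>R a + t' *\<^sub>R b)"])
       (intro DA[OF smooth_on_pd[OF f]]; use t' in linarith)
  then obtain s' where s': "0 < s'" "s' < h" and s1':
    "pd b f (x + h *\<^sub>R a + t' *\<^sub>R b) - pd b f (x + 0 *\<^sub>R a + t' *\<^sub>R b) = h * pd a (pd b f) (x + s' *\<^sub>R a + t' *\<^sub>R b)"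
    by blast
  have "f (x + h *\<^sub>R a + h *\<^sub>R b) - f (x + h *\<^sub>R a + 0 *\<^sub>R b)
      - (f (x + 0 *\<^sub>R a + h *\<^sub>R b) - f (x + 0 *\<^sub>R a + 0 *\<^sub>R b))
    = f (x + h *\<^sub>R a + h *\<^sub>R b) - f (x + 0 *\<^sub>R a + h *\<^sub>R b)
      - (f (x + h *\<^sub>R a + 0 *\<^sub>R b) - f (x + 0 *\<^sub>R a + 0 *\<^sub>R b))" by linarith
  then have "h * (h * pd b (pd a f) (x + s *\<^sub>R a + t *\<^sub>R b)) = h * (h * pd a (pd b f) (x + s' *\<^sub>R a + t' *\<^sub>R b))"
    unfolding s1 t1 s1' t1' .
  then have eq: "pd b (pd a f) (x + s *\<^sub>R a + t *\<^sub>R b) = pd a (pd b f) (x + s' *\<^sub>R a + t' *\<^sub>R b)"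
    using h by simp
  have "\<bar>pd b (pd a f) (x + s *\<^sub>R a + t *\<^sub>R b) - pd b (pd a f) x\<bar> < e"
    using d2(2) near[of s t] s t d by force
  moreover have "\<bar>pd a (pd b f) (x + s' *\<^sub>R a + t' *\<^sub>R b) - pd a (pd b f) x\<bar> < e"
    using d1(2) near[of s' t'] s' t' d by force
  moreover have "2 * e = \<bar>pd a (pd b f) x - pd b (pd a f) x\<bar>" by (simp add: e_def)
  ultimately show False using eq by (simp add: abs_if split: if_splits)
qed


section \<open>Bump functions\<close>

text \<open>The case \<open>n = 0\<close> is the classical flat function exp(-1/x). The powers in
  the denominator make the family closed under differentiation up to linear combinations, so that
  one induction handles all derivatives.\<close>

definition flat_exp :: "nat \<Rightarrow> real \<Rightarrow> real" where
  "flat_exp n x = (if x \<le> 0 then 0 else exp (- inverse x) / x ^ n)"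

text \<open>Substituting y = 1/x on the right turns this into the decay of y^n / exp y at infinity;
  on the left the function is zero.\<close>

lemma tendsto_flat_exp_0: "flat_exp n \<midarrow>0\<rightarrow> 0"
proof -
  have "((\<lambda>x. x ^ n / exp x) \<longlongrightarrow> (0::real)) at_top" by (rule tendsto_power_div_exp_0)
  then have "((\<lambda>x. inverse x ^ n / exp (inverse x)) \<longlongrightarrow> (0::real)) (at_right 0)"
    by (rule filterlim_compose[OF _ filterlim_inverse_at_top_right])
  then have R: "(flat_exp n \<longlongrightarrow> 0) (at_right 0)"
    by (rule Lim_transform_eventually)
      (auto simp: eventually_at_right_field flat_exp_def exp_minus field_simps intro!: exI[of _ 1])
  have "((\<lambda>x. 0) \<longlongrightarrow> (0::real)) (at_left 0)" by simp
  then have L: "(flat_exp n \<longlongrightarrow> 0) (at_left 0)"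
    by (rule Lim_transform_eventually)
      (auto simp: eventually_at_left_field flat_exp_def intro!: exI[of _ "-1"])
  show ?thesis using L R by (simp add: filterlim_at_split)
qed

lemma DERIV_flat_exp:
  "(flat_exp n has_real_derivative flat_exp (n + 2) x - real n * flat_exp (n + 1) x) (at x)"
proof (cases "x = 0")
  case True
  \<comment> \<open>The difference quotient at 0 is itself \<open>flat_exp (Suc n)\<close>, whose
    limit is already known.\<close>
  have "(\<lambda>h. (flat_exp n (0 + h) - flat_exp n 0) / h) \<midarrow>0\<rightarrow> 0"
    by (rule Lim_transform_eventually[OF tendsto_flat_exp_0[of "Suc n"]])
      (auto simp: eventually_at flat_exp_def intro!: exI[of _ 1])
  then have "(flat_exp n has_real_derivative 0) (at 0)" by (simp add: DERIV_def)
  then show ?thesis using True by (simp add: flat_exp_def)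
next
  case False
  show ?thesis
  proof (cases "x < 0")
    case True
    have "(flat_exp n has_real_derivative 0) (at x)"
      by (rule has_field_derivative_transform_within_open[of "\<lambda>_. 0" _ _ "{..<0}"])
         (use True in \<open>auto simp: flat_exp_def\<close>)
    then show ?thesis using True by (simp add: flat_exp_def)
  next
    case F: False
    then have x: "x > 0" using False by simp
    have "((\<lambda>x. exp (- inverse x) / x ^ n) has_real_derivative
      flat_exp (n + 2) x - real n * flat_exp (n + 1) x) (at x)"
    proof -
      have "((\<lambda>x. exp (- inverse x)) has_real_derivative exp (- inverse x) / x\<^sup>2) (at x)"
        using x by (auto intro!: derivative_eq_intros simp: power2_eq_square field_simps)
      from DERIV_divide[OF this DERIV_pow[of n]] show ?thesis
        by (rule DERIV_cong)
           (use x in \<open>cases n; simp add: flat_exp_def field_simps power2_eq_square\<close>)+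
    qed
    then show ?thesis
      by (rule has_field_derivative_transform_within_open[where S="{0<..}"])
         (use x in \<open>auto simp: flat_exp_def\<close>)
  qed
qed

lemma smooth_on_flat_exp: "smooth_on UNIV (flat_exp n)"
  unfolding smooth_on_def
proof
  have d: "(flat_exp n has_derivative (\<lambda>v. (flat_exp (n + 2) x - real n * flat_exp (n + 1) x) * v)) (at x)"
    for n x using DERIV_flat_exp[of n x] by (simp add: has_field_derivative_def)
  fix k show "Ck_on k UNIV (flat_exp n)"
  proof (induction k arbitrary: n)
    case 0
    show ?case unfolding Ck_on.simps
      by (intro continuous_at_imp_continuous_on ballI DERIV_isCont[OF DERIV_flat_exp])
  next
    case (Suc k)
    have "Ck_on k UNIV (\<lambda>x. (flat_exp (n + 2) x + (- real n) * flat_exp (n + 1) x) * v)" for v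
      by (intro Ck_on_bilinear[OF bounded_bilinear_mult] Ck_on_add open_UNIV Ck_on_const Suc)
    moreover have "pd v (flat_exp n) = (\<lambda>x. (flat_exp (n + 2) x + (- real n) * flat_exp (n + 1) x) * v)" for v
      using pd_eqI[OF d] by (simp add: fun_eq_iff)
    ultimately show ?case using differentiableI[OF d] by (simp add: Ck_on_Suc_pd)
  qed
qed

lemma smooth_bump:
  fixes a :: "'a::euclidean_space"
  assumes "r > 0"
  obtains b :: "'a \<Rightarrow> real" where "smooth_on UNIV b" "b a = 1" "\<And>x. x \<notin> cball a r \<Longrightarrow> b x = 0"
proof
  define c where "c = flat_exp 0 (r\<^sup>2)"
  \<comment> \<open>The squared distance is polynomial, hence smooth at the centre as well, unlike
    the norm. Division by \<open>c\<close>, the value at the centre, normalises the peak to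
    1.\<close>
  define b where "b = (\<lambda>x. flat_exp 0 (r\<^sup>2 - (x - a) \<bullet> (x - a)) * inverse c)"
  have c: "c > 0" using assms by (simp add: c_def flat_exp_def)
  show "smooth_on UNIV b" unfolding b_def
    by (intro smooth_intros open_UNIV smooth_on_compose[OF _ _ smooth_on_flat_exp]) auto
  show "b a = 1" using c by (simp add: b_def flip: c_def)
  fix x assume "x \<notin> cball a r"
  then have "r < norm (x - a)" by (simp add: dist_norm norm_minus_commute)
  then have "r\<^sup>2 \<le> (norm (x - a))\<^sup>2" using assms by (simp add: power_mono)
  then show "b x = 0" by (simp add: b_def flat_exp_def power2_norm_eq_inner)
qed

section \<open>Integrals depending on parameters\<close>

text \<open>Differentiation under the integral sign. The open set \<Omega> surrounds
  \<open>S \<times> {0..1}\<close>, so that two-sided derivatives of \<open>G\<close> exist at the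
  end points of the interval too.\<close>

lemma has_derivative_integral_param:
  fixes G :: "'a::euclidean_space \<times> real \<Rightarrow> real"
  assumes S: "open S" and O: "open \<Omega>" and SO: "S \<times> {0..1} \<subseteq> \<Omega>" and G: "smooth_on \<Omega> G"
    and x0: "x0 \<in> S"
  shows "((\<lambda>x. integral {0..1} (\<lambda>t. G (x, t))) has_derivative
           (\<lambda>v. integral {0..1} (\<lambda>t. pd (v, 0) G (x0, t)))) (at x0)"
proof -
  obtain e where e: "e > 0" "ball x0 e \<subseteq> S" using S x0 open_contains_ball by blast
  \<comment> \<open>\<open>leibniz_rule\<close> wants the derivative as a continuous family of
    bounded linear maps. In finite dimension this continuity can be tested on basis vectors, where
    it is continuity of a directional derivative.\<close>
  define fx where "fx = (\<lambda>x t. Blinfun (\<lambda>v. pd (v, 0) G (x, t)))"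
  have diff: "G differentiable (at (x, t))" if "x \<in> S" "t \<in> {0..1}" for x t
    using smooth_on_imp_differentiable[OF G] SO that by blast
  have bl: "bounded_linear (\<lambda>v. pd (v, 0) G (x, t))" if "x \<in> S" "t \<in> {0..1}" for x t
  proof -
    have "bounded_linear (\<lambda>v. (v, 0::real))"
      by (intro bounded_linear_Pair bounded_linear_ident bounded_linear_zero)
    then show ?thesis
      using bounded_linear_compose[OF has_derivative_bounded_linear[OF has_derivative_pd[OF diff[OF that]]]]
      by fast
  qed
  have fx: "blinfun_apply (fx x t) v = pd (v, 0) G (x, t)" if "x \<in> S" "t \<in> {0..1}" for x t v
    unfolding fx_def by (simp add: bounded_linear_Blinfun_apply[OF bl[OF that]])
  have cont: "continuous_on (ball x0 e \<times> cbox 0 1) (\<lambda>(x, t). fx x t)"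
  proof (rule continuous_on_blinfun_componentwise)
    fix i :: 'a assume "i \<in> Basis"
    have "continuous_on (ball x0 e \<times> cbox 0 1) (pd (i, 0) G)"
      by (rule continuous_on_subset[OF smooth_on_imp_continuous_on[OF smooth_on_pd[OF G]]])
         (use SO e in auto)
    moreover have "pd (i, 0) G p = blinfun_apply (case p of (x, t) \<Rightarrow> fx x t) i"
      if "p \<in> ball x0 e \<times> cbox 0 1" for p
      using that e fx by (cases p) auto
    ultimately show "continuous_on (ball x0 e \<times> cbox 0 1) (\<lambda>p. blinfun_apply (case p of (x, t) \<Rightarrow> fx x t) i)"
      by (simp cong: continuous_on_cong)
  qed
  have D: "((\<lambda>x. G (x, t)) has_derivative blinfun_apply (fx x t)) (at x within ball x0 e)"
    if "x \<in> ball x0 e" "t \<in> cbox 0 1" for x t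
  proof -
    have xt: "x \<in> S" "t \<in> {0..1}" using that e by auto
    have "((\<lambda>x. (x, t)) has_derivative (\<lambda>v. (v, 0))) (at x)"
      by (auto intro!: derivative_eq_intros)
    from has_derivative_compose[OF this has_derivative_pd[OF diff[OF xt]]]
    have "((\<lambda>x. G (x, t)) has_derivative (\<lambda>v. pd (v, 0) G (x, t))) (at x)" .
    moreover have "blinfun_apply (fx x t) = (\<lambda>v. pd (v, 0) G (x, t))" using fx[OF xt] by auto
    ultimately show ?thesis using has_derivative_at_withinI by metis
  qed
  have int: "(\<lambda>t. G (x, t)) integrable_on cbox 0 1" if "x \<in> ball x0 e" for x
  proof (rule integrable_continuous)
    show "continuous_on (cbox 0 1) (\<lambda>t. G (x, t))"
      by (rule continuous_on_compose2[OF smooth_on_imp_continuous_on[OF G]])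
        (use that e SO in \<open>auto intro!: continuous_intros\<close>)
  qed
  have x0e: "x0 \<in> ball x0 e" using e by simp
  have "((\<lambda>x. integral (cbox 0 1) (\<lambda>t. G (x, t))) has_derivative
    blinfun_apply (integral (cbox 0 1) (fx x0))) (at x0 within ball x0 e)"
    by (rule leibniz_rule[OF D int cont x0e convex_ball])
  then have "((\<lambda>x. integral {0..1} (\<lambda>t. G (x, t))) has_derivative
    blinfun_apply (integral {0..1} (fx x0))) (at x0)"
    using at_within_open[OF x0e open_ball] by simp
  moreover have "blinfun_apply (integral {0..1} (fx x0)) = (\<lambda>v. integral {0..1} (\<lambda>t. pd (v, 0) G (x0, t)))"
  proof
    fix v
    have "continuous_on (cbox 0 1) (\<lambda>t. case (x0, t) of (x, t) \<Rightarrow> fx x t)"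
      by (rule continuous_on_compose2[OF cont]) (use x0e in \<open>auto intro!: continuous_intros\<close>)
    then have "fx x0 integrable_on {0..1}"
      using integrable_continuous[of 0 1 "fx x0"] by simp
    then have "blinfun_apply (integral {0..1} (fx x0)) v = integral {0..1} (\<lambda>t. blinfun_apply (fx x0 t) v)"
      by (rule blinfun_apply_integral)
    also have "\<dots> = integral {0..1} (\<lambda>t. pd (v, 0) G (x0, t))"
      using fx[OF x0] by (intro integral_cong) auto
    finally show "blinfun_apply (integral {0..1} (fx x0)) v = integral {0..1} (\<lambda>t. pd (v, 0) G (x0, t))" .
  qed
  ultimately show ?thesis by simp
qed

text \<open>The derivative of such a parameter integral is again one, with
  \<open>pd (v, 0) G\<close> as integrand; this closes the induction on the order.\<close>

lemma smooth_on_integral_param: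
  fixes G :: "'a::euclidean_space \<times> real \<Rightarrow> real"
  assumes S: "open S" and O: "open \<Omega>" and SO: "S \<times> {0..1} \<subseteq> \<Omega>" and "smooth_on \<Omega> G"
  shows "smooth_on S (\<lambda>x. integral {0..1} (\<lambda>t. G (x, t)))"
  unfolding smooth_on_def
proof
  fix k show "Ck_on k S (\<lambda>x. integral {0..1} (\<lambda>t. G (x, t)))" using assms(4)
  proof (induction k arbitrary: G)
    case 0
    show ?case unfolding Ck_on.simps
      by (rule continuous_at_imp_continuous_on)
         (use has_derivative_continuous[OF has_derivative_integral_param[OF S O SO 0]] in blast)
  next
    case (Suc k)
    note d = has_derivative_integral_param[OF S O SO Suc.prems]
    have "Ck_on k S (pd v (\<lambda>x. integral {0..1} (\<lambda>t. G (x, t))))" for v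
      using Suc.IH[OF smooth_on_pd[OF Suc.prems], of "(v, 0)"] pd_eqI[OF d]
        Ck_on_cong[OF S, of "pd v (\<lambda>x. integral {0..1} (\<lambda>t. G (x, t)))"] by simp
    then show ?case using d by (auto simp: Ck_on_Suc_pd differentiable_def)
  qed
qed

lemma integral_FTC:
  fixes F F' :: "real \<Rightarrow> real"
  assumes "\<And>t. t \<in> {0..1} \<Longrightarrow> (F has_real_derivative F' t) (at t)"
  shows "integral {0..1} F' = F 1 - F 0"
  using fundamental_theorem_of_calculus[of 0 1 F F'] assms
  by (intro integral_unique)
     (auto simp: has_real_derivative_iff_has_vector_derivative intro: has_vector_derivative_at_within)

section \<open>Primitives of closed forms\<close>

lemma fibre_primitive:
  fixes \<beta> :: "'n::finite \<Rightarrow> 'a::euclidean_space \<times> (real ^ 'n) \<Rightarrow> real"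
  assumes B: "open B" and \<beta>: "\<And>i. smooth_on (B \<times> UNIV) (\<beta> i)"
    and closed: "\<And>i j x. x \<in> B \<times> UNIV \<Longrightarrow> pd (0, axis i 1) (\<beta> j) x = pd (0, axis j 1) (\<beta> i) x"
  obtains D where "smooth_on (B \<times> UNIV) D"
    "\<And>i x. x \<in> B \<times> UNIV \<Longrightarrow> pd (0, axis i 1) D x = \<beta> i x"
proof
  define W where "W = B \<times> (UNIV :: (real ^ 'n) set)"
  have W: "open W" using B by (simp add: W_def open_Times)
  define \<sigma> :: "('a \<times> (real ^ 'n)) \<times> real \<Rightarrow> 'a \<times> (real ^ 'n)"
    where "\<sigma> = (\<lambda>p. (fst (fst p), snd p *\<^sub>R snd (fst p)))"
  define G where "G = (\<lambda>p. \<Sum>i\<in>UNIV. \<beta> i (\<sigma> p) * snd (fst p) $ i)"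
  define D where "D = (\<lambda>x. integral {0..1} (\<lambda>t. G (x, t)))"
  have O: "open (W \<times> (UNIV :: real set))" using W by (simp add: open_Times)
  have \<sigma>: "smooth_on (W \<times> UNIV) \<sigma>" unfolding \<sigma>_def by (intro smooth_intros O)
  have \<beta>\<sigma>: "smooth_on (W \<times> UNIV) (\<lambda>p. \<beta> i (\<sigma> p))" for i
    by (rule smooth_on_compose[OF O \<sigma> \<beta>]) (auto simp: \<sigma>_def W_def)
  have G: "smooth_on (W \<times> UNIV) G" unfolding G_def by (intro smooth_intros O \<beta>\<sigma>)
  show "smooth_on (B \<times> UNIV) D" unfolding D_def W_def[symmetric]
    by (rule smooth_on_integral_param[OF W O _ G]) auto
  fix j x assume "x \<in> B \<times> (UNIV :: (real ^ 'n) set)"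
  then have x: "x \<in> W" by (simp add: W_def)
  have d\<sigma>: "(\<sigma> has_derivative (\<lambda>h. (fst (fst h), snd h *\<^sub>R snd (fst p) + snd p *\<^sub>R snd (fst h)))) (at p)" for p
    unfolding \<sigma>_def by (auto intro!: derivative_eq_intros)
  have \<beta>d: "\<beta> i differentiable (at (\<sigma> (x, t)))" for i t
    using x smooth_on_imp_differentiable[OF \<beta>, of "\<sigma> (x, t)" i] by (auto simp: \<sigma>_def W_def)
  have \<beta>\<sigma>d: "((\<lambda>p. \<beta> i (\<sigma> p)) has_derivative
      (\<lambda>h. pd (fst (fst h), snd h *\<^sub>R snd x + t *\<^sub>R snd (fst h)) (\<beta> i) (\<sigma> (x, t)))) (at (x, t))" for i t
    using has_derivative_compose[OF d\<sigma> has_derivative_pd[OF \<beta>d]] by simp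
  \<comment> \<open>Closedness has exchanged the two indices in the first summand. In this form the
    right-hand side is the derivative with respect to \<open>t\<close> of
    \<open>t * \<beta> j (\<sigma> (x, t))\<close>, so the integral can be evaluated.\<close>
  have key: "pd ((0, axis j 1), 0) G (x, t) =
      (\<Sum>i\<in>UNIV. snd x $ i * pd (0, axis i 1) (\<beta> j) (\<sigma> (x, t))) * t + \<beta> j (\<sigma> (x, t))" for t
  proof -
    interpret l: linear "\<lambda>v. pd v (\<beta> i) (\<sigma> (x, t))" for i by (rule linear_pd[OF \<beta>d])
    have "(G has_derivative (\<lambda>h. \<Sum>i\<in>UNIV. \<beta> i (\<sigma> (x, t)) * snd (fst h) $ i +
        pd (fst (fst h), snd h *\<^sub>R snd x + t *\<^sub>R snd (fst h)) (\<beta> i) (\<sigma> (x, t)) * snd x $ i)) (at (x, t))"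
      unfolding G_def
      by (intro has_derivative_sum has_derivative_eq_rhs[OF has_derivative_mult[OF \<beta>\<sigma>d
            bounded_linear_imp_has_derivative[of "\<lambda>p. snd (fst p) $ _"]]])
         (auto intro!: bounded_linear_compose[OF bounded_linear_vec_nth]
            bounded_linear_compose[OF bounded_linear_snd] bounded_linear_fst)
    from pd_eqI[OF this, of "((0, axis j 1), 0)"]
    have "pd ((0, axis j 1), 0) G (x, t) = (\<Sum>i\<in>UNIV. \<beta> i (\<sigma> (x, t)) * axis j 1 $ i +
        pd (0, t *\<^sub>R axis j 1) (\<beta> i) (\<sigma> (x, t)) * snd x $ i)" by simp
    also have "\<dots> = (\<Sum>i\<in>UNIV. (if i = j then \<beta> i (\<sigma> (x, t)) else 0)) +
        (\<Sum>i\<in>UNIV. pd (t *\<^sub>R (0, axis j 1)) (\<beta> i) (\<sigma> (x, t)) * snd x $ i)"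
      unfolding sum.distrib[symmetric] by (intro sum.cong refl) (auto simp: axis_def)
    also have "(\<Sum>i\<in>UNIV. pd (t *\<^sub>R (0, axis j 1)) (\<beta> i) (\<sigma> (x, t)) * snd x $ i) =
        (\<Sum>i\<in>UNIV. snd x $ i * pd (0, axis i 1) (\<beta> j) (\<sigma> (x, t))) * t"
      unfolding l.scale sum_distrib_right
      by (intro sum.cong refl)
         (use x closed[of "\<sigma> (x, t)" j] in \<open>auto simp: \<sigma>_def W_def\<close>)
    finally show ?thesis by simp
  qed
  have "pd (0, axis j 1) D x = integral {0..1} (\<lambda>t. pd ((0, axis j 1), 0) G (x, t))"
    unfolding D_def by (rule pd_eqI[OF has_derivative_integral_param[OF W O _ G x]]) auto
  also have "\<dots> = 1 * \<beta> j (\<sigma> (x, 1)) - 0 * \<beta> j (\<sigma> (x, 0))"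
  proof (rule integral_FTC)
    fix t :: real
    interpret l: linear "\<lambda>v. pd v (\<beta> j) (\<sigma> (x, t))" by (rule linear_pd[OF \<beta>d])
    have "((\<lambda>t. (x, t)) has_derivative (\<lambda>h. (0, h))) (at t)"
      by (auto intro!: derivative_eq_intros)
    from has_derivative_compose[OF this \<beta>\<sigma>d[of j t]]
    have "((\<lambda>t. \<beta> j (\<sigma> (x, t))) has_derivative (\<lambda>h. pd (h *\<^sub>R (0, snd x)) (\<beta> j) (\<sigma> (x, t)))) (at t)"
      by simp
    then have "((\<lambda>t. \<beta> j (\<sigma> (x, t))) has_real_derivative pd (0, snd x) (\<beta> j) (\<sigma> (x, t))) (at t)"
      unfolding l.scale has_field_derivative_def by (rule has_derivative_eq_rhs) (simp add: fun_eq_iff)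
    moreover have "pd (0, snd x) (\<beta> j) (\<sigma> (x, t)) = (\<Sum>i\<in>UNIV. snd x $ i * pd (0, axis i 1) (\<beta> j) (\<sigma> (x, t)))"
    proof -
      have "(0, snd x) = (\<Sum>i\<in>UNIV. (snd x $ i) *\<^sub>R ((0::'a), axis i 1))"
        by (simp add: prod_eq_iff fst_sum snd_sum vec_expand)
      then show ?thesis by (simp only: l.sum l.scale real_scaleR_def)
    qed
    ultimately have d: "((\<lambda>t. \<beta> j (\<sigma> (x, t))) has_real_derivative
        (\<Sum>i\<in>UNIV. snd x $ i * pd (0, axis i 1) (\<beta> j) (\<sigma> (x, t)))) (at t)" by simp
    show "((\<lambda>t. t * \<beta> j (\<sigma> (x, t))) has_real_derivative pd ((0, axis j 1), 0) G (x, t)) (at t)"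
      unfolding key by (rule DERIV_cong[OF DERIV_mult[OF DERIV_ident d]]) simp
  qed
  finally show "pd (0, axis j 1) D x = \<beta> j x" by (simp add: \<sigma>_def)
qed

lemma closed_two_form_primitive:
  fixes \<omega> :: "'n::finite \<Rightarrow> 'n \<Rightarrow> real ^ 'n \<Rightarrow> real"
  assumes B: "open B" "convex B" and q0: "q0 \<in> B" and \<omega>: "\<And>i j. smooth_on B (\<omega> i j)"
    and anti: "\<And>i j q. q \<in> B \<Longrightarrow> \<omega> i j q = - \<omega> j i q"
    and closed: "\<And>i j k q. q \<in> B \<Longrightarrow>
      pd (axis k 1) (\<omega> i j) q + pd (axis i 1) (\<omega> j k) q + pd (axis j 1) (\<omega> k i) q = 0"
  obtains \<alpha> where "\<And>i. smooth_on B (\<alpha> i)"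
    "\<And>i j q. q \<in> B \<Longrightarrow> pd (axis i 1) (\<alpha> j) q - pd (axis j 1) (\<alpha> i) q = \<omega> i j q"
proof
  define \<sigma> where "\<sigma> = (\<lambda>p :: (real ^ 'n) \<times> real. q0 + snd p *\<^sub>R (fst p - q0))"
  \<comment> \<open>All pairs for which the contracted point lies in \<open>B\<close>. It is open,
    and by convexity it contains \<open>B \<times> {0..1}\<close>, as differentiation under the
    integral requires.\<close>
  define \<Omega> where "\<Omega> = \<sigma> -` B"
  define G where "G = (\<lambda>i p. snd p * (\<Sum>j\<in>UNIV. \<omega> j i (\<sigma> p) * (fst p - q0) $ j))"
  define \<alpha> where "\<alpha> = (\<lambda>i q. integral {0..1} (\<lambda>t. G i (q, t)))"
  have O: "open \<Omega>" unfolding \<Omega>_def \<sigma>_def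
    by (rule open_vimage[OF B(1)]) (intro continuous_intros)
  have sB: "\<sigma> (q, t) \<in> B" if "q \<in> B" "t \<in> {0..1}" for q t
    using convexD_alt[OF B(2) q0 that(1), of t] that(2) by (simp add: \<sigma>_def algebra_simps)
  have SO: "B \<times> {0..1} \<subseteq> \<Omega>" using sB by (auto simp: \<Omega>_def)
  have \<sigma>: "smooth_on \<Omega> \<sigma>" unfolding \<sigma>_def by (intro smooth_intros O)
  have \<omega>\<sigma>: "smooth_on \<Omega> (\<lambda>p. \<omega> i j (\<sigma> p))" for i j
    by (rule smooth_on_compose[OF O \<sigma> \<omega>]) (auto simp: \<Omega>_def)
  have G: "smooth_on \<Omega> (G i)" for i unfolding G_def by (intro smooth_intros O \<omega>\<sigma>)
  show "smooth_on B (\<alpha> i)" for i unfolding \<alpha>_def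
    by (rule smooth_on_integral_param[OF B(1) O SO G])
  fix k i q assume q: "q \<in> B"
  let ?u = "q - q0"
  have d\<sigma>: "(\<sigma> has_derivative (\<lambda>h. snd h *\<^sub>R (fst p - q0) + snd p *\<^sub>R fst h)) (at p)" for p
    unfolding \<sigma>_def by (auto intro!: derivative_eq_intros)
  have \<omega>d: "\<omega> j i differentiable (at (\<sigma> (q, t)))" if "t \<in> {0..1}" for i j t
    using smooth_on_imp_differentiable[OF \<omega> sB[OF q that]] .
  have \<omega>\<sigma>d: "((\<lambda>p. \<omega> j i (\<sigma> p)) has_derivative
      (\<lambda>h. pd (snd h *\<^sub>R ?u + t *\<^sub>R fst h) (\<omega> j i) (\<sigma> (q, t)))) (at (q, t))" if "t \<in> {0..1}" for i j t
    using has_derivative_compose[OF d\<sigma> has_derivative_pd[OF \<omega>d[OF that]]] by simp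
  \<comment> \<open>One factor \<open>t\<close> is the weight in \<open>G\<close>, the other comes
    from the chain rule through \<sigma>.\<close>
  have key: "pd (axis k 1, 0) (G i) (q, t) =
      t\<^sup>2 * (\<Sum>j\<in>UNIV. ?u $ j * pd (axis k 1) (\<omega> j i) (\<sigma> (q, t))) + t * \<omega> k i (\<sigma> (q, t))"
    if t: "t \<in> {0..1}" for t i k
  proof -
    interpret l: linear "\<lambda>v. pd v (\<omega> j i) (\<sigma> (q, t))" for j by (rule linear_pd[OF \<omega>d[OF t]])
    have "((\<lambda>p. \<Sum>j\<in>UNIV. \<omega> j i (\<sigma> p) * (fst p - q0) $ j) has_derivative
        (\<lambda>h. \<Sum>j\<in>UNIV. \<omega> j i (\<sigma> (q, t)) * fst h $ j +
        pd (snd h *\<^sub>R ?u + t *\<^sub>R fst h) (\<omega> j i) (\<sigma> (q, t)) * ?u $ j)) (at (q, t))"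
    proof (rule has_derivative_sum)
      fix j
      have "((\<lambda>p :: (real ^ 'n) \<times> real. fst p - q0) has_derivative fst) (at (q, t))"
        by (auto intro!: derivative_eq_intros)
      from bounded_linear.has_derivative[OF bounded_linear_vec_nth this, of j]
      have "((\<lambda>p :: (real ^ 'n) \<times> real. (fst p - q0) $ j) has_derivative (\<lambda>h. fst h $ j)) (at (q, t))" .
      from has_derivative_mult[OF \<omega>\<sigma>d[OF t, of j i] this]
      show "((\<lambda>p. \<omega> j i (\<sigma> p) * (fst p - q0) $ j) has_derivative
        (\<lambda>h. \<omega> j i (\<sigma> (q, t)) * fst h $ j +
        pd (snd h *\<^sub>R ?u + t *\<^sub>R fst h) (\<omega> j i) (\<sigma> (q, t)) * ?u $ j)) (at (q, t))" by simp
    qed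
    from pd_eqI[OF has_derivative_mult[OF has_derivative_snd[OF has_derivative_ident] this], of "(axis k 1, 0)"]
    have "pd (axis k 1, 0) (G i) (q, t) = t * (\<Sum>j\<in>UNIV. \<omega> j i (\<sigma> (q, t)) * axis k 1 $ j +
        pd (t *\<^sub>R axis k 1) (\<omega> j i) (\<sigma> (q, t)) * ?u $ j)" unfolding G_def by simp
    also have "(\<Sum>j\<in>UNIV. \<omega> j i (\<sigma> (q, t)) * axis k 1 $ j +
        pd (t *\<^sub>R axis k 1) (\<omega> j i) (\<sigma> (q, t)) * ?u $ j) =
        (\<Sum>j\<in>UNIV. (if j = k then \<omega> j i (\<sigma> (q, t)) else 0) +
        t * (?u $ j * pd (axis k 1) (\<omega> j i) (\<sigma> (q, t))))"
      unfolding l.scale by (intro sum.cong refl) (auto simp: axis_def)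
    also have "\<dots> = \<omega> k i (\<sigma> (q, t)) + t * (\<Sum>j\<in>UNIV. ?u $ j * pd (axis k 1) (\<omega> j i) (\<sigma> (q, t)))"
      by (simp add: sum.distrib sum_distrib_left)
    finally show ?thesis by (simp add: algebra_simps power2_eq_square)
  qed
  have int: "(\<lambda>t. pd (axis k 1, 0) (G i) (q, t)) integrable_on {0..1}" for i k
  proof (rule integrable_continuous_interval)
    show "continuous_on {0..1} (\<lambda>t. pd (axis k 1, 0) (G i) (q, t))"
      by (rule continuous_on_compose2[OF smooth_on_imp_continuous_on[OF smooth_on_pd[OF G]]])
        (use q SO in \<open>auto intro!: continuous_intros\<close>)
  qed
  have "pd (axis k 1) (\<alpha> i) q - pd (axis i 1) (\<alpha> k) q =
      integral {0..1} (\<lambda>t. pd (axis k 1, 0) (G i) (q, t)) - integral {0..1} (\<lambda>t. pd (axis i 1, 0) (G k) (q, t))"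
    unfolding \<alpha>_def pd_eqI[OF has_derivative_integral_param[OF B(1) O SO G q]] ..
  also have "\<dots> = integral {0..1} (\<lambda>t. pd (axis k 1, 0) (G i) (q, t) - pd (axis i 1, 0) (G k) (q, t))"
    by (rule integral_diff[OF int int, symmetric])
  also have "\<dots> = 1\<^sup>2 * \<omega> k i (\<sigma> (q, 1)) - 0\<^sup>2 * \<omega> k i (\<sigma> (q, 0))"
  proof (rule integral_FTC)
    fix t :: real assume t: "t \<in> {0..1}"
    interpret l: linear "\<lambda>v. pd v (\<omega> j i) (\<sigma> (q, t))" for i j by (rule linear_pd[OF \<omega>d[OF t]])
    have "((\<lambda>t. (q, t)) has_derivative (\<lambda>h. (0, h))) (at t)"
      by (auto intro!: derivative_eq_intros)
    from has_derivative_compose[OF this \<omega>\<sigma>d[OF t]]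
    have "((\<lambda>t. \<omega> k i (\<sigma> (q, t))) has_derivative (\<lambda>h. pd (h *\<^sub>R ?u) (\<omega> k i) (\<sigma> (q, t)))) (at t)"
      by simp
    then have "((\<lambda>t. \<omega> k i (\<sigma> (q, t))) has_real_derivative pd ?u (\<omega> k i) (\<sigma> (q, t))) (at t)"
      unfolding l.scale has_field_derivative_def by (rule has_derivative_eq_rhs) (simp add: fun_eq_iff)
    then have d: "((\<lambda>t. \<omega> k i (\<sigma> (q, t))) has_real_derivative
        (\<Sum>j\<in>UNIV. ?u $ j * pd (axis j 1) (\<omega> k i) (\<sigma> (q, t)))) (at t)"
      unfolding pd_vec_expand[OF \<omega>d[OF t], of ?u] by simp
    \<comment> \<open>The closedness relation, with two of its three terms rewritten by
      antisymmetry. It turns the difference of the sums in \<open>key\<close> into the derivative of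
      \<omega> along the segment.\<close>
    have c: "pd (axis k 1) (\<omega> j i) (\<sigma> (q, t)) - pd (axis i 1) (\<omega> j k) (\<sigma> (q, t)) =
        pd (axis j 1) (\<omega> k i) (\<sigma> (q, t))" for j
    proof -
      have "pd v (\<omega> a b) (\<sigma> (q, t)) = - pd v (\<omega> b a) (\<sigma> (q, t))" for v a b
      proof -
        have "pd v (\<omega> a b) (\<sigma> (q, t)) = pd v (\<lambda>q. - 1 * \<omega> b a q) (\<sigma> (q, t))"
          by (rule pd_transform[OF B(1) sB[OF q t]]) (use anti[of _ a b] in simp)
        also have "\<dots> = - 1 * pd v (\<omega> b a) (\<sigma> (q, t))" by (rule pd_cmult[OF \<omega>d[OF t]])
        finally show ?thesis by simp
      qed
      from this[of "axis k 1" j i] this[of "axis j 1" k i]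
      show ?thesis using closed[OF sB[OF q t], of k i j] by simp
    qed
    have "((\<lambda>t. t\<^sup>2 * \<omega> k i (\<sigma> (q, t))) has_real_derivative
      2 * t * \<omega> k i (\<sigma> (q, t)) + t\<^sup>2 * (\<Sum>j\<in>UNIV. ?u $ j * pd (axis j 1) (\<omega> k i) (\<sigma> (q, t)))) (at t)"
      by (rule DERIV_cong[OF DERIV_mult[OF DERIV_pow d]]) simp
    moreover have "pd (axis k 1, 0) (G i) (q, t) - pd (axis i 1, 0) (G k) (q, t) =
      2 * t * \<omega> k i (\<sigma> (q, t)) + t\<^sup>2 * (\<Sum>j\<in>UNIV. ?u $ j * pd (axis j 1) (\<omega> k i) (\<sigma> (q, t)))"
      unfolding key[OF t] c[symmetric] anti[OF sB[OF q t], of i k]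
        right_diff_distrib sum_subtractf by (simp only: mult_minus_right)
    ultimately show "((\<lambda>t. t\<^sup>2 * \<omega> k i (\<sigma> (q, t))) has_real_derivative
      pd (axis k 1, 0) (G i) (q, t) - pd (axis i 1, 0) (G k) (q, t)) (at t)" by simp
  qed
  finally show "pd (axis k 1) (\<alpha> i) q - pd (axis i 1) (\<alpha> k) q = \<omega> k i q" by (simp add: \<sigma>_def)
qed

section \<open>Local solutions of ordinary differential equations\<close>

text \<open>Bootstrapping: if \<open>z\<close> is of class k, then so is its derivative
  \<open>F (z t)\<close>, hence \<open>z\<close> is of class k + 1.\<close>

lemma smooth_on_solution:
  fixes F :: "'a::euclidean_space \<Rightarrow> 'a"
  assumes W: "open W" "smooth_on W F" and I: "open I"
    and z: "\<And>t. t \<in> I \<Longrightarrow> z t \<in> W" "\<And>t. t \<in> I \<Longrightarrow> (z has_vector_derivative F (z t)) (at t)"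
  shows "smooth_on I z"
  unfolding smooth_on_def
proof
  have d: "(z has_derivative (\<lambda>v. v *\<^sub>R F (z t))) (at t)" if "t \<in> I" for t
    using z(2)[OF that] by (simp add: has_vector_derivative_def)
  fix k show "Ck_on k I z"
  proof (induction k)
    case 0
    show ?case unfolding Ck_on.simps
      by (rule continuous_at_imp_continuous_on) (use has_derivative_continuous[OF d] in blast)
  next
    case (Suc k)
    have "Ck_on k I (\<lambda>t. v *\<^sub>R F (z t))" for v
      by (rule Ck_on_bounded_linear[OF bounded_linear_scaleR_right I])
         (rule Ck_on_compose[OF I Suc, of W], use W z in \<open>auto simp: smooth_on_def\<close>)
    then have "Ck_on k I (pd v z)" for v
      using Ck_on_cong[OF I, of "pd v z"] pd_eqI[OF d] by simp
    then show ?case using differentiableI[OF d] by (simp add: Ck_on_Suc_pd)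
  qed
qed

text \<open>Composing with the projection onto a closed ball makes the right-hand side globally
  Lipschitz and bounded, so that the Picard operator is a contraction of the whole space of
  bounded continuous functions.\<close>

lemma ODE_solution:
  fixes F :: "'a::euclidean_space \<Rightarrow> 'a"
  assumes W: "open W" "smooth_on W F" and z0: "z0 \<in> W"
  obtains \<delta> z where "\<delta> > 0" "z 0 = z0" "\<And>t. t \<in> {-\<delta><..<\<delta>} \<Longrightarrow> z t \<in> W"
    "\<And>t. t \<in> {-\<delta><..<\<delta>} \<Longrightarrow> (z has_vector_derivative F (z t)) (at t)"
proof -
  obtain r where r: "r > 0" "cball z0 r \<subseteq> W" using W(1) z0 open_contains_cball by blast
  define K where "K = cball z0 r"
  have K: "compact K" "convex K" "closed K" "K \<noteq> {}" "K \<subseteq> W" using r by (auto simp: K_def)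
  have "bounded (F ` K)"
    by (intro compact_imp_bounded compact_continuous_image K(1)
        continuous_on_subset[OF smooth_on_imp_continuous_on[OF W(2)] K(5)])
  then obtain M where M: "\<And>x. x \<in> K \<Longrightarrow> norm (F x) \<le> M" by (auto simp: bounded_iff)
  have M0: "M \<ge> 0" using M K(4) norm_ge_zero order_trans by blast
  \<comment> \<open>This sum dominates the operator norm of the derivative and is continuous, hence
    bounded on the compact ball; its bound serves as Lipschitz constant there.\<close>
  have "bounded ((\<lambda>x. \<Sum>b\<in>Basis. norm (pd b F x)) ` K)"
    by (intro compact_imp_bounded compact_continuous_image K(1) continuous_intros
        continuous_on_subset[OF smooth_on_imp_continuous_on[OF smooth_on_pd[OF W(2)]] K(5)])
  then obtain B where B: "\<And>x. x \<in> K \<Longrightarrow> (\<Sum>b\<in>Basis. norm (pd b F x)) \<le> B"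
    by (auto simp: bounded_iff abs_le_iff)
  have B0: "B \<ge> 0" using B K(4) sum_nonneg[of Basis "\<lambda>b. norm (pd b F _)"] order_trans
    by (metis all_not_in_conv norm_ge_zero)
  have lipF: "norm (F x - F y) \<le> B * norm (x - y)" if "x \<in> K" "y \<in> K" for x y
  proof (rule differentiable_bound[OF K(2) _ _ that])
    fix x assume x: "x \<in> K"
    then have d: "F differentiable (at x)" using smooth_on_imp_differentiable[OF W(2)] K(5) by blast
    show "(F has_derivative (\<lambda>v. pd v F x)) (at x within K)"
      by (rule has_derivative_at_withinI[OF has_derivative_pd[OF d]])
    interpret linear "\<lambda>v. pd v F x" by (rule linear_pd[OF d])
    show "onorm (\<lambda>v. pd v F x) \<le> B"
    proof (rule onorm_le)
      fix v
      have "pd v F x = pd (\<Sum>b\<in>Basis. (v \<bullet> b) *\<^sub>R b) F x" by (simp add: euclidean_representation)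
      also have "\<dots> = (\<Sum>b\<in>Basis. (v \<bullet> b) *\<^sub>R pd b F x)" by (simp add: sum scale)
      also have "norm \<dots> \<le> (\<Sum>b\<in>Basis. norm v * norm (pd b F x))"
        by (rule sum_norm_le) (simp add: Basis_le_norm mult_right_mono)
      also have "\<dots> = (\<Sum>b\<in>Basis. norm (pd b F x)) * norm v"
        by (simp add: sum_distrib_left[symmetric] mult.commute)
      also have "\<dots> \<le> B * norm v" using B[OF x] by (simp add: mult_right_mono)
      finally show "norm (pd v F x) \<le> B * norm v" .
    qed
  qed
  define G where "G = (\<lambda>x. F (closest_point K x))"
  have cpK: "closest_point K x \<in> K" for x by (rule closest_point_in_set[OF K(3,4)])
  have lipG: "norm (G x - G y) \<le> B * dist x y" for x y
    unfolding G_def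
    using lipF[OF cpK cpK, of x y] closest_point_lipschitz[OF K(2-4), of x y] B0
    by (smt (verit) dist_norm mult_left_mono)
  have boundG: "norm (G x) \<le> M" for x unfolding G_def by (rule M[OF cpK])
  have contG: "continuous_on UNIV G"
    unfolding G_def
    by (rule continuous_on_compose2[OF continuous_on_subset[OF smooth_on_imp_continuous_on[OF W(2)] K(5)]
          continuous_on_closest_point[OF K(2-4)]]) (use cpK in auto)
  \<comment> \<open>The first bound gives \<open>4 * \<delta> * M \<le> r\<close>, which keeps the
    iterates in the ball; the second gives \<open>4 * \<delta> * B \<le> 1 / 2\<close>, which makes
    the Picard operator a contraction. Adding 1 avoids division by zero.\<close>
  define \<delta> where "\<delta> = min (r / (4 * (M + 1))) (1 / (8 * (B + 1)))"
  have \<delta>: "\<delta> > 0" using r M0 B0 by (simp add: \<delta>_def)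
  have \<delta>M: "4 * \<delta> * M \<le> r"
  proof -
    have "4 * \<delta> * M \<le> 4 * (r / (4 * (M + 1))) * (M + 1)"
      using \<delta> M0 r by (intro mult_mono) (auto simp: \<delta>_def)
    also have "\<dots> = r" using M0 by (simp add: field_simps)
    finally show ?thesis .
  qed
  have \<delta>B: "4 * \<delta> * B \<le> 1 / 2"
  proof -
    have "4 * \<delta> * B \<le> 4 * (1 / (8 * (B + 1))) * (B + 1)"
      using \<delta> B0 by (intro mult_mono) (auto simp: \<delta>_def)
    also have "\<dots> = 1 / 2" using B0 by (simp add: field_simps)
    finally show ?thesis .
  qed
  \<comment> \<open>Time is clamped to the interval, so that the operator acts on bounded continuous
    functions on the whole line, for which completeness is available.\<close>
  define c where "c = (\<lambda>t. max (-\<delta>) (min \<delta> t))"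
  have c: "-\<delta> \<le> c t" "c t \<le> \<delta>" for t using \<delta> by (auto simp: c_def)
  have contc: "continuous_on UNIV c" unfolding c_def by (intro continuous_intros)
  \<comment> \<open>The integral from 0 to the clamped time, written as a difference of integrals
    from the left end point so that negative times are covered as well. Each of the two costs an
    interval of length at most \<open>2 * \<delta>\<close>, whence the constant 4 in
    \<open>Jbound\<close>.\<close>
  define J where "J = (\<lambda>(h :: real \<Rightarrow> 'a) t. integral {-\<delta>..c t} h - integral {-\<delta>..0} h)"
  have Jbound: "norm (J h t) \<le> 4 * \<delta> * C"
    if h: "continuous_on UNIV h" "\<And>t. norm (h t) \<le> C" for h C t
  proof -
    have C: "C \<ge> 0" using h(2) norm_ge_zero order_trans by blast
    have "norm (integral {-\<delta>..s} h) \<le> 2 * \<delta> * C" if s: "-\<delta> \<le> s" "s \<le> \<delta>" for s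
    proof -
      have "norm (integral {-\<delta>..s} h) \<le> C * (s - (-\<delta>))"
        by (rule integral_bound) (use s h continuous_on_subset[OF h(1)] in auto)
      also have "\<dots> \<le> C * (2 * \<delta>)" using s C by (intro mult_left_mono) auto
      finally show ?thesis by (simp add: mult.commute)
    qed
    from this[OF c, of t] this[of 0] \<delta> show ?thesis
      unfolding J_def using norm_triangle_ineq4[of "integral {-\<delta>..c t} h" "integral {-\<delta>..0} h"] by simp
  qed
  have Jcont: "continuous_on UNIV (J h)" if h: "continuous_on UNIV h" for h
  proof -
    have "h integrable_on {-\<delta>..\<delta>}"
      by (rule integrable_continuous_interval) (rule continuous_on_subset[OF h], simp)
    then have "continuous_on {-\<delta>..\<delta>} (\<lambda>x. integral {-\<delta>..x} h)"
      by (rule indefinite_integral_continuous_1)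
    then have "continuous_on UNIV (\<lambda>t. integral {-\<delta>..c t} h)"
      by (rule continuous_on_compose2[OF _ contc]) (use c in auto)
    then show ?thesis unfolding J_def by (intro continuous_intros)
  qed
  have Gz: "continuous_on UNIV (\<lambda>s. G (apply_bcontfun z s))" for z :: "real \<Rightarrow>\<^sub>C 'a"
    by (rule continuous_on_compose2[OF contG]) auto
  define T where "T = (\<lambda>z :: real \<Rightarrow>\<^sub>C 'a. Bcontfun (\<lambda>t. z0 + J (\<lambda>s. G (apply_bcontfun z s)) t))"
  have T: "apply_bcontfun (T z) t = z0 + J (\<lambda>s. G (apply_bcontfun z s)) t" for z t
  proof -
    have "(\<lambda>t. z0 + J (\<lambda>s. G (apply_bcontfun z s)) t) \<in> bcontfun"
    proof (rule bcontfun_normI)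
      show "continuous_on UNIV (\<lambda>t. z0 + J (\<lambda>s. G (apply_bcontfun z s)) t)"
        by (intro continuous_intros Jcont Gz)
      show "norm (z0 + J (\<lambda>s. G (apply_bcontfun z s)) t) \<le> norm z0 + 4 * \<delta> * M" for t
        using Jbound[OF Gz boundG, of z t] norm_triangle_ineq[of z0] by (smt (verit))
    qed
    then show ?thesis unfolding T_def by (simp add: Bcontfun_inverse)
  qed
  have contr: "dist (T x) (T y) \<le> 1 / 2 * dist x y" for x y
  proof (rule dist_bound)
    fix t
    have i: "h integrable_on {-\<delta>..s}" if "continuous_on UNIV h" for h :: "real \<Rightarrow> 'a" and s
      by (rule integrable_continuous_interval) (rule continuous_on_subset[OF that], simp)
    have "apply_bcontfun (T x) t - apply_bcontfun (T y) t =
        J (\<lambda>s. G (apply_bcontfun x s) - G (apply_bcontfun y s)) t"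
      unfolding T J_def integral_diff[OF i[OF Gz] i[OF Gz]] by simp
    moreover have "norm (J (\<lambda>s. G (apply_bcontfun x s) - G (apply_bcontfun y s)) t) \<le> 4 * \<delta> * (B * dist x y)"
    proof (rule Jbound)
      show "continuous_on UNIV (\<lambda>s. G (apply_bcontfun x s) - G (apply_bcontfun y s))"
        by (intro continuous_intros Gz)
      show "norm (G (apply_bcontfun x s) - G (apply_bcontfun y s)) \<le> B * dist x y" for s
        using lipG[of "apply_bcontfun x s" "apply_bcontfun y s"] dist_bounded[of x s y] B0
        by (smt (verit) mult_left_mono)
    qed
    moreover have "4 * \<delta> * (B * dist x y) \<le> 1 / 2 * dist x y"
      using mult_right_mono[OF \<delta>B, of "dist x y"] by (simp add: mult.assoc)
    ultimately show "dist (apply_bcontfun (T x) t) (apply_bcontfun (T y) t) \<le> 1 / 2 * dist x y"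
      by (simp add: dist_norm)
  qed
  have "\<exists>!z. T z = z" by (rule banach_fix_type[of "1/2"]) (use contr in auto)
  then obtain Z where Z: "T Z = Z" by blast
  define z where "z = apply_bcontfun Z"
  have z: "z t = z0 + J (\<lambda>s. G (z s)) t" for t using T[of Z t] by (simp add: Z z_def)
  \<comment> \<open>The fixed point never leaves the ball, where the projection is the identity;
    hence the modified right-hand side agrees with \<open>F\<close> along it.\<close>
  have zK: "z t \<in> K" for t
    using Jbound[OF Gz boundG, of Z t] \<delta>M by (simp add: K_def z[of t] dist_norm) (simp add: z_def)
  show ?thesis
  proof
    show "\<delta> > 0" by (rule \<delta>)
    show "z 0 = z0" using \<delta> by (simp add: z[of 0] J_def c_def)
    show "z t \<in> W" for t using zK K(5) by blast
    fix t assume t: "t \<in> {-\<delta><..<\<delta>}"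
    have "((\<lambda>u. integral {-\<delta>..u} (\<lambda>s. G (z s))) has_vector_derivative G (z t)) (at t within {-\<delta>..\<delta>})"
      by (rule integral_has_vector_derivative)
         (use t Gz[of Z] in \<open>auto simp: z_def intro: continuous_on_subset\<close>)
    then have "((\<lambda>u. integral {-\<delta>..u} (\<lambda>s. G (z s))) has_vector_derivative G (z t)) (at t)"
      using t at_within_Icc_at[of "-\<delta>" t \<delta>] by simp
    then have "((\<lambda>u. z0 + (integral {-\<delta>..u} (\<lambda>s. G (z s)) - integral {-\<delta>..0} (\<lambda>s. G (z s))))
        has_vector_derivative G (z t)) (at t)"
      using has_vector_derivative_add[OF has_vector_derivative_const
          has_vector_derivative_diff[OF _ has_vector_derivative_const]] by fastforce
    then have "(z has_vector_derivative G (z t)) (at t)"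
    proof (rule has_vector_derivative_transform_within_open[OF _ open_greaterThanLessThan t])
      fix u assume "u \<in> {-\<delta><..<\<delta>}"
      then have "c u = u" by (simp add: c_def)
      then show "z0 + (integral {-\<delta>..u} (\<lambda>s. G (z s)) - integral {-\<delta>..0} (\<lambda>s. G (z s))) = z u"
        unfolding z[of u] J_def by simp
    qed
    moreover have "G (z t) = F (z t)" by (simp add: G_def closest_point_self[OF zK])
    ultimately show "(z has_vector_derivative F (z t)) (at t)" by simp
  qed
qed


section \<open>The Helmholtz conditions in coordinates\<close>

definition dq :: "'n::finite \<Rightarrow> ((real ^ 'n) \<times> (real ^ 'n) \<Rightarrow> real) \<Rightarrow> (real ^ 'n) \<times> (real ^ 'n) \<Rightarrow> real" where
  "dq i F = pd (axis i 1, 0) F"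

definition dv :: "'n::finite \<Rightarrow> ((real ^ 'n) \<times> (real ^ 'n) \<Rightarrow> real) \<Rightarrow> (real ^ 'n) \<times> (real ^ 'n) \<Rightarrow> real" where
  "dv i F = pd (0, axis i 1) F"

lemma has_derivative_snd_nth:
  "((\<lambda>x :: 'a::real_normed_vector \<times> (real ^ 'n). snd x $ i) has_derivative (\<lambda>h. snd h $ i)) F"
  by (intro bounded_linear_imp_has_derivative bounded_linear_compose[OF bounded_linear_vec_nth]
      bounded_linear_snd)

lemma dv_snd_nth: "dv k (\<lambda>x. snd x $ i) x = (if i = k then 1 else 0)"
  unfolding dv_def pd_eqI[OF has_derivative_snd_nth] by (auto simp: axis_def)

text \<open>On a fibre the derivative of the function is zero, and the fibre, being a vector space,
  is convex.\<close>

lemma dv_fibre_const: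
  assumes "q \<in> B" "smooth_on (B \<times> UNIV) F" "\<And>i x. x \<in> B \<times> UNIV \<Longrightarrow> dv i F x = 0"
  shows "F (q, v) = F (q, 0)"
proof -
  have "((\<lambda>v. F (q, v)) has_derivative (\<lambda>h. 0)) (at v)" for v
  proof -
    have d: "F differentiable (at (q, v))" using smooth_on_imp_differentiable[OF assms(2)] assms(1) by blast
    interpret linear "\<lambda>h. pd h F (q, v)" by (rule linear_pd[OF d])
    have "((\<lambda>v. (q, v)) has_derivative (\<lambda>h. (0, h))) (at v)" by (auto intro!: derivative_eq_intros)
    from has_derivative_compose[OF this has_derivative_pd[OF d]]
    have "((\<lambda>v. F (q, v)) has_derivative (\<lambda>h. pd (0, h) F (q, v))) (at v)" .
    moreover have "pd (0, h) F (q, v) = 0" for h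
    proof -
      have "(0, h) = (\<Sum>i\<in>UNIV. (h $ i) *\<^sub>R ((0 :: real ^ 'a), axis i 1))"
        by (simp add: prod_eq_iff fst_sum snd_sum vec_expand)
      moreover have "pd (\<Sum>i\<in>UNIV. (h $ i) *\<^sub>R ((0 :: real ^ 'a), axis i 1)) F (q, v) = 0"
        unfolding sum scale using assms(1,3) by (simp add: dv_def)
      ultimately show ?thesis by metis
    qed
    ultimately show ?thesis by simp
  qed
  then show ?thesis
    using has_derivative_zero_constant[of UNIV "\<lambda>v. F (q, v)"] by (metis convex_UNIV UNIV_I)
qed

text \<open>\<open>N j i\<close> is \<open>\<Gamma>\<^sup>j\<^sub>i\<close>, \<open>curvN k i j\<close> is \<open>R\<^sup>k\<^sub>i\<^sub>j\<close>, \<open>DH g k i j\<close> is the component of \<open>D\<^sup>H g\<close> with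
  differentiation index \<open>k\<close>, and \<open>EL L i\<close> is \<open>\<Gamma>(V\<^sub>i L) - \<partial>L/\<partial>q\<^sup>i\<close>.\<close>

locale sode_coords =
  fixes W :: "((real ^ 'n::finite) \<times> (real ^ 'n)) set"
    and f :: "(real ^ 'n) \<times> (real ^ 'n) \<Rightarrow> real ^ 'n"
  assumes W: "open W" and f: "smooth_on W f"
begin

definition N where "N j i x = - (1 / 2) * dv i (\<lambda>x. f x $ j) x"
definition dh where "dh i F x = dq i F x - (\<Sum>j\<in>UNIV. N j i x * dv j F x)"
definition curvN where "curvN k i j x = dh j (N k i) x - dh i (N k j) x"
definition EL where
  "EL L i x = (\<Sum>k\<in>UNIV. dv k (dv i L) x * f x $ k + snd x $ k * dq k (dv i L) x) - dq i L x"
definition \<omega> where "\<omega> L j k x = dh j (dv k L) x - dh k (dv j L) x"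
definition DH where
  "DH g k i j x = dh k (g i j) x - (\<Sum>l\<in>UNIV. g l j x * dv k (N l i) x) - (\<Sum>l\<in>UNIV. g i l x * dv k (N l j) x)"

lemma smooth_dq: "smooth_on W F \<Longrightarrow> smooth_on W (dq i F)"
  unfolding dq_def by (rule smooth_on_pd)

lemma smooth_dv: "smooth_on W F \<Longrightarrow> smooth_on W (dv i F)"
  unfolding dv_def by (rule smooth_on_pd)

lemma smooth_N: "smooth_on W (N j i)"
  unfolding N_def[abs_def] by (intro smooth_intros W smooth_dv f)

lemma smooth_dh: "smooth_on W F \<Longrightarrow> smooth_on W (dh i F)"
  unfolding dh_def[abs_def] by (intro smooth_intros W smooth_dv smooth_dq smooth_N)

lemma smooth_EL: "smooth_on W L \<Longrightarrow> smooth_on W (EL L i)"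
  unfolding EL_def[abs_def] by (intro smooth_intros W smooth_dv smooth_dq f)

lemma smooth_\<omega>: "smooth_on W L \<Longrightarrow> smooth_on W (\<omega> L i j)"
  unfolding \<omega>_def[abs_def] by (intro smooth_intros W smooth_dv smooth_dh)

lemmas smooths = smooth_dq smooth_dv smooth_N smooth_dh

lemma transform:
  assumes "\<And>y. y \<in> W \<Longrightarrow> F y = G y" "x \<in> W"
  shows "dq i F x = dq i G x" "dv i F x = dv i G x" "dh i F x = dh i G x"
  using pd_transform[OF W assms(2,1)] by (simp_all add: dq_def dv_def dh_def)

lemmas diff = smooth_on_imp_differentiable

lemma dq_rules:
  fixes K :: "'n \<Rightarrow> (real ^ 'n) \<times> (real ^ 'n) \<Rightarrow> real"
  assumes "x \<in> W"
  shows "smooth_on W F \<Longrightarrow> smooth_on W G \<Longrightarrow> dq i (\<lambda>x. F x + G x) x = dq i F x + dq i G x"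
    "smooth_on W F \<Longrightarrow> smooth_on W G \<Longrightarrow> dq i (\<lambda>x. F x - G x) x = dq i F x - dq i G x"
    "smooth_on W F \<Longrightarrow> smooth_on W G \<Longrightarrow> dq i (\<lambda>x. F x * G x) x = dq i F x * G x + F x * dq i G x"
    "(\<And>k. smooth_on W (K k)) \<Longrightarrow> dq i (\<lambda>x. \<Sum>k\<in>UNIV. K k x) x = (\<Sum>k\<in>UNIV. dq i (K k) x)"
  unfolding dq_def by (auto intro!: pd_add pd_diff pd_mult pd_sum diff[OF _ assms])

lemma dv_rules:
  fixes K :: "'n \<Rightarrow> (real ^ 'n) \<times> (real ^ 'n) \<Rightarrow> real"
  assumes "x \<in> W"
  shows "smooth_on W F \<Longrightarrow> smooth_on W G \<Longrightarrow> dv i (\<lambda>x. F x + G x) x = dv i F x + dv i G x"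
    "smooth_on W F \<Longrightarrow> smooth_on W G \<Longrightarrow> dv i (\<lambda>x. F x - G x) x = dv i F x - dv i G x"
    "smooth_on W F \<Longrightarrow> smooth_on W G \<Longrightarrow> dv i (\<lambda>x. F x * G x) x = dv i F x * G x + F x * dv i G x"
    "(\<And>k. smooth_on W (K k)) \<Longrightarrow> dv i (\<lambda>x. \<Sum>k\<in>UNIV. K k x) x = (\<Sum>k\<in>UNIV. dv i (K k) x)"
  unfolding dv_def by (auto intro!: pd_add pd_diff pd_mult pd_sum diff[OF _ assms])

lemma dh_rules:
  fixes K :: "'n \<Rightarrow> (real ^ 'n) \<times> (real ^ 'n) \<Rightarrow> real"
  assumes x: "x \<in> W"
  shows "smooth_on W F \<Longrightarrow> smooth_on W G \<Longrightarrow> dh i (\<lambda>x. F x - G x) x = dh i F x - dh i G x"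
    "smooth_on W F \<Longrightarrow> smooth_on W G \<Longrightarrow> dh i (\<lambda>x. F x * G x) x = dh i F x * G x + F x * dh i G x"
    "(\<And>k. smooth_on W (K k)) \<Longrightarrow> dh i (\<lambda>x. \<Sum>k\<in>UNIV. K k x) x = (\<Sum>k\<in>UNIV. dh i (K k) x)"
proof -
  assume F: "smooth_on W F" "smooth_on W G"
  show "dh i (\<lambda>x. F x - G x) x = dh i F x - dh i G x"
    unfolding dh_def dq_rules(2)[OF x F] dv_rules(2)[OF x F]
    by (simp add: algebra_simps sum_subtractf)
  show "dh i (\<lambda>x. F x * G x) x = dh i F x * G x + F x * dh i G x"
    unfolding dh_def dq_rules(3)[OF x F] dv_rules(3)[OF x F]
    by (simp add: algebra_simps sum.distrib sum_distrib_left)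
next
  assume K: "\<And>k. smooth_on W (K k)"
  have "(\<Sum>j\<in>UNIV. N j i x * (\<Sum>k\<in>UNIV. dv j (K k) x)) = (\<Sum>k\<in>UNIV. \<Sum>j\<in>UNIV. N j i x * dv j (K k) x)"
    unfolding sum_distrib_left by (rule sum.swap)
  then show "dh i (\<lambda>x. \<Sum>k\<in>UNIV. K k x) x = (\<Sum>k\<in>UNIV. dh i (K k) x)"
    unfolding dh_def dq_rules(4)[OF x K] dv_rules(4)[OF x K] sum_subtractf by simp
qed

section \<open>Commutators of vertical and horizontal derivatives\<close>

lemma commute:
  assumes "smooth_on W F" "x \<in> W"
  shows dv_dv: "dv i (dv j F) x = dv j (dv i F) x"
    and dq_dq: "dq i (dq j F) x = dq j (dq i F) x"
    and dv_dq: "dv i (dq j F) x = dq j (dv i F) x"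
  unfolding dv_def dq_def using pd_commute[OF W assms] by blast+

text \<open>The commutator of \<open>V\<^sub>j\<close> and \<open>H\<^sub>k\<close>: second
  derivatives cancel, and only the vertical derivative of the connection coefficients
  remains.\<close>

lemma dv_dh:
  assumes F: "smooth_on W F" and x: "x \<in> W"
  shows "dv j (dh k F) x = dh k (dv j F) x - (\<Sum>l\<in>UNIV. dv j (N l k) x * dv l F x)"
proof -
  have "dv j (dh k F) x = dv j (dq k F) x - dv j (\<lambda>x. \<Sum>l\<in>UNIV. N l k x * dv l F x) x"
    unfolding dh_def[abs_def] by (rule dv_rules(2)[OF x]) (intro smooth_intros W smooths F)+
  also have "dv j (\<lambda>x. \<Sum>l\<in>UNIV. N l k x * dv l F x) x =
      (\<Sum>l\<in>UNIV. dv j (N l k) x * dv l F x + N l k x * dv j (dv l F) x)"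
    by (subst dv_rules(4)[OF x]) (intro smooth_intros W smooths F sum.cong refl dv_rules(3)[OF x])+
  finally show ?thesis
    unfolding dh_def dv_dq[OF F x] sum.distrib dv_dv[OF F x, of j] by simp
qed

text \<open>The commutator of two horizontal fields is vertical, and the curvature consists of its
  components.\<close>

lemma dh_dh:
  assumes F: "smooth_on W F" and x: "x \<in> W"
  shows "dh i (dh j F) x - dh j (dh i F) x = (\<Sum>k\<in>UNIV. curvN k i j x * dv k F x)"
proof -
  \<comment> \<open>When \<open>i\<close> and \<open>j\<close> are exchanged, the first and the last
    term are unchanged and the second and fourth trade places. Only the third term survives
    antisymmetrisation, and it yields \<open>curvN\<close>.\<close>
  have e: "dh i (dh j F) x = dq i (dq j F) x - (\<Sum>m\<in>UNIV. N m i x * dq j (dv m F) x)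
      - (\<Sum>l\<in>UNIV. dh i (N l j) x * dv l F x) - (\<Sum>l\<in>UNIV. N l j x * dq i (dv l F) x)
      + (\<Sum>l\<in>UNIV. \<Sum>m\<in>UNIV. N l j x * N m i x * dv m (dv l F) x)" for i j
  proof -
    have "dh i (dh j F) x = dh i (dq j F) x - dh i (\<lambda>x. \<Sum>l\<in>UNIV. N l j x * dv l F x) x"
      unfolding dh_def[of j, abs_def] by (rule dh_rules(1)[OF x]) (intro smooth_intros W smooths F)+
    also have "dh i (\<lambda>x. \<Sum>l\<in>UNIV. N l j x * dv l F x) x =
        (\<Sum>l\<in>UNIV. dh i (N l j) x * dv l F x + N l j x * dh i (dv l F) x)"
      by (subst dh_rules(3)[OF x]) (intro smooth_intros W smooths F sum.cong refl dh_rules(2)[OF x])+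
    also have "\<dots> = (\<Sum>l\<in>UNIV. dh i (N l j) x * dv l F x) + (\<Sum>l\<in>UNIV. N l j x * dq i (dv l F) x)
        - (\<Sum>l\<in>UNIV. \<Sum>m\<in>UNIV. N l j x * N m i x * dv m (dv l F) x)"
      unfolding dh_def[of i "dv _ F"]
      by (simp add: sum.distrib sum_subtractf right_diff_distrib sum_distrib_left mult.assoc)
    also have "dh i (dq j F) x = dq i (dq j F) x - (\<Sum>m\<in>UNIV. N m i x * dq j (dv m F) x)"
      unfolding dh_def dv_dq[OF F x] ..
    finally show ?thesis by simp
  qed
  have "(\<Sum>l\<in>UNIV. \<Sum>m\<in>UNIV. N l j x * N m i x * dv m (dv l F) x) =
      (\<Sum>l\<in>UNIV. \<Sum>m\<in>UNIV. N l i x * N m j x * dv m (dv l F) x)"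
    by (subst sum.swap) (simp add: dv_dv[OF F x] mult.commute)
  then show ?thesis
    unfolding e[of i j] e[of j i] dq_dq[OF F x, of j i] curvN_def
    by (simp add: left_diff_distrib sum_subtractf)
qed

text \<open>Both sides are -1/2 times the same second fibre derivative of a component of
  \<open>f\<close>; this expresses absence of torsion.\<close>

lemma dv_N: "x \<in> W \<Longrightarrow> dv k (N l i) x = dv i (N l k) x"
proof -
  assume x: "x \<in> W"
  have s: "smooth_on W (\<lambda>x. f x $ l)" by (intro smooth_intros W f)
  have "dv k (N l i) x = - (1/2) * dv k (dv i (\<lambda>x. f x $ l)) x" for i k
    unfolding N_def[abs_def] unfolding dv_def[of k]
    by (rule pd_cmult[OF diff[OF smooth_dv[OF s] x]])
  then show ?thesis using dv_dv[OF s x] by simp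
qed

text \<open>Terms with third derivatives of \<open>L\<close> are symmetric in the two indices and
  cancel. Of the rest, the derivative of \<open>f\<close> gives -2 times the connection, and the
  derivative of the factor v^k supplies one \<open>dq j (dv i L)\<close> while the other comes from
  the last term of \<open>EL\<close> with indices exchanged. So both parts of \<open>dh\<close>
  occur twice.\<close>

lemma dv_EL:
  assumes L: "smooth_on W L" and x: "x \<in> W"
  shows "dv j (EL L i) x - dv i (EL L j) x = 2 * \<omega> L j i x"
proof -
  have e: "dv j (EL L i) x = (\<Sum>k\<in>UNIV. dv j (dv k (dv i L)) x * f x $ k)
      - 2 * (\<Sum>k\<in>UNIV. N k j x * dv k (dv i L) x) + dq j (dv i L) x
      + (\<Sum>k\<in>UNIV. snd x $ k * dv j (dq k (dv i L)) x) - dq i (dv j L) x" for i j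
  proof -
    have sf: "smooth_on W (\<lambda>x. f x $ k)" for k by (intro smooth_intros W f)
    have ss: "smooth_on W (\<lambda>x. snd x $ k)" for k by (intro smooth_intros W)
    have "dv j (EL L i) x = dv j (\<lambda>x. \<Sum>k\<in>UNIV. dv k (dv i L) x * f x $ k + snd x $ k * dq k (dv i L) x) x
        - dv j (dq i L) x"
      unfolding EL_def[abs_def] by (rule dv_rules(2)[OF x]) (intro smooth_intros W smooths L f)+
    also have "dv j (\<lambda>x. \<Sum>k\<in>UNIV. dv k (dv i L) x * f x $ k + snd x $ k * dq k (dv i L) x) x =
        (\<Sum>k\<in>UNIV. dv j (\<lambda>x. dv k (dv i L) x * f x $ k + snd x $ k * dq k (dv i L) x) x)"
      by (rule dv_rules(4)[OF x]) (intro smooth_intros W smooths L f)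
    also have "\<dots> = (\<Sum>k\<in>UNIV. (dv j (dv k (dv i L)) x * f x $ k + dv k (dv i L) x * dv j (\<lambda>x. f x $ k) x)
        + (dv j (\<lambda>x. snd x $ k) x * dq k (dv i L) x + snd x $ k * dv j (dq k (dv i L)) x))"
    proof (rule sum.cong[OF refl])
      fix k
      have "dv j (\<lambda>x. dv k (dv i L) x * f x $ k + snd x $ k * dq k (dv i L) x) x =
          dv j (\<lambda>x. dv k (dv i L) x * f x $ k) x + dv j (\<lambda>x. snd x $ k * dq k (dv i L) x) x"
        by (rule dv_rules(1)[OF x]) (intro smooth_intros W smooths L f)+
      also have "dv j (\<lambda>x. dv k (dv i L) x * f x $ k) x =
          dv j (dv k (dv i L)) x * f x $ k + dv k (dv i L) x * dv j (\<lambda>x. f x $ k) x"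
        by (rule dv_rules(3)[OF x _ sf]) (intro smooths L)
      also have "dv j (\<lambda>x. snd x $ k * dq k (dv i L) x) x =
          dv j (\<lambda>x. snd x $ k) x * dq k (dv i L) x + snd x $ k * dv j (dq k (dv i L)) x"
        by (rule dv_rules(3)[OF x ss]) (intro smooths L)
      finally show "dv j (\<lambda>x. dv k (dv i L) x * f x $ k + snd x $ k * dq k (dv i L) x) x =
        (dv j (dv k (dv i L)) x * f x $ k + dv k (dv i L) x * dv j (\<lambda>x. f x $ k) x)
        + (dv j (\<lambda>x. snd x $ k) x * dq k (dv i L) x + snd x $ k * dv j (dq k (dv i L)) x)" .
    qed
    also have "\<dots> = (\<Sum>k\<in>UNIV. dv j (dv k (dv i L)) x * f x $ k)
        + (\<Sum>k\<in>UNIV. dv k (dv i L) x * dv j (\<lambda>x. f x $ k) x)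
        + ((\<Sum>k\<in>UNIV. (if k = j then dq k (dv i L) x else 0))
        + (\<Sum>k\<in>UNIV. snd x $ k * dv j (dq k (dv i L)) x))"
      unfolding sum.distrib dv_snd_nth by (intro arg_cong2[of _ _ _ _ "(+)"] sum.cong refl) auto
    also have "(\<Sum>k\<in>UNIV. dv k (dv i L) x * dv j (\<lambda>x. f x $ k) x) =
        - 2 * (\<Sum>k\<in>UNIV. N k j x * dv k (dv i L) x)"
      unfolding N_def sum_distrib_left by (intro sum.cong refl) simp
    finally show ?thesis unfolding dv_dq[OF L x] by simp
  qed
  have 1: "dv j (dv k (dv i L)) x = dv i (dv k (dv j L)) x" for k
  proof -
    have "dv j (dv k (dv i L)) x = dv k (dv j (dv i L)) x" by (rule dv_dv[OF smooth_dv[OF L] x])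
    also have "\<dots> = dv k (dv i (dv j L)) x" by (rule transform[OF dv_dv[OF L] x])
    also have "\<dots> = dv i (dv k (dv j L)) x" by (rule dv_dv[OF smooth_dv[OF L] x])
    finally show ?thesis .
  qed
  have 2: "dv j (dq k (dv i L)) x = dv i (dq k (dv j L)) x" for k
  proof -
    have "dv j (dq k (dv i L)) x = dq k (dv j (dv i L)) x" by (rule dv_dq[OF smooth_dv[OF L] x])
    also have "\<dots> = dq k (dv i (dv j L)) x" by (rule transform[OF dv_dv[OF L] x])
    also have "\<dots> = dv i (dq k (dv j L)) x" by (rule dv_dq[OF smooth_dv[OF L] x, symmetric])
    finally show ?thesis .
  qed
  show ?thesis unfolding e[of j i] e[of i j] 1 2 \<omega>_def dh_def by simp
qed

text \<open>Moving \<open>V\<^sub>j\<close> through \<open>H\<^sub>k\<close> by \<open>dv_dh\<close>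
  produces one of the two connection sums of \<open>DH\<close>. The other one is symmetric in the
  exchanged indices by \<open>dv_N\<close> and drops out of the difference.\<close>

lemma DH_hessian:
  assumes L: "smooth_on W L" and x: "x \<in> W"
  defines "g \<equiv> \<lambda>i j. dv i (dv j L)"
  shows "DH g k i j x - DH g i k j x = dv j (\<omega> L k i) x"
proof -
  have g: "g i j y = g j i y" if "y \<in> W" for i j y unfolding g_def by (rule dv_dv[OF L that])
  have e: "dv j (dh k (dv i L)) x = dh k (g i j) x - (\<Sum>l\<in>UNIV. g i l x * dv k (N l j) x)" for i k
  proof -
    have "dh k (g j i) x = dh k (g i j) x" by (rule transform[OF g x])
    moreover have "(\<Sum>l\<in>UNIV. dv j (N l k) x * dv l (dv i L) x) = (\<Sum>l\<in>UNIV. g i l x * dv k (N l j) x)"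
      using g[OF x, of _ i] dv_N[OF x, of j _ k] by (intro sum.cong refl) (simp add: g_def)
    ultimately show ?thesis using dv_dh[OF smooth_dv[OF L] x, of j k i] by (simp add: g_def)
  qed
  have "dv j (\<omega> L k i) x = dv j (dh k (dv i L)) x - dv j (dh i (dv k L)) x"
    unfolding \<omega>_def[abs_def] by (rule dv_rules(2)[OF x]) (intro smooths L)+
  then show ?thesis unfolding e DH_def dv_N[OF x, of k _ i] by simp
qed

lemma DH_sym:
  assumes g: "\<And>i j y. y \<in> W \<Longrightarrow> g i j y = g j i y" and x: "x \<in> W"
  shows "DH g k i j x = DH g k j i x"
proof -
  have "dh k (g i j) x = dh k (g j i) x" by (rule transform(3)[OF _ x]) (rule g)
  moreover have "g l j x = g j l x" "g i l x = g l i x" for l by (rule g[OF x])+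
  ultimately show ?thesis unfolding DH_def by simp
qed

lemma DH_cong:
  assumes g: "\<And>i j y. y \<in> W \<Longrightarrow> g i j y = g' i j y" and x: "x \<in> W"
  shows "DH g k i j x = DH g' k i j x"
proof -
  have "dh k (g i j) x = dh k (g' i j) x" by (rule transform(3)[OF _ x]) (rule g)
  then show ?thesis unfolding DH_def using g[OF x] by simp
qed

text \<open>The six second horizontal derivatives on the right pair up into three commutators, each
  of which \<open>dh_dh\<close> turns into a curvature term.\<close>

lemma cyclic_curvN:
  assumes L: "smooth_on W L" and x: "x \<in> W"
  shows "(\<Sum>l\<in>UNIV. curvN l i j x * dv l (dv k L) x) + (\<Sum>l\<in>UNIV. curvN l j k x * dv l (dv i L) x)
      + (\<Sum>l\<in>UNIV. curvN l k i x * dv l (dv j L) x) =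
    dh i (\<omega> L j k) x + dh j (\<omega> L k i) x + dh k (\<omega> L i j) x"
proof -
  have "dh i (\<omega> L j k) x = dh i (dh j (dv k L)) x - dh i (dh k (dv j L)) x" for i j k
    unfolding \<omega>_def[abs_def] by (rule dh_rules(1)[OF x]) (intro smooths L)+
  then show ?thesis unfolding dh_dh[OF smooth_dv[OF L] x, symmetric] by simp
qed

text \<open>A fibre gradient has vanishing curl, so \<omega> is identically zero on \<open>W\<close>
  by \<open>dv_EL\<close>, and with it all its vertical and horizontal derivatives.\<close>

theorem helmholtz_necessary:
  assumes L: "smooth_on W L" and D: "smooth_on W D"
    and EL: "\<And>i x. x \<in> W \<Longrightarrow> EL L i x = dv i D x" and x: "x \<in> W"
  defines "g \<equiv> \<lambda>i j. dv i (dv j L)"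
  shows "DH g k i j x = DH g i k j x" "DH g k i j x = DH g k j i x"
    and "(\<Sum>l\<in>UNIV. curvN l i j x * g l k x) + (\<Sum>l\<in>UNIV. curvN l j k x * g l i x)
      + (\<Sum>l\<in>UNIV. curvN l k i x * g l j x) = 0"
proof -
  have \<omega>: "\<omega> L j i y = 0" if y: "y \<in> W" for i j y
  proof -
    have "dv j (EL L i) y = dv j (dv i D) y" for i j by (rule transform[OF EL y])
    then show ?thesis using dv_EL[OF L y, of j i] dv_dv[OF D y, of i j] by simp
  qed
  have "dv j (\<omega> L k i) x = dv j (\<lambda>x. 0) x" by (rule transform(2)[OF _ x]) (rule \<omega>)
  moreover have "dh a (\<omega> L b c) x = dh a (\<lambda>x. 0) x" for a b c by (rule transform(3)[OF _ x]) (rule \<omega>)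
  ultimately have 0: "dv j (\<omega> L k i) x = 0" "dh a (\<omega> L b c) x = 0" for a b c
    by (simp_all add: dh_def dv_def dq_def)
  show "DH g k i j x = DH g i k j x" using DH_hessian[OF L x, of k i j] 0 by (simp add: g_def)
  show "DH g k i j x = DH g k j i x" by (rule DH_sym) (use dv_dv[OF L] x in \<open>auto simp: g_def\<close>)
  show "(\<Sum>l\<in>UNIV. curvN l i j x * g l k x) + (\<Sum>l\<in>UNIV. curvN l j k x * g l i x)
      + (\<Sum>l\<in>UNIV. curvN l k i x * g l j x) = 0"
    unfolding g_def cyclic_curvN[OF L x] using 0 by simp
qed

theorem helmholtz_sufficient:
  assumes WB: "W = B \<times> UNIV" and B: "open B" "convex B" "B \<noteq> {}"
    and g: "\<And>i j. smooth_on W (g i j)"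
    and gsym: "\<And>i j x. x \<in> W \<Longrightarrow> g i j x = g j i x"
    and DV: "\<And>i j k x. x \<in> W \<Longrightarrow> dv k (g i j) x = dv i (g k j) x"
    and DH: "\<And>i j k x. x \<in> W \<Longrightarrow> DH g k i j x = DH g i k j x"
    and cyc: "\<And>i j k x. x \<in> W \<Longrightarrow> (\<Sum>l\<in>UNIV. curvN l i j x * g l k x)
      + (\<Sum>l\<in>UNIV. curvN l j k x * g l i x) + (\<Sum>l\<in>UNIV. curvN l k i x * g l j x) = 0"
  obtains L D where "smooth_on W L" "smooth_on W D" "\<And>i j x. x \<in> W \<Longrightarrow> dv i (dv j L) x = g i j x"
    "\<And>i x. x \<in> W \<Longrightarrow> EL L i x = dv i D x"
proof -
  note g' = g[unfolded WB] and DV' = DV[unfolded WB] and gsym' = gsym[unfolded WB]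
  \<comment> \<open>Each column of \<open>g\<close> is a closed 1-form on the fibres by
    \<open>DV\<close>, hence a gradient; these primitives will become the momenta.\<close>
  have "\<exists>\<theta>. smooth_on W \<theta> \<and> (\<forall>i. \<forall>x\<in>W. dv i \<theta> x = g i j x)" for j
  proof -
    have "pd (0, axis i 1) (g k j) x = pd (0, axis k 1) (g i j) x" if "x \<in> B \<times> UNIV" for i k x
      using DV'[OF that, of i k j] by (simp add: dv_def)
    from fibre_primitive[where \<beta>="\<lambda>i. g i j", OF B(1) g' this]
    show ?thesis unfolding WB dv_def by metis
  qed
  then obtain \<theta> where \<theta>: "\<And>j. smooth_on W (\<theta> j)" "\<And>i j x. x \<in> W \<Longrightarrow> dv i (\<theta> j) x = g i j x" by metis
  \<comment> \<open>Symmetry of \<open>g\<close> says that the momenta themselves form a closed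
    1-form on the fibres.\<close>
  have "\<exists>L. smooth_on W L \<and> (\<forall>i. \<forall>x\<in>W. dv i L x = \<theta> i x)"
  proof -
    have "pd (0, axis i 1) (\<theta> j) x = pd (0, axis j 1) (\<theta> i) x" if "x \<in> B \<times> UNIV" for i j x
      using \<theta>(2)[of x i j] \<theta>(2)[of x j i] gsym[of x i j] that by (simp add: WB dv_def)
    from fibre_primitive[OF B(1) \<theta>(1)[unfolded WB] this]
    show ?thesis unfolding WB dv_def by metis
  qed
  then obtain L0 where L0: "smooth_on W L0" "\<And>i x. x \<in> W \<Longrightarrow> dv i L0 x = \<theta> i x" by blast
  have hess0: "dv i (dv j L0) x = g i j x" if "x \<in> W" for i j x
    using transform(2)[OF L0(2) that] \<theta>(2)[OF that] by simp
  \<comment> \<open>The form of \<open>L0\<close> need not vanish, since \<open>g\<close> fixes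
    \<open>L0\<close> only up to terms affine in the velocities; but it is constant along the
    fibres.\<close>
  have dv\<omega>: "dv j (\<omega> L0 k i) x = 0" if x: "x \<in> W" for i j k x
  proof -
    have "DH (\<lambda>i j. dv i (dv j L0)) k i j x = DH g k i j x" for i j k
      unfolding DH_def using transform(3)[OF hess0 x] hess0[OF x] by simp
    then show ?thesis using DH_hessian[OF L0(1) x, of k i j] DH[OF x] by simp
  qed
  \<comment> \<open>Since the form does not depend on the velocity, evaluation on the zero section
    recovers it as a 2-form on the base.\<close>
  define w where "w = (\<lambda>i j q. \<omega> L0 i j (q, 0))"
  have w: "\<omega> L0 i j x = w i j (fst x)" if "x \<in> W" for i j x
    using dv_fibre_const[of "fst x" B "\<omega> L0 i j" "snd x"] smooth_\<omega>[OF L0(1)] dv\<omega> that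
    by (auto simp: WB w_def)
  have sw: "smooth_on B (w i j)" for i j
    unfolding w_def
    by (rule smooth_on_compose[OF B(1) _ smooth_\<omega>[OF L0(1)]])
       (auto intro!: smooth_intros B simp: WB)
  \<comment> \<open>For a function without vertical derivatives the connection term of
    \<open>dh\<close> disappears, so the horizontal derivative is the partial derivative on the
    base.\<close>
  have dw: "pd (axis k 1) (w i j) q = dh k (\<omega> L0 i j) (q, 0)" if "q \<in> B" for i j k q
  proof -
    have x: "(q, 0) \<in> W" using that by (simp add: WB)
    have "((\<lambda>q :: real ^ 'n. (q, 0 :: real ^ 'n)) has_derivative (\<lambda>h. (h, 0))) (at q)"
      by (auto intro!: derivative_eq_intros)
    from pd_eqI[OF has_derivative_compose[OF this has_derivative_pd[OF diff[OF smooth_\<omega>[OF L0(1)] x]]]]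
    have "pd (axis k 1) (w i j) q = dq k (\<omega> L0 i j) (q, 0)" unfolding w_def dq_def .
    then show ?thesis unfolding dh_def using dv\<omega>[OF x] by simp
  qed
  obtain q0 where q0: "q0 \<in> B" using B by blast
  have wa: "w i j q = - w j i q" for i j q unfolding w_def \<omega>_def by simp
  have wc: "pd (axis k 1) (w i j) q + pd (axis i 1) (w j k) q + pd (axis j 1) (w k i) q = 0"
    if q: "q \<in> B" for i j k q
  proof -
    have x: "(q, 0) \<in> W" using q by (simp add: WB)
    show ?thesis unfolding dw[OF q] using cyclic_curvN[OF L0(1) x, of i j k] cyc[OF x, of i j k] hess0[OF x]
      by simp
  qed
  obtain \<alpha> where \<alpha>: "\<And>i. smooth_on B (\<alpha> i)"
    "\<And>i j q. q \<in> B \<Longrightarrow> pd (axis i 1) (\<alpha> j) q - pd (axis j 1) (\<alpha> i) q = w i j q"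
    using closed_two_form_primitive[OF B(1,2) q0 sw wa wc] by metis
  define a where "a = (\<lambda>i (x :: (real ^ 'n) \<times> (real ^ 'n)). \<alpha> i (fst x))"
  have sa: "smooth_on W (a i)" for i
    unfolding a_def
    by (rule smooth_on_compose[OF W _ \<alpha>(1)], intro smooth_intros W) (auto simp: WB)
  have dfst: "(fst has_derivative fst) (at (x :: (real ^ 'n) \<times> (real ^ 'n)))" for x
    by (intro bounded_linear_imp_has_derivative bounded_linear_fst)
  have da: "dv k (a i) x = 0" "dq k (a i) x = pd (axis k 1) (\<alpha> i) (fst x)" if x: "x \<in> W" for i k x
  proof -
    have "\<alpha> i differentiable (at (fst x))" using diff[OF \<alpha>(1)] x by (auto simp: WB)
    note d = pd_eqI[OF has_derivative_compose[OF dfst has_derivative_pd[OF this]]] linear_0[OF linear_pd[OF this]]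
    show "dv k (a i) x = 0" "dq k (a i) x = pd (axis k 1) (\<alpha> i) (fst x)"
      unfolding dv_def dq_def a_def d(1) using d(2) by simp_all
  qed
  \<comment> \<open>The fibre derivative of the subtracted term is \<open>a k\<close>, and the curl
    of that is \<open>w\<close>. Hence the form of \<open>L\<close> is zero, and \<open>EL L\<close>
    is a fibre gradient.\<close>
  define L where "L = (\<lambda>x. L0 x - (\<Sum>i\<in>UNIV. a i x * snd x $ i))"
  have sL: "smooth_on W L" unfolding L_def by (intro smooth_intros W L0 sa)
  have dvL: "dv k L x = dv k L0 x - a k x" if x: "x \<in> W" for k x
  proof -
    have sn: "smooth_on W (\<lambda>x. snd x $ i)" for i by (intro smooth_intros W)
    have "dv k L x = dv k L0 x - dv k (\<lambda>x. \<Sum>i\<in>UNIV. a i x * snd x $ i) x"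
      unfolding L_def by (rule dv_rules(2)[OF x]) (intro smooth_intros W L0 sa)+
    also have "dv k (\<lambda>x. \<Sum>i\<in>UNIV. a i x * snd x $ i) x = (\<Sum>i\<in>UNIV. dv k (\<lambda>x. a i x * snd x $ i) x)"
      by (rule dv_rules(4)[OF x]) (intro smooth_intros W sa)
    also have "\<dots> = (\<Sum>i\<in>UNIV. if i = k then a i x else 0)"
      unfolding dv_rules(3)[OF x sa sn] dv_snd_nth da(1)[OF x] by (intro sum.cong refl) auto
    finally show ?thesis by simp
  qed
  have \<omega>0: "\<omega> L j k x = 0" if x: "x \<in> W" for j k x
  proof -
    have "dh j (dv k L) x = dh j (dv k L0) x - dh j (a k) x" for j k
      using transform(3)[OF dvL x] dh_rules(1)[OF x smooth_dv[OF L0(1)] sa] by simp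
    moreover have "dh j (a k) x = pd (axis j 1) (\<alpha> k) (fst x)" for j k
      unfolding dh_def da[OF x] by simp
    moreover have "fst x \<in> B" using x by (auto simp: WB)
    ultimately show ?thesis using \<alpha>(2)[of "fst x" j k] w[OF x, of j k] unfolding \<omega>_def by simp
  qed
  have "\<exists>D. smooth_on W D \<and> (\<forall>i. \<forall>x\<in>W. dv i D x = EL L i x)"
  proof -
    have "pd (0, axis i 1) (EL L j) x = pd (0, axis j 1) (EL L i) x" if "x \<in> B \<times> UNIV" for i j x
      using dv_EL[OF sL, of x j i] \<omega>0[of x] that by (simp add: WB dv_def)
    from fibre_primitive[OF B(1) smooth_EL[OF sL, unfolded WB] this]
    show ?thesis unfolding WB dv_def by metis
  qed
  then obtain D where D: "smooth_on W D" "\<And>i x. x \<in> W \<Longrightarrow> dv i D x = EL L i x" by blast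
  show ?thesis
  proof (rule that[OF sL D(1)])
    show "EL L i x = dv i D x" if "x \<in> W" for i x using D(2)[OF that] by simp
    fix i j x assume x: "x \<in> W"
    have "dv i (dv j L) x = dv i (dv j L0) x - dv i (a j) x"
      using transform(2)[OF dvL x] dv_rules(2)[OF x smooth_dv[OF L0(1)] sa] by simp
    then show "dv i (dv j L) x = g i j x" using hess0[OF x] da(1)[OF x] by simp
  qed
qed

end


section \<open>Charts of the tangent bundle\<close>

lemma pd_commute_vec:
  fixes F :: "'a::real_normed_vector \<Rightarrow> real ^ 'm"
  assumes S: "open S" and F: "smooth_on S F" and x: "x \<in> S"
  shows "pd a (pd b F) x = pd b (pd a F) x"
proof (rule vec_eq_iff[THEN iffD2, rule_format])
  fix k :: 'm
  have nth: "pd w G y $ k = pd w (\<lambda>x. G x $ k) y" if "smooth_on S G" "y \<in> S" for w G y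
    using pd_bounded_linear[OF smooth_on_imp_differentiable[OF that] bounded_linear_vec_nth] by metis
  have "pd a (pd b F) x $ k = pd a (pd b (\<lambda>x. F x $ k)) x" for a b
    using nth[OF smooth_on_pd[OF F] x] pd_transform[OF S x, of "\<lambda>y. pd b F y $ k"] nth[OF F] by metis
  then show "pd a (pd b F) x $ k = pd b (pd a F) x $ k"
    using pd_commute[OF S smooth_on_nth[OF S F] x] by metis
qed

lemma pd_fst_arg:
  assumes "T differentiable (at (fst x))"
  shows "pd h (\<lambda>x. T (fst x)) x = pd (fst h) T (fst x)"
  by (rule pd_eqI[OF has_derivative_compose[OF has_derivative_fst[OF has_derivative_ident] has_derivative_pd[OF assms]]])

lemma pd_pair_expand:
  fixes F :: "(real ^ 'n) \<times> (real ^ 'n) \<Rightarrow> real"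
  assumes "F differentiable (at x)"
  shows "pd (h, k) F x = (\<Sum>i\<in>UNIV. h $ i * dq i F x) + (\<Sum>i\<in>UNIV. k $ i * dv i F x)"
proof -
  interpret linear "\<lambda>w. pd w F x" by (rule linear_pd[OF assms])
  have "(h, k) = (\<Sum>i\<in>UNIV. (h $ i) *\<^sub>R (axis i 1, 0)) + (\<Sum>i\<in>UNIV. (k $ i) *\<^sub>R (0, axis i 1))"
    by (simp add: prod_eq_iff fst_sum snd_sum vec_expand)
  then show ?thesis by (simp only: add sum scale dq_def dv_def real_scaleR_def)
qed

locale manifold =
  fixes A :: "('q::t2_space, real ^ 'n::finite) chart set"
  assumes atlas: "smooth_atlas A"
begin

section \<open>Transition maps and tangent spaces\<close>

lemma chart:
  assumes "c \<in> A"
  shows open_cdom: "open (cdom c)" and open_cran: "open (cmap c ` cdom c)"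
    and cont_cmap: "continuous_on (cdom c) (cmap c)"
    and cont_cinv: "continuous_on (cmap c ` cdom c) (chart_inv c)"
    and cinv_cmap: "\<And>p. p \<in> cdom c \<Longrightarrow> chart_inv c (cmap c p) = p"
  using atlas assms unfolding smooth_atlas_def homeomorphism_def by auto

lemma cover: "\<exists>c\<in>A. p \<in> cdom c"
  using atlas unfolding smooth_atlas_def by blast

lemma open_cmap_image:
  assumes "c \<in> A" "open V"
  shows "open (cmap c ` (V \<inter> cdom c))"
proof -
  have "cmap c ` (V \<inter> cdom c) = cmap c ` cdom c \<inter> chart_inv c -` V"
    using cinv_cmap[OF assms(1)] by (auto intro!: image_eqI)
  then show ?thesis
    using continuous_open_preimage[OF cont_cinv[OF assms(1)] open_cran[OF assms(1)] assms(2)] by simp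
qed

definition tr :: "('q, real ^ 'n) chart \<Rightarrow> ('q, real ^ 'n) chart \<Rightarrow> real ^ 'n \<Rightarrow> real ^ 'n" where
  "tr c c' = cmap c' \<circ> chart_inv c"

lemma smooth_tr:
  "c \<in> A \<Longrightarrow> c' \<in> A \<Longrightarrow> smooth_on (cmap c ` (cdom c' \<inter> cdom c)) (tr c c')"
  using atlas unfolding smooth_atlas_def tr_def by (metis inf_commute)

lemma tr_cmap: "c \<in> A \<Longrightarrow> p \<in> cdom c \<Longrightarrow> tr c c' (cmap c p) = cmap c' p"
  by (simp add: tr_def cinv_cmap)

definition J :: "('q, real ^ 'n) chart \<Rightarrow> ('q, real ^ 'n) chart \<Rightarrow> 'q \<Rightarrow> real ^ 'n \<Rightarrow> real ^ 'n" where
  "J c c' p v = pd v (tr c c') (cmap c p)"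

lemma tr_differentiable:
  "c \<in> A \<Longrightarrow> c' \<in> A \<Longrightarrow> p \<in> cdom c \<Longrightarrow> p \<in> cdom c' \<Longrightarrow> tr c c' differentiable (at (cmap c p))"
  using smooth_on_imp_differentiable[OF smooth_tr[of c c']] by blast

lemma linear_J:
  "c \<in> A \<Longrightarrow> c' \<in> A \<Longrightarrow> p \<in> cdom c \<Longrightarrow> p \<in> cdom c' \<Longrightarrow> linear (J c c' p)"
  using linear_pd[OF tr_differentiable[of c c' p]] by (simp add: J_def[abs_def])

lemma J_id: "c \<in> A \<Longrightarrow> p \<in> cdom c \<Longrightarrow> J c c p v = v"
proof -
  assume c: "c \<in> A" "p \<in> cdom c"
  have "J c c p v = pd v (\<lambda>x. x) (cmap c p)"
    unfolding J_def by (rule pd_transform[OF open_cran[OF c(1)]]) (use c in \<open>auto simp: tr_cmap\<close>)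
  then show ?thesis by (simp add: pd_def)
qed

text \<open>The cocycle identity of the Jacobians, from the chain rule. It makes
  \<open>tangent_vec\<close> an element of the tangent space.\<close>

lemma J_comp:
  assumes c: "c \<in> A" "c' \<in> A" "c'' \<in> A" and p: "p \<in> cdom c" "p \<in> cdom c'" "p \<in> cdom c''"
  shows "J c' c'' p (J c c' p v) = J c c'' p v"
proof -
  have "J c c'' p v = pd v (\<lambda>x. tr c' c'' (tr c c' x)) (cmap c p)"
    unfolding J_def
    by (rule pd_transform[OF open_cmap_image[OF c(1) open_Int[OF open_cdom[OF c(2)] open_cdom[OF c(3)]]]])
       (use c p in \<open>auto simp: tr_cmap\<close>)
  also have "\<dots> = pd (pd v (tr c c') (cmap c p)) (tr c' c'') (tr c c' (cmap c p))"
    by (rule pd_compose) (use c p in \<open>auto simp: tr_cmap intro!: tr_differentiable\<close>)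
  finally show ?thesis using c p by (simp add: J_def tr_cmap)
qed

lemma tangent_vec_J:
  "tangent_vec A c p v = (\<lambda>c'. if c' \<in> A \<and> p \<in> cdom c' then J c c' p v else 0)"
  unfolding tangent_vec_def J_def pd_def tr_def ..

lemma tangent_space_J:
  "w \<in> tangent_space A p \<longleftrightarrow>
    (\<forall>c\<in>A. \<forall>c'\<in>A. p \<in> cdom c \<and> p \<in> cdom c' \<longrightarrow> w c' = J c c' p (w c)) \<and>
    (\<forall>c. \<not> (c \<in> A \<and> p \<in> cdom c) \<longrightarrow> w c = 0)"
  by (simp add: tangent_space_def J_def pd_def tr_def)

lemma tangent_spaceD:
  assumes "w \<in> tangent_space A p" "c \<in> A" "p \<in> cdom c"
  shows "c' \<in> A \<Longrightarrow> p \<in> cdom c' \<Longrightarrow> w c' = J c c' p (w c)"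
    and "\<not> (c' \<in> A \<and> p \<in> cdom c') \<Longrightarrow> w c' = 0"
  by (fact conjunct1[OF assms(1)[unfolded tangent_space_J], rule_format, OF assms(2) _ conjI[OF assms(3)]])
     (fact conjunct2[OF assms(1)[unfolded tangent_space_J], rule_format])

lemma tangent_vec_in: "c \<in> A \<Longrightarrow> p \<in> cdom c \<Longrightarrow> tangent_vec A c p v \<in> tangent_space A p"
  unfolding tangent_space_J by (auto simp: tangent_vec_J J_comp)

lemma tangent_vec_self: "c \<in> A \<Longrightarrow> p \<in> cdom c \<Longrightarrow> tangent_vec A c p v c = v"
  by (simp add: tangent_vec_J J_id)

lemma tangent_vec_eq:
  "w \<in> tangent_space A p \<Longrightarrow> c \<in> A \<Longrightarrow> p \<in> cdom c \<Longrightarrow> tangent_vec A c p (w c) = w"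
proof (rule ext)
  fix c' assume w: "w \<in> tangent_space A p" "c \<in> A" "p \<in> cdom c"
  show "tangent_vec A c p (w c) c' = w c'"
  proof (cases "c' \<in> A \<and> p \<in> cdom c'")
    case True
    then have "J c c' p (w c) = w c'" using tangent_spaceD(1)[OF w, symmetric] by metis
    then show ?thesis unfolding tangent_vec_J using True by simp
  next
    case False
    then have "w c' = 0" by (rule tangent_spaceD(2)[OF w])
    then show ?thesis unfolding tangent_vec_J using False by auto
  qed
qed

lemma zero_in_tangent_space: "(\<lambda>c. 0) \<in> tangent_space A p"
  unfolding tangent_space_J by (auto simp: linear_0[OF linear_J])

abbreviation "I \<equiv> induced_chart A"
abbreviation "TB \<equiv> tangent_bundle A"

section \<open>The tangent bundle in induced charts\<close>

lemma TB_iff: "u \<in> TB V \<longleftrightarrow> fst u \<in> V \<and> snd u \<in> tangent_space A (fst u)"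
  by (cases u) (simp add: tangent_bundle_def)

lemma cdom_I [simp]: "cdom (I c) = TB (cdom c)"
  by (simp add: induced_chart_def)

lemma cmap_I [simp]: "cmap (I c) u = (cmap c (fst u), snd u c)"
  by (cases u) (simp add: induced_chart_def)

lemma cinv_I:
  assumes c: "c \<in> A" and u: "u \<in> TB (cdom c)"
  shows "chart_inv (I c) (cmap c (fst u), snd u c) = u"
proof -
  have "inj_on (cmap (I c)) (cdom (I c))"
  proof (rule inj_onI)
    fix u u' assume u: "u \<in> cdom (I c)" "u' \<in> cdom (I c)" and e: "cmap (I c) u = cmap (I c) u'"
    then have "fst u = fst u'" using cinv_cmap[OF c] by (metis TB_iff cdom_I cmap_I fst_conv)
    moreover from this have "snd u = snd u'"
      using u e tangent_vec_eq[OF _ c] by (metis TB_iff cdom_I cmap_I snd_conv)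
    ultimately show "u = u'" by (simp add: prod_eq_iff)
  qed
  from inv_into_f_f[OF this, of u] show ?thesis using u by (simp add: chart_inv_def)
qed

text \<open>The coordinate image of the tangent bundle over \<open>V\<close>. Every coordinate
  vector is the expression of a tangent vector, so the second factor is the full space.\<close>

definition Wd :: "('q, real ^ 'n) chart \<Rightarrow> 'q set \<Rightarrow> ((real ^ 'n) \<times> (real ^ 'n)) set" where
  "Wd c V = (cmap c ` (V \<inter> cdom c)) \<times> (UNIV :: (real ^ 'n) set)"

lemma open_Wd: "c \<in> A \<Longrightarrow> open V \<Longrightarrow> open (Wd c V)"
  unfolding Wd_def by (intro open_Times open_cmap_image) auto

lemma Wd_E:
  assumes "c \<in> A" "x \<in> Wd c V"
  obtains u where "u \<in> TB (V \<inter> cdom c)" "x = (cmap c (fst u), snd u c)" "chart_inv (I c) x = u"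
proof -
  obtain p v where p: "p \<in> V" "p \<in> cdom c" and x: "x = (cmap c p, v)" using assms(2) by (auto simp: Wd_def)
  define u where "u = (p, tangent_vec A c p v)"
  have "u \<in> TB (V \<inter> cdom c)" using p assms(1) by (simp add: u_def TB_iff tangent_vec_in)
  moreover have "x = (cmap c (fst u), snd u c)"
    using p assms(1) by (simp add: u_def x tangent_vec_self)
  moreover from calculation have "chart_inv (I c) x = u"
    using cinv_I[OF assms(1), of u] by (simp add: TB_iff)
  ultimately show ?thesis by (rule that)
qed

lemma Wd_I: "u \<in> TB V \<Longrightarrow> fst u \<in> cdom c \<Longrightarrow> (cmap c (fst u), snd u c) \<in> Wd c V"
  by (auto simp: Wd_def TB_iff)

lemma cmap_I_image:
  assumes "c \<in> A"
  shows "cmap (I c) ` (TB V \<inter> TB (cdom c)) = Wd c V"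
proof
  show "cmap (I c) ` (TB V \<inter> TB (cdom c)) \<subseteq> Wd c V" by (auto simp: TB_iff Wd_def)
  show "Wd c V \<subseteq> cmap (I c) ` (TB V \<inter> TB (cdom c))"
  proof
    fix x assume "x \<in> Wd c V"
    then obtain u where "u \<in> TB (V \<inter> cdom c)" "x = (cmap c (fst u), snd u c)" using Wd_E[OF assms] by metis
    then show "x \<in> cmap (I c) ` (TB V \<inter> TB (cdom c))" by (intro image_eqI[of _ _ u]) (auto simp: TB_iff)
  qed
qed

lemma Wd_mono: "V \<subseteq> V' \<Longrightarrow> Wd c V \<subseteq> Wd c V'"
  by (auto simp: Wd_def)

lemma smooth_function_iff:
  "smooth_function (tangent_atlas A) (TB V) F \<longleftrightarrow> (\<forall>c\<in>A. smooth_on (Wd c V) (F \<circ> chart_inv (I c)))"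
proof -
  have "smooth_on (cmap (I c) ` (TB V \<inter> cdom (I c))) (F \<circ> chart_inv (I c)) \<longleftrightarrow>
      smooth_on (Wd c V) (F \<circ> chart_inv (I c))" if "c \<in> A" for c
    using cmap_I_image[OF that] by (simp only: cdom_I)
  then show ?thesis unfolding smooth_function_def tangent_atlas_def by blast
qed

definition \<Phi> :: "('q, real ^ 'n) chart \<Rightarrow> ('q, real ^ 'n) chart \<Rightarrow> (real ^ 'n) \<times> (real ^ 'n) \<Rightarrow> (real ^ 'n) \<times> (real ^ 'n)" where
  "\<Phi> c c' = cmap (I c') \<circ> chart_inv (I c)"

lemma \<Phi>_cmap: "c \<in> A \<Longrightarrow> u \<in> TB (cdom c) \<Longrightarrow> \<Phi> c c' (cmap c (fst u), snd u c) = (cmap c' (fst u), snd u c')"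
  by (simp add: \<Phi>_def cinv_I)

text \<open>The derivative of the transition map is expanded over the axis vectors because
  smoothness of \<open>pd\<close> is available for constant directions only.\<close>

lemma \<Phi>_eq:
  assumes c: "c \<in> A" "c' \<in> A" and x: "x \<in> Wd c (cdom c')"
  shows "\<Phi> c c' x = (tr c c' (fst x), \<Sum>i\<in>UNIV. (snd x $ i) *\<^sub>R pd (axis i 1) (tr c c') (fst x))"
proof -
  obtain u where u: "u \<in> TB (cdom c' \<inter> cdom c)" and xu: "x = (cmap c (fst u), snd u c)"
    using Wd_E[OF c(1) x] by metis
  have p: "fst u \<in> cdom c" "fst u \<in> cdom c'" "snd u \<in> tangent_space A (fst u)" using u by (auto simp: TB_iff)
  have "snd u c' = J c c' (fst u) (snd u c)" by (rule tangent_spaceD(1)[OF p(3) c(1) p(1) c(2) p(2)])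
  then show ?thesis
    using \<Phi>_cmap[OF c(1), of u c'] p tr_cmap[OF c(1) p(1)]
      pd_vec_expand[OF tr_differentiable[OF c p(1,2)], of "snd u c"] by (simp add: xu TB_iff J_def)
qed

lemma smooth_tr_fst:
  assumes c: "c \<in> A" "c' \<in> A"
  shows "smooth_on (Wd c (cdom c')) (\<lambda>x. tr c c' (fst x))"
    and "smooth_on (Wd c (cdom c')) (\<lambda>x. pd w (tr c c') (fst x))"
proof -
  have f: "smooth_on (Wd c (cdom c')) fst" by (intro smooth_intros open_Wd c open_cdom)
  show "smooth_on (Wd c (cdom c')) (\<lambda>x. tr c c' (fst x))"
    by (rule smooth_on_compose[OF open_Wd[OF c(1) open_cdom[OF c(2)]] f smooth_tr[OF c]]) (auto simp: Wd_def)
  show "smooth_on (Wd c (cdom c')) (\<lambda>x. pd w (tr c c') (fst x))"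
    by (rule smooth_on_compose[OF open_Wd[OF c(1) open_cdom[OF c(2)]] f smooth_on_pd[OF smooth_tr[OF c]]])
       (auto simp: Wd_def)
qed

lemma smooth_\<Phi>:
  assumes c: "c \<in> A" "c' \<in> A"
  shows "smooth_on (Wd c (cdom c')) (\<Phi> c c')"
proof -
  let ?G = "\<lambda>x. (tr c c' (fst x), \<Sum>i\<in>UNIV. (snd x $ i) *\<^sub>R pd (axis i 1) (tr c c') (fst x))"
  have "smooth_on (Wd c (cdom c')) ?G"
    by (intro smooth_intros smooth_tr_fst c open_Wd open_cdom)
  then show ?thesis
    using smooth_on_cong[OF open_Wd[OF c(1) open_cdom[OF c(2)]], of "\<Phi> c c'" ?G] \<Phi>_eq[OF c] by blast
qed

text \<open>The velocity part involves second derivatives of the transition map. They are the source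
  of the vertical term in \<open>ddq_change\<close>.\<close>

lemma pd_\<Phi>:
  assumes c: "c \<in> A" "c' \<in> A" and x: "x \<in> Wd c (cdom c')"
  shows "pd (h, k) (\<Phi> c c') x = (pd h (tr c c') (fst x),
     (\<Sum>i\<in>UNIV. (k $ i) *\<^sub>R pd (axis i 1) (tr c c') (fst x))
     + (\<Sum>i\<in>UNIV. (snd x $ i) *\<^sub>R pd h (pd (axis i 1) (tr c c')) (fst x)))"
proof -
  have o: "open (Wd c (cdom c'))" by (intro open_Wd c open_cdom)
  have fx: "fst x \<in> cmap c ` (cdom c' \<inter> cdom c)" using x by (auto simp: Wd_def)
  have d: "tr c c' differentiable (at (fst x))" "pd w (tr c c') differentiable (at (fst x))" for w
    using smooth_on_imp_differentiable[OF smooth_tr[OF c] fx]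
      smooth_on_imp_differentiable[OF smooth_on_pd[OF smooth_tr[OF c]] fx] by auto
  have dc: "((\<lambda>x. T (fst x)) has_derivative (\<lambda>h. pd (fst h) T (fst x))) (at x)"
    if "T differentiable (at (fst x))" for T :: "real ^ 'n \<Rightarrow> real ^ 'n"
    by (rule has_derivative_compose[OF has_derivative_fst[OF has_derivative_ident] has_derivative_pd[OF that]])
  have "((\<lambda>x. (tr c c' (fst x), \<Sum>i\<in>UNIV. (snd x $ i) *\<^sub>R pd (axis i 1) (tr c c') (fst x))) has_derivative
     (\<lambda>h. (pd (fst h) (tr c c') (fst x), \<Sum>i\<in>UNIV. (snd x $ i) *\<^sub>R pd (fst h) (pd (axis i 1) (tr c c')) (fst x)
       + (snd h $ i) *\<^sub>R pd (axis i 1) (tr c c') (fst x)))) (at x)"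
    by (intro has_derivative_Pair has_derivative_sum has_derivative_scaleR has_derivative_snd_nth dc d)
  from pd_eqI[OF this, of "(h, k)"] pd_transform[OF o x \<Phi>_eq[OF c], where v="(h, k)"]
  show ?thesis by (simp add: sum.distrib add.commute)
qed

lemma loc_change:
  assumes c: "c \<in> A" "c' \<in> A" and x: "x \<in> Wd c (cdom c')"
  shows "(F \<circ> chart_inv (I c)) x = (F \<circ> chart_inv (I c')) (\<Phi> c c' x)"
proof -
  obtain u where u: "u \<in> TB (cdom c' \<inter> cdom c)" and xu: "x = (cmap c (fst u), snd u c)"
    using Wd_E[OF c(1) x] by metis
  then show ?thesis using \<Phi>_cmap[OF c(1), of u c'] cinv_I[OF c(1), of u] cinv_I[OF c(2), of u]
    by (simp add: TB_iff)
qed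

lemma \<Phi>_Wd:
  assumes c: "c \<in> A" "c' \<in> A" and x: "x \<in> Wd c V" "x \<in> Wd c (cdom c')"
  shows "\<Phi> c c' x \<in> Wd c' V"
proof -
  obtain u where u: "u \<in> TB (V \<inter> cdom c)" and xu: "x = (cmap c (fst u), snd u c)"
    using Wd_E[OF c(1) x(1)] by metis
  obtain u' where u': "u' \<in> TB (cdom c' \<inter> cdom c)" and xu': "x = (cmap c (fst u'), snd u' c)"
    using Wd_E[OF c(1) x(2)] by metis
  have "u' = u" using xu xu' u u' cinv_I[OF c(1), of u] cinv_I[OF c(1), of u'] by (simp add: TB_iff)
  then show ?thesis using u u' \<Phi>_cmap[OF c(1), of u c'] Wd_I[of u V c'] by (simp add: xu TB_iff)
qed

text \<open>Smoothness is demanded in all charts; it passes from one chart to the others by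
  composition with the smooth map \<open>\<Phi>\<close>.\<close>

lemma smooth_function_chart:
  assumes c: "c \<in> A" and V: "open V" "V \<subseteq> cdom c"
    and F: "smooth_on (Wd c V) (F \<circ> chart_inv (I c))"
  shows "smooth_function (tangent_atlas A) (TB V) F"
  unfolding smooth_function_iff
proof
  fix c' assume c': "c' \<in> A"
  have o: "open (Wd c' V)" using open_Wd c' V by blast
  have sub: "Wd c' V \<subseteq> Wd c' (cdom c)" by (rule Wd_mono[OF V(2)])
  have "smooth_on (Wd c' V) (\<lambda>x. (F \<circ> chart_inv (I c)) (\<Phi> c' c x))"
    by (rule smooth_on_compose[OF o smooth_on_subset[OF smooth_\<Phi>[OF c' c] sub] F])
       (use \<Phi>_Wd[OF c' c] sub in blast)
  moreover have "(F \<circ> chart_inv (I c')) x = (F \<circ> chart_inv (I c)) (\<Phi> c' c x)" if "x \<in> Wd c' V" for x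
    by (rule loc_change[OF c' c]) (use sub that in blast)
  ultimately show "smooth_on (Wd c' V) (F \<circ> chart_inv (I c'))" 
    using smooth_on_cong[OF o, of "F \<circ> chart_inv (I c')" "\<lambda>x. (F \<circ> chart_inv (I c)) (\<Phi> c' c x)"]
    by blast
qed

lemma smooth_function_subset:
  "smooth_function (tangent_atlas A) (TB V) F \<Longrightarrow> V' \<subseteq> V \<Longrightarrow> smooth_function (tangent_atlas A) (TB V') F"
  unfolding smooth_function_iff using smooth_on_subset Wd_mono by blast

lemma loc_eqI:
  assumes "c \<in> A" "x \<in> Wd c V" "\<And>u. u \<in> TB (V \<inter> cdom c) \<Longrightarrow> F u = G u"
  shows "(F \<circ> chart_inv (I c)) x = (G \<circ> chart_inv (I c)) x"
proof (rule Wd_E[OF assms(1,2)])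
  fix u assume "u \<in> TB (V \<inter> cdom c)" "chart_inv (I c) x = u"
  then show ?thesis using assms(3) by simp
qed

lemma smooth_function_cong:
  assumes "open V" "\<And>u. u \<in> TB V \<Longrightarrow> F u = G u"
  shows "smooth_function (tangent_atlas A) (TB V) F \<longleftrightarrow> smooth_function (tangent_atlas A) (TB V) G"
proof -
  have "(F \<circ> chart_inv (I c)) x = (G \<circ> chart_inv (I c)) x" if "c \<in> A" "x \<in> Wd c V" for c x
    by (rule loc_eqI[OF that]) (use assms(2) in \<open>auto simp: TB_iff\<close>)
  then have "smooth_on (Wd c V) (F \<circ> chart_inv (I c)) \<longleftrightarrow> smooth_on (Wd c V) (G \<circ> chart_inv (I c))"
    if "c \<in> A" for c using smooth_on_cong[OF open_Wd[OF that assms(1)]] that by blast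
  then show ?thesis unfolding smooth_function_iff by blast
qed

section \<open>Coordinate derivatives under a change of chart\<close>

lemma ddv_dv: "ddv A c i F u = dv i (F \<circ> chart_inv (I c)) (cmap c (fst u), snd u c)"
  by (simp add: ddv_def dv_def pd_def)

lemma ddq_dq: "ddq A c i F u = dq i (F \<circ> chart_inv (I c)) (cmap c (fst u), snd u c)"
  by (simp add: ddq_def dq_def pd_def)

lemma loc_ddv:
  assumes "c \<in> A" "x \<in> Wd c V"
  shows "(ddv A c i F \<circ> chart_inv (I c)) x = dv i (F \<circ> chart_inv (I c)) x"
proof (rule Wd_E[OF assms])
  fix u assume "x = (cmap c (fst u), snd u c)" "chart_inv (I c) x = u"
  then show ?thesis by (simp add: ddv_dv)
qed

lemma ddv_ddv:
  assumes c: "c \<in> A" and u: "u \<in> TB (cdom c)"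
  shows "ddv A c i (ddv A c j F) u = dv i (dv j (F \<circ> chart_inv (I c))) (cmap c (fst u), snd u c)"
  unfolding ddv_dv[of c i] dv_def[of i]
  by (rule pd_transform[OF open_Wd[OF c open_cdom[OF c]] Wd_I[OF u]])
     (use u c loc_ddv in \<open>auto simp: TB_iff\<close>)

lemma smooth_function_ddv:
  assumes c: "c \<in> A" and V: "open V" and F: "smooth_function (tangent_atlas A) (TB V) F"
  shows "smooth_function (tangent_atlas A) (TB (V \<inter> cdom c)) (ddv A c i F)"
proof (rule smooth_function_chart[OF c])
  show "open (V \<inter> cdom c)" using V open_cdom[OF c] by blast
  then have o: "open (Wd c (V \<inter> cdom c))" by (rule open_Wd[OF c])
  have "smooth_on (Wd c (V \<inter> cdom c)) (dv i (F \<circ> chart_inv (I c)))"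
    unfolding dv_def
    by (rule smooth_on_pd) (use c smooth_function_subset[OF F, of "V \<inter> cdom c"] smooth_function_iff in blast)
  then show "smooth_on (Wd c (V \<inter> cdom c)) (ddv A c i F \<circ> chart_inv (I c))"
    using smooth_on_cong[OF o, of "ddv A c i F \<circ> chart_inv (I c)" "dv i (F \<circ> chart_inv (I c))"] loc_ddv[OF c]
    by blast
qed auto

text \<open>Velocities transform linearly by a Jacobian that depends on the base point only, so
  vertical derivatives transform by the Jacobian alone. Varying the position at fixed velocity in
  \<open>c\<close> also varies the velocity in \<open>c'\<close>, which adds a vertical
  term.\<close>

lemma coordinate_change:
  assumes c: "c \<in> A" "c' \<in> A" and V: "open V" and u: "u \<in> TB V" "fst u \<in> cdom c" "fst u \<in> cdom c'"
    and F: "smooth_function (tangent_atlas A) (TB V) F"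
  shows ddv_change: "ddv A c i F u = (\<Sum>k\<in>UNIV. J c c' (fst u) (axis i 1) $ k * ddv A c' k F u)"
    and ddq_change: "ddq A c i F u = (\<Sum>k\<in>UNIV. J c c' (fst u) (axis i 1) $ k * ddq A c' k F u)
      + (\<Sum>k\<in>UNIV. pd (snd u c) (pd (axis i 1) (tr c c')) (cmap c (fst u)) $ k * ddv A c' k F u)"
proof -
  let ?x = "(cmap c (fst u), snd u c)"
  have x: "?x \<in> Wd c (cdom c')" using u by (auto simp: TB_iff Wd_def)
  have \<Phi>x: "\<Phi> c c' ?x = (cmap c' (fst u), snd u c')" using \<Phi>_cmap[OF c(1)] u by (simp add: TB_iff)
  have "(F \<circ> chart_inv (I c')) differentiable (at (\<Phi> c c' ?x))"
    unfolding \<Phi>x using F c(2) Wd_I[OF u(1,3)] unfolding smooth_function_iff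
    using smooth_on_imp_differentiable by blast
  note d = this
  have "pd w (F \<circ> chart_inv (I c)) ?x = pd w (\<lambda>x. (F \<circ> chart_inv (I c')) (\<Phi> c c' x)) ?x" for w
    by (rule pd_transform[OF open_Wd[OF c(1) open_cdom[OF c(2)]] x loc_change[OF c]])
  also have "pd w (\<lambda>x. (F \<circ> chart_inv (I c')) (\<Phi> c c' x)) ?x =
      pd (pd w (\<Phi> c c') ?x) (F \<circ> chart_inv (I c')) (\<Phi> c c' ?x)" for w
    by (rule pd_compose[OF smooth_on_imp_differentiable[OF smooth_\<Phi>[OF c] x] d])
  finally have e: "pd w (F \<circ> chart_inv (I c)) ?x =
      pd (pd w (\<Phi> c c') ?x) (F \<circ> chart_inv (I c')) (\<Phi> c c' ?x)" for w .
  have fx: "fst ?x \<in> cmap c ` (cdom c' \<inter> cdom c)" using x by (auto simp: Wd_def)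
  have opn: "open (cmap c ` (cdom c' \<inter> cdom c))" by (intro open_cmap_image c open_cdom)
  have "(\<Sum>m\<in>UNIV. (axis i 1 $ m) *\<^sub>R pd (axis m 1) (tr c c') (cmap c (fst u))) = J c c' (fst u) (axis i 1)"
    unfolding J_def using pd_vec_expand[OF tr_differentiable[OF c u(2,3)], of "axis i 1"] by simp
  then have v: "pd (0, axis i 1) (\<Phi> c c') ?x = (0, J c c' (fst u) (axis i 1))"
    unfolding pd_\<Phi>[OF c x] using linear_0[OF linear_pd[OF tr_differentiable[OF c u(2,3)]]]
      linear_0[OF linear_pd[OF smooth_on_imp_differentiable[OF smooth_on_pd[OF smooth_tr[OF c]] fx]]] by simp
  show "ddv A c i F u = (\<Sum>k\<in>UNIV. J c c' (fst u) (axis i 1) $ k * ddv A c' k F u)"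
    unfolding ddv_dv dv_def[of i] e v pd_pair_expand[OF d] unfolding \<Phi>x by simp
  \<comment> \<open>Symmetry of second derivatives gives the derivative of a Jacobian column in the
    direction of the velocity. Along a curve this is the time derivative of that column.\<close>
  have "(\<Sum>m\<in>UNIV. (snd u c $ m) *\<^sub>R pd (axis i 1) (pd (axis m 1) (tr c c')) (cmap c (fst u))) =
      pd (snd u c) (pd (axis i 1) (tr c c')) (cmap c (fst u))"
    using pd_vec_expand[OF smooth_on_imp_differentiable[OF smooth_on_pd[OF smooth_tr[OF c]] fx], of "snd u c" "axis i 1"]
      pd_commute_vec[OF opn smooth_tr[OF c] fx, of "axis i 1"] by simp
  then have q: "pd (axis i 1, 0) (\<Phi> c c') ?x = (J c c' (fst u) (axis i 1), pd (snd u c) (pd (axis i 1) (tr c c')) (cmap c (fst u)))"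
    unfolding pd_\<Phi>[OF c x] by (simp add: J_def)
  show "ddq A c i F u = (\<Sum>k\<in>UNIV. J c c' (fst u) (axis i 1) $ k * ddq A c' k F u)
      + (\<Sum>k\<in>UNIV. pd (snd u c) (pd (axis i 1) (tr c c')) (cmap c (fst u)) $ k * ddv A c' k F u)"
    unfolding ddq_dq ddv_dv dq_def[of i] e q pd_pair_expand[OF d] unfolding \<Phi>x by simp
qed

text \<open>The Jacobian is constant along the fibres and passes through the second vertical
  derivative, so the fibre Hessian is a tensor.\<close>

lemma hessian_change:
  assumes c: "c \<in> A" "c' \<in> A" and V: "open V" and u: "u \<in> TB V" "fst u \<in> cdom c" "fst u \<in> cdom c'"
    and L: "smooth_function (tangent_atlas A) (TB V) L"
  shows "ddv A c i (ddv A c j L) u = (\<Sum>k\<in>UNIV. \<Sum>l\<in>UNIV.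
    J c c' (fst u) (axis i 1) $ k * J c c' (fst u) (axis j 1) $ l * ddv A c' k (ddv A c' l L) u)"
proof -
  let ?x = "(cmap c (fst u), snd u c)"
  let ?G = "\<lambda>l. ddv A c' l L \<circ> chart_inv (I c)"
  let ?b = "\<lambda>l x. pd (axis j 1) (tr c c') x $ l"
  have V': "open (V \<inter> cdom c')" using V open_cdom[OF c(2)] by blast
  have u': "u \<in> TB (V \<inter> cdom c')" using u by (simp add: TB_iff)
  have G: "smooth_function (tangent_atlas A) (TB (V \<inter> cdom c')) (ddv A c' l L)" for l
    by (rule smooth_function_ddv[OF c(2) V L])
  have x: "?x \<in> Wd c (V \<inter> cdom c')" by (rule Wd_I[OF u' u(2)])
  have Gd: "?G l differentiable (at ?x)" for l
    using G[of l] c(1) x unfolding smooth_function_iff using smooth_on_imp_differentiable by blast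
  have fx: "fst ?x \<in> cmap c ` (cdom c' \<inter> cdom c)" using u by simp
  have bd: "?b l differentiable (at (fst ?x))" for l
    by (rule smooth_on_imp_differentiable[OF smooth_on_nth[OF _ smooth_on_pd[OF smooth_tr[OF c]]] fx])
       (intro open_cmap_image c open_cdom)
  have bfd: "(\<lambda>x. ?b l (fst x)) differentiable (at ?x)" for l
    using has_derivative_compose[OF has_derivative_fst[OF has_derivative_ident] has_derivative_pd[OF bd]]
      differentiableI by blast
  have eq: "(ddv A c j L \<circ> chart_inv (I c)) y = (\<Sum>l\<in>UNIV. ?b l (fst y) * ?G l y)"
    if y: "y \<in> Wd c (V \<inter> cdom c')" for y
  proof -
    obtain u1 where u1: "u1 \<in> TB (V \<inter> cdom c' \<inter> cdom c)" "y = (cmap c (fst u1), snd u1 c)" "chart_inv (I c) y = u1"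
      using Wd_E[OF c(1) y] by metis
    then show ?thesis using ddv_change[OF c V _ _ _ L, of u1 j] by (simp add: TB_iff J_def)
  qed
  have "ddv A c i (ddv A c j L) u = pd (0, axis i 1) (\<lambda>y. \<Sum>l\<in>UNIV. ?b l (fst y) * ?G l y) ?x"
    unfolding ddv_dv[of c i] dv_def by (rule pd_transform[OF open_Wd[OF c(1) V'] x eq])
  also have "\<dots> = (\<Sum>l\<in>UNIV. pd (0, axis i 1) (\<lambda>y. ?b l (fst y) * ?G l y) ?x)"
    by (intro pd_sum differentiable_mult bfd Gd)
  also have "\<dots> = (\<Sum>l\<in>UNIV. J c c' (fst u) (axis j 1) $ l * ddv A c i (ddv A c' l L) u)"
  proof (rule sum.cong[OF refl])
    fix l
    have "pd (0, axis i 1) (\<lambda>y. ?b l (fst y)) ?x = 0"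
      using pd_fst_arg[OF bd[of l], of "(0, axis i 1)"] linear_0[OF linear_pd[OF bd[of l]]] by simp
    then show "pd (0, axis i 1) (\<lambda>y. ?b l (fst y) * ?G l y) ?x =
        J c c' (fst u) (axis j 1) $ l * ddv A c i (ddv A c' l L) u"
      unfolding ddv_dv[of c i] dv_def[of i] using pd_mult[OF bfd[of l] Gd[of l], of "(0, axis i 1)"] by (simp add: J_def)
  qed
  also have "\<dots> = (\<Sum>l\<in>UNIV. \<Sum>k\<in>UNIV. J c c' (fst u) (axis i 1) $ k * J c c' (fst u) (axis j 1) $ l * ddv A c' k (ddv A c' l L) u)"
    unfolding ddv_change[OF c V' u' u(2,3) G] by (simp add: sum_distrib_left mult_ac)
  finally show ?thesis by (subst sum.swap)
qed

end


section \<open>Tensor fields along the projection in coordinates\<close>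

text \<open>The covariant derivatives and the curvature condition are all brought into this
  trilinear form, so that statements about vector fields become statements about components.\<close>

definition tri :: "('n::finite \<Rightarrow> 'n \<Rightarrow> 'n \<Rightarrow> real) \<Rightarrow> real ^ 'n \<Rightarrow> real ^ 'n \<Rightarrow> real ^ 'n \<Rightarrow> real" where
  "tri T x y z = (\<Sum>i\<in>UNIV. \<Sum>j\<in>UNIV. \<Sum>k\<in>UNIV. T i j k * x $ i * y $ j * z $ k)"

lemma tri_axis: "tri T (axis i 1) (axis j 1) (axis k 1) = T i j k"
proof -
  have s: "(\<Sum>m\<in>UNIV. F m * axis a 1 $ m) = F a" for F :: "'a \<Rightarrow> real" and a
    by (simp add: axis_def if_distrib cong: if_cong)
  have "tri T (axis i 1) (axis j 1) (axis k 1) = (\<Sum>a\<in>UNIV. (\<Sum>b\<in>UNIV.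
      (\<Sum>c\<in>UNIV. T a b c * axis k 1 $ c) * axis j 1 $ b) * axis i 1 $ a)"
    unfolding tri_def by (simp add: sum_distrib_right sum_distrib_left mult_ac)
  then show ?thesis unfolding s .
qed

lemma tri_swap12: "(\<And>i j k. T i j k = T j i k) \<Longrightarrow> tri T x y z = tri T y x z"
  unfolding tri_def by (subst sum.swap) (simp add: mult_ac)

lemma tri_swap23:
  assumes "\<And>i j k. T i j k = T i k j"
  shows "tri T x y z = tri T x z y"
proof -
  have "(\<Sum>j\<in>UNIV. \<Sum>k\<in>UNIV. T i j k * x $ i * y $ j * z $ k) =
      (\<Sum>j\<in>UNIV. \<Sum>k\<in>UNIV. T i j k * x $ i * z $ j * y $ k)" for i
    by (subst sum.swap) (simp add: assms[of i] mult_ac)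
  then show ?thesis unfolding tri_def by simp
qed

lemma tri_rotate: "tri C y z x = tri (\<lambda>i j k. C j k i) x y z"
proof -
  have "tri C y z x = (\<Sum>j\<in>UNIV. \<Sum>i\<in>UNIV. \<Sum>k\<in>UNIV. C j k i * y $ j * z $ k * x $ i)"
    unfolding tri_def by (intro sum.cong refl sum.swap)
  also have "\<dots> = (\<Sum>i\<in>UNIV. \<Sum>j\<in>UNIV. \<Sum>k\<in>UNIV. C j k i * y $ j * z $ k * x $ i)"
    by (rule sum.swap)
  finally show ?thesis unfolding tri_def by (simp add: mult_ac)
qed

lemma tri_add: "tri S x y z + tri T x y z = tri (\<lambda>i j k. S i j k + T i j k) x y z"
  by (simp add: tri_def sum.distrib distrib_right)

lemma tri_cyclic_sum:
  "tri C x y z + tri C y z x + tri C z x y = tri (\<lambda>i j k. C i j k + C j k i + C k i j) x y z"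
proof -
  have "tri C z x y = tri (\<lambda>i j k. C k i j) x y z"
    unfolding tri_rotate[of C z x y] by (rule tri_rotate)
  then show ?thesis unfolding tri_rotate[of C y z x] by (simp only: tri_add)
qed

text \<open>The shape produced by \<open>derivation02\<close>, with the differentiation index summed
  inside the other two.\<close>

lemma tri_alt:
  "(\<Sum>i\<in>UNIV. \<Sum>j\<in>UNIV. (\<Sum>k\<in>UNIV. x $ k * T k i j) * y $ i * z $ j) = tri T x y z"
proof -
  have "tri T x y z = tri (\<lambda>i j k. T k i j) y z x" by (rule tri_rotate[symmetric, of "\<lambda>i j k. T k i j", simplified])
  then show ?thesis by (simp add: tri_def sum_distrib_left sum_distrib_right mult_ac)
qed

lemma DV02_tri:
  "DV02 A c X g u y z = tri (\<lambda>k i j. ddv A c k (comp02 A c g i j) u) (X u c) (y c) (z c)"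
  unfolding DV02_def derivation02_def DV_fun_def by (simp add: tri_alt)

lemma DH02_tri:
  "DH02 A \<Gamma> c X g u y z = tri (\<lambda>k i j. ddh A \<Gamma> c k (comp02 A c g i j) u
     - (\<Sum>l\<in>UNIV. comp02 A c g l j u * ddv A c k (conn A \<Gamma> c l i) u)
     - (\<Sum>l\<in>UNIV. comp02 A c g i l u * ddv A c k (conn A \<Gamma> c l j) u)) (X u c) (y c) (z c)"
proof -
  define C where "C = (\<lambda>k l i. ddv A c k (conn A \<Gamma> c l i) u)"
  define G where "G = (\<lambda>i j. comp02 A c g i j u)"
  define H where "H = (\<lambda>k i j. ddh A \<Gamma> c k (comp02 A c g i j) u)"
  let ?x = "X u c" and ?y = "y c" and ?z = "z c"
  \<comment> \<open>Moves the innermost of three sums to the outside. It brings the index contracted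
    between \<open>G\<close> and \<open>C\<close> to the innermost place in \<open>1\<close> and
    \<open>2\<close>, the contributions of the coordinate 1-forms in the first and second
    slot.\<close>
  have s3: "(\<Sum>j\<in>UNIV. \<Sum>k\<in>UNIV. \<Sum>l\<in>UNIV. F j k l) = (\<Sum>l\<in>UNIV. \<Sum>j\<in>UNIV. \<Sum>k\<in>UNIV. F j k l)"
    for F :: "'b \<Rightarrow> 'b \<Rightarrow> 'b \<Rightarrow> real"
  proof -
    have "(\<Sum>j\<in>UNIV. \<Sum>k\<in>UNIV. \<Sum>l\<in>UNIV. F j k l) = (\<Sum>j\<in>UNIV. \<Sum>l\<in>UNIV. \<Sum>k\<in>UNIV. F j k l)"
      by (intro sum.cong refl sum.swap)
    then show ?thesis by (subst (asm) sum.swap)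
  qed
  have 1: "(\<Sum>i\<in>UNIV. \<Sum>j\<in>UNIV. G i j * - (\<Sum>k\<in>UNIV. \<Sum>l\<in>UNIV. ?x $ k * C k i l * ?y $ l) * ?z $ j) =
      tri (\<lambda>k i j. - (\<Sum>l\<in>UNIV. G l j * C k l i)) ?x ?y ?z"
  proof -
    have "(\<Sum>i\<in>UNIV. \<Sum>j\<in>UNIV. G i j * - (\<Sum>k\<in>UNIV. \<Sum>l\<in>UNIV. ?x $ k * C k i l * ?y $ l) * ?z $ j) =
        (\<Sum>i\<in>UNIV. \<Sum>j\<in>UNIV. \<Sum>k\<in>UNIV. \<Sum>l\<in>UNIV. - (?x $ k * G i j * C k i l * ?y $ l * ?z $ j))"
      by (simp add: sum_distrib_left sum_distrib_right sum_negf mult_ac)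
    also have "\<dots> = (\<Sum>i\<in>UNIV. \<Sum>l\<in>UNIV. \<Sum>j\<in>UNIV. \<Sum>k\<in>UNIV. - (?x $ k * G i j * C k i l * ?y $ l * ?z $ j))"
      by (intro sum.cong refl s3)
    also have "\<dots> = (\<Sum>l\<in>UNIV. \<Sum>i\<in>UNIV. \<Sum>j\<in>UNIV. \<Sum>k\<in>UNIV. - (?x $ k * G i j * C k i l * ?y $ l * ?z $ j))"
      by (rule sum.swap)
    also have "\<dots> = (\<Sum>l\<in>UNIV. \<Sum>j\<in>UNIV. \<Sum>k\<in>UNIV. \<Sum>i\<in>UNIV. - (?x $ k * G i j * C k i l * ?y $ l * ?z $ j))"
      by (intro sum.cong refl s3[symmetric])
    also have "\<dots> = (\<Sum>l\<in>UNIV. \<Sum>j\<in>UNIV. (\<Sum>k\<in>UNIV. ?x $ k * - (\<Sum>i\<in>UNIV. G i j * C k i l)) * ?y $ l * ?z $ j)"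
      by (simp add: sum_distrib_left sum_distrib_right sum_negf mult_ac)
    finally show ?thesis unfolding tri_alt .
  qed
  have 2: "(\<Sum>i\<in>UNIV. \<Sum>j\<in>UNIV. G i j * ?y $ i * - (\<Sum>k\<in>UNIV. \<Sum>l\<in>UNIV. ?x $ k * C k j l * ?z $ l)) =
      tri (\<lambda>k i j. - (\<Sum>l\<in>UNIV. G i l * C k l j)) ?x ?y ?z"
  proof -
    have "(\<Sum>i\<in>UNIV. \<Sum>j\<in>UNIV. G i j * ?y $ i * - (\<Sum>k\<in>UNIV. \<Sum>l\<in>UNIV. ?x $ k * C k j l * ?z $ l)) =
        (\<Sum>i\<in>UNIV. \<Sum>j\<in>UNIV. \<Sum>k\<in>UNIV. \<Sum>l\<in>UNIV. - (?x $ k * G i j * C k j l * ?y $ i * ?z $ l))"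
      by (simp add: sum_distrib_left sum_distrib_right sum_negf mult_ac)
    also have "\<dots> = (\<Sum>i\<in>UNIV. \<Sum>l\<in>UNIV. \<Sum>j\<in>UNIV. \<Sum>k\<in>UNIV. - (?x $ k * G i j * C k j l * ?y $ i * ?z $ l))"
      by (intro sum.cong refl s3)
    also have "\<dots> = (\<Sum>i\<in>UNIV. \<Sum>l\<in>UNIV. \<Sum>k\<in>UNIV. \<Sum>j\<in>UNIV. - (?x $ k * G i j * C k j l * ?y $ i * ?z $ l))"
      by (intro sum.cong refl sum.swap)
    also have "\<dots> = (\<Sum>i\<in>UNIV. \<Sum>l\<in>UNIV. (\<Sum>k\<in>UNIV. ?x $ k * - (\<Sum>j\<in>UNIV. G i j * C k j l)) * ?y $ i * ?z $ l)"
      by (simp add: sum_distrib_left sum_distrib_right sum_negf mult_ac)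
    finally show ?thesis unfolding tri_alt .
  qed
  have "DH02 A \<Gamma> c X g u y z = tri H ?x ?y ?z + tri (\<lambda>k i j. - (\<Sum>l\<in>UNIV. G l j * C k l i)) ?x ?y ?z
      + tri (\<lambda>k i j. - (\<Sum>l\<in>UNIV. G i l * C k l j)) ?x ?y ?z"
    unfolding 1[symmetric] 2[symmetric] tri_alt[symmetric, of H]
    unfolding DH02_def derivation02_def DH_fun_def DH_dq_def C_def G_def H_def sum.distrib ..
  also have "\<dots> = tri (\<lambda>k i j. H k i j - (\<Sum>l\<in>UNIV. G l j * C k l i) - (\<Sum>l\<in>UNIV. G i l * C k l j)) ?x ?y ?z"
    by (simp only: tri_add diff_conv_add_uminus)
  finally show ?thesis unfolding C_def G_def H_def .
qed

section \<open>Tensors and vector fields along the projection at a point\<close>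

context manifold
begin

lemma tangent_vec_linear:
  assumes "c \<in> A" "p \<in> cdom c"
  shows "tangent_vec A c p (a *\<^sub>R v + b *\<^sub>R w) = (\<lambda>c'. a *\<^sub>R tangent_vec A c p v c' + b *\<^sub>R tangent_vec A c p w c')"
proof
  fix c'
  show "tangent_vec A c p (a *\<^sub>R v + b *\<^sub>R w) c' = a *\<^sub>R tangent_vec A c p v c' + b *\<^sub>R tangent_vec A c p w c'"
  proof (cases "c' \<in> A \<and> p \<in> cdom c'")
    case True
    then interpret linear "J c c' p" using linear_J assms by blast
    show ?thesis using True by (simp add: tangent_vec_J add scale)
  qed (auto simp: tangent_vec_J)
qed

lemma tensor_expand:
  assumes g: "tensor_field02_along A U g" and c: "c \<in> A" and u: "u \<in> TB U" "fst u \<in> cdom c"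
    and x: "x \<in> tangent_space A (fst u)" and y: "y \<in> tangent_space A (fst u)"
  shows "g u x y = (\<Sum>i\<in>UNIV. \<Sum>j\<in>UNIV. comp02 A c g i j u * x c $ i * y c $ j)"
proof -
  let ?t = "tangent_vec A c (fst u)"
  note tin = tangent_vec_in[OF c u(2)]
  have bil: "g u (\<lambda>c. a *\<^sub>R x c + b *\<^sub>R y c) z = a * g u x z + b * g u y z"
    "g u z (\<lambda>c. a *\<^sub>R x c + b *\<^sub>R y c) = a * g u z x + b * g u z y"
    if "x \<in> tangent_space A (fst u)" "y \<in> tangent_space A (fst u)" "z \<in> tangent_space A (fst u)" for x y z a b
    using conjunct1[OF g[unfolded tensor_field02_along_def]] u(1) that by blast+
  have l1: "linear (\<lambda>v. g u (?t v) z)" if "z \<in> tangent_space A (fst u)" for z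
  proof (rule linearI)
    show "g u (?t (v + w)) z = g u (?t v) z + g u (?t w) z" for v w
      using bil(1)[OF tin tin that, of 1 v 1 w] tangent_vec_linear[OF c u(2), of 1 v 1 w] by simp
    show "g u (?t (r *\<^sub>R v)) z = r *\<^sub>R g u (?t v) z" for r v
      using bil(1)[OF tin tin that, of r v 0 v] tangent_vec_linear[OF c u(2), of r v 0 v] by simp
  qed
  have l2: "linear (\<lambda>v. g u z (?t v))" if "z \<in> tangent_space A (fst u)" for z
  proof (rule linearI)
    show "g u z (?t (v + w)) = g u z (?t v) + g u z (?t w)" for v w
      using bil(2)[OF tin tin that, of 1 v 1 w] tangent_vec_linear[OF c u(2), of 1 v 1 w] by simp
    show "g u z (?t (r *\<^sub>R v)) = r *\<^sub>R g u z (?t v)" for r v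
      using bil(2)[OF tin tin that, of r v 0 v] tangent_vec_linear[OF c u(2), of r v 0 v] by simp
  qed
  have e1: "g u (?t v) z = (\<Sum>i\<in>UNIV. v $ i * g u (?t (axis i 1)) z)" if z: "z \<in> tangent_space A (fst u)" for v z
  proof -
    interpret linear "\<lambda>v. g u (?t v) z" by (rule l1[OF z])
    have "g u (?t v) z = g u (?t (\<Sum>i\<in>UNIV. (v $ i) *\<^sub>R axis i 1)) z" by (simp add: vec_expand)
    then show ?thesis by (simp only: sum scale real_scaleR_def)
  qed
  have e2: "g u z (?t v) = (\<Sum>i\<in>UNIV. v $ i * g u z (?t (axis i 1)))" if z: "z \<in> tangent_space A (fst u)" for v z
  proof -
    interpret linear "\<lambda>v. g u z (?t v)" by (rule l2[OF z])
    have "g u z (?t v) = g u z (?t (\<Sum>i\<in>UNIV. (v $ i) *\<^sub>R axis i 1))" by (simp add: vec_expand)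
    then show ?thesis by (simp only: sum scale real_scaleR_def)
  qed
  have "g u x y = g u (?t (x c)) (?t (y c))"
    using tangent_vec_eq[OF x c u(2)] tangent_vec_eq[OF y c u(2)] by simp
  also have "\<dots> = (\<Sum>i\<in>UNIV. x c $ i * g u (?t (axis i 1)) (?t (y c)))"
    by (rule e1[OF tin])
  also have "\<dots> = (\<Sum>i\<in>UNIV. x c $ i * (\<Sum>j\<in>UNIV. y c $ j * comp02 A c g i j u))"
    unfolding comp02_def by (intro sum.cong refl arg_cong2[where f="(*)"] e2[OF tin])
  finally show ?thesis by (simp add: sum_distrib_left mult_ac)
qed

lemma curvature_tri:
  assumes g: "tensor_field02_along A U g" and c: "c \<in> A" and u: "u \<in> TB U" "fst u \<in> cdom c"
    and z: "z \<in> tangent_space A (fst u)"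
  shows "g u (curvature A \<Gamma> c u x y) z =
    tri (\<lambda>i j k. \<Sum>l\<in>UNIV. curv A \<Gamma> c l i j u * comp02 A c g l k u) (x c) (y c) (z c)"
proof -
  let ?w = "\<chi> k. \<Sum>i\<in>UNIV. \<Sum>j\<in>UNIV. curv A \<Gamma> c k i j u * (x c $ i) * (y c $ j)"
  have "g u (curvature A \<Gamma> c u x y) z = (\<Sum>l\<in>UNIV. \<Sum>k\<in>UNIV. comp02 A c g l k u * ?w $ l * z c $ k)"
    using tensor_expand[OF g c u tangent_vec_in[OF c u(2)] z, of ?w] tangent_vec_self[OF c u(2), of ?w]
    by (simp add: curvature_def)
  also have "\<dots> = (\<Sum>l\<in>UNIV. \<Sum>k\<in>UNIV. \<Sum>i\<in>UNIV. \<Sum>j\<in>UNIV.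
      curv A \<Gamma> c l i j u * comp02 A c g l k u * x c $ i * y c $ j * z c $ k)"
    by (simp add: sum_distrib_left sum_distrib_right mult_ac)
  also have "\<dots> = (\<Sum>l\<in>UNIV. tri (\<lambda>i j k. curv A \<Gamma> c l i j u * comp02 A c g l k u) (x c) (y c) (z c))"
  proof (rule sum.cong[OF refl])
    fix l
    show "(\<Sum>k\<in>UNIV. \<Sum>i\<in>UNIV. \<Sum>j\<in>UNIV. curv A \<Gamma> c l i j u * comp02 A c g l k u * x c $ i * y c $ j * z c $ k) =
      tri (\<lambda>i j k. curv A \<Gamma> c l i j u * comp02 A c g l k u) (x c) (y c) (z c)"
      unfolding tri_rotate[of "\<lambda>i j k. curv A \<Gamma> c l i j u * comp02 A c g l k u"] tri_def
      unfolding tri_def by (simp add: mult_ac)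
  qed
  also have "\<dots> = tri (\<lambda>i j k. \<Sum>l\<in>UNIV. curv A \<Gamma> c l i j u * comp02 A c g l k u) (x c) (y c) (z c)"
  proof -
    have "tri (\<lambda>i j k. \<Sum>l\<in>S. T l i j k) x y z = (\<Sum>l\<in>S. tri (T l) x y z)"
      for S :: "'n set" and T :: "'n \<Rightarrow> 'n \<Rightarrow> 'n \<Rightarrow> 'n \<Rightarrow> real" and x y z
    proof (induction S rule: infinite_finite_induct)
      case (insert l S)
      then show ?case by (simp add: tri_def sum.distrib distrib_right)
    qed (auto simp: tri_def)
    then show ?thesis by simp
  qed
  finally show ?thesis .
qed

text \<open>The constant coordinate vector \<open>w\<close>, lifted from the base and cut off by a
  bump function inside the chart. It lets conditions on vector fields over \<open>U\<close> be read
  off in components at one point.\<close>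

lemma vector_field_extension:
  assumes U: "open U" and c: "c \<in> A" and u: "u \<in> TB U" "fst u \<in> cdom c"
  obtains X where "vector_field_along A U X" "X u c = w"
proof -
  let ?p = "fst u"
  have "open (cmap c ` cdom c)" "cmap c ?p \<in> cmap c ` cdom c" using open_cran[OF c] u(2) by auto
  then obtain r where r: "r > 0" "cball (cmap c ?p) r \<subseteq> cmap c ` cdom c"
    using open_contains_cball by blast
  obtain b :: "real ^ 'n \<Rightarrow> real" where b: "smooth_on UNIV b" "b (cmap c ?p) = 1"
    "\<And>x. x \<notin> cball (cmap c ?p) r \<Longrightarrow> b x = 0" by (rule smooth_bump[OF r(1)]) blast
  \<comment> \<open>The cut-off field vanishes outside \<open>C\<close>. As a compact subset of a
    Hausdorff space \<open>C\<close> is closed, so extension by zero is smooth across the boundary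
    of the chart domain.\<close>
  define C where "C = chart_inv c ` cball (cmap c ?p) r"
  have "compact C" unfolding C_def
    by (intro compact_continuous_image continuous_on_subset[OF cont_cinv[OF c] r(2)] compact_cball)
  then have C: "closed C" by (rule compact_imp_closed)
  define X where "X = (\<lambda>u :: ('q, 'n) npoint. if fst u \<in> cdom c
    then tangent_vec A c (fst u) (b (cmap c (fst u)) *\<^sub>R w) else (\<lambda>c. 0))"
  have X0: "X u' = (\<lambda>c. 0)" if "fst u' \<notin> C" for u'
  proof (cases "fst u' \<in> cdom c")
    case True
    have "cmap c (fst u') \<notin> cball (cmap c ?p) r"
      using that cinv_cmap[OF c True] unfolding C_def by (metis imageI)
    then show ?thesis
      using b(3) tangent_vec_linear[OF c True, of 0 w 0 w] by (simp add: X_def True)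
  qed (simp add: X_def)
  have "vector_field_along A U X"
    unfolding vector_field_along_def
  proof (intro conjI ballI allI)
    show "X u' \<in> tangent_space A (fst u')" for u'
      using tangent_vec_in[OF c] zero_in_tangent_space by (simp add: X_def)
    fix c1 i assume c1: "c1 \<in> A"
    show "smooth_function (tangent_atlas A) (TB (U \<inter> cdom c1)) (\<lambda>u. X u c1 $ i)"
      unfolding smooth_function_iff
    proof (rule ballI, rule smooth_on_local)
      fix c2 x assume c2: "c2 \<in> A" and x: "x \<in> Wd c2 (U \<inter> cdom c1)"
      obtain u' where u': "u' \<in> TB (U \<inter> cdom c1 \<inter> cdom c2)" "x = (cmap c2 (fst u'), snd u' c2)"
        using Wd_E[OF c2 x] by metis
      show "\<exists>T. open T \<and> x \<in> T \<and> smooth_on T ((\<lambda>u. X u c1 $ i) \<circ> chart_inv (I c2))"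
      \<comment> \<open>The open sets \<open>cdom c\<close> and \<open>- C\<close> cover the base;
        on the first the field has a coordinate formula, on the second it is zero.\<close>
      proof (cases "fst u' \<in> cdom c")
        case True
        let ?V = "U \<inter> cdom c1 \<inter> cdom c"
        let ?T = "Wd c2 ?V"
        let ?F = "\<lambda>x. (b (tr c2 c (fst x)) *\<^sub>R pd w (tr c c1) (tr c2 c (fst x))) $ i"
        have o: "open ?T" by (intro open_Wd open_Int c2 U open_cdom c c1)
        have t: "smooth_on ?T (\<lambda>x. tr c2 c (fst x))"
          using smooth_on_subset[OF smooth_tr_fst(1)[OF c2 c] Wd_mono] by auto
        have im: "(\<lambda>x. tr c2 c (fst x)) ` ?T \<subseteq> cmap c ` (cdom c1 \<inter> cdom c)"
          using tr_cmap[OF c2, of _ c] by (auto simp: Wd_def)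
        have "smooth_on ?T (\<lambda>x. b (tr c2 c (fst x)))"
          by (rule smooth_on_compose[OF o t b(1)]) auto
        moreover have "smooth_on ?T (\<lambda>x. pd w (tr c c1) (tr c2 c (fst x)))"
          by (rule smooth_on_compose[OF o t smooth_on_pd[OF smooth_tr[OF c c1]] im])
        ultimately have "smooth_on ?T ?F" by (intro smooth_on_nth smooth_on_scaleR o)
        moreover have "((\<lambda>u. X u c1 $ i) \<circ> chart_inv (I c2)) y = ?F y" if y: "y \<in> ?T" for y
        proof (rule Wd_E[OF c2 y])
          fix v assume v: "v \<in> TB (?V \<inter> cdom c2)" "y = (cmap c2 (fst v), snd v c2)" "chart_inv (I c2) y = v"
          then have p: "fst v \<in> cdom c" "fst v \<in> cdom c1" "fst v \<in> cdom c2" by (auto simp: TB_iff)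
          interpret linear "J c c1 (fst v)" by (rule linear_J[OF c c1 p(1,2)])
          show ?thesis using v(2,3) p c1 c2 tr_cmap[OF c2 p(3), of c]
            by (simp add: X_def tangent_vec_J scale) (simp add: J_def)
        qed
        ultimately have "smooth_on ?T ((\<lambda>u. X u c1 $ i) \<circ> chart_inv (I c2))"
          using smooth_on_cong[OF o, of "(\<lambda>u. X u c1 $ i) \<circ> chart_inv (I c2)" ?F] by blast
        moreover have "x \<in> ?T" using u' True Wd_I[of u' ?V c2] by (simp add: TB_iff)
        ultimately show ?thesis using o by blast
      next
        case False
        let ?V = "U \<inter> cdom c1 \<inter> - C"
        let ?T = "Wd c2 ?V"
        have o: "open ?T" by (intro open_Wd open_Int open_Compl c2 U open_cdom c1 C)
        have "((\<lambda>u. X u c1 $ i) \<circ> chart_inv (I c2)) y = 0" if y: "y \<in> ?T" for y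
        proof (rule Wd_E[OF c2 y])
          fix v assume "v \<in> TB (?V \<inter> cdom c2)" "chart_inv (I c2) y = v"
          then show ?thesis using X0[of v] by (simp add: TB_iff)
        qed
        then have "smooth_on ?T ((\<lambda>u. X u c1 $ i) \<circ> chart_inv (I c2))"
          using smooth_on_cong[OF o, of "(\<lambda>u. X u c1 $ i) \<circ> chart_inv (I c2)" "\<lambda>x. 0"] by simp
        moreover have "fst u' \<notin> C"
        proof
          assume "fst u' \<in> C"
          then obtain y where "y \<in> cmap c ` cdom c" "fst u' = chart_inv c y" using r(2) unfolding C_def by blast
          then show False using False cinv_cmap[OF c] by auto
        qed
        then have "x \<in> ?T" using u' Wd_I[of u' ?V c2] by (simp add: TB_iff)
        ultimately show ?thesis using o by blast
      qed
    qed
  qed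
  moreover have "X u c = w" using u(2) b(2) tangent_vec_self[OF c u(2)] by (simp add: X_def)
  ultimately show ?thesis by (rule that)
qed

text \<open>The derivative depends on the fields only through their values at \<open>u\<close>, and
  these can be made coordinate vectors by extension.\<close>

lemma symmetric_derivative_components:
  assumes U: "open U" and c: "c \<in> A" and u: "u \<in> TB U" "fst u \<in> cdom c"
    and sym: "symmetric_derivative A U D g"
    and D: "\<And>X y z. D c X g u y z = tri T (X u c) (y c) (z c)"
  shows "T k i j = T i k j"
proof -
  obtain X where X: "vector_field_along A U X" "X u c = axis k 1"
    using vector_field_extension[OF U c u, of "axis k 1"] by blast
  obtain Y where Y: "vector_field_along A U Y" "Y u c = axis i 1"
    using vector_field_extension[OF U c u, of "axis i 1"] by blast
  obtain Z where Z: "vector_field_along A U Z" "Z u c = axis j 1"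
    using vector_field_extension[OF U c u, of "axis j 1"] by blast
  have "u \<in> TB (U \<inter> cdom c)" using u by (simp add: TB_iff)
  then have "D c X g u (Y u) (Z u) = D c Y g u (X u) (Z u)"
    using sym X(1) Y(1) Z(1) c unfolding symmetric_derivative_def by blast
  then show ?thesis unfolding D X Y Z tri_axis .
qed

lemma cyclic_curvature_components:
  assumes U: "open U" and c: "c \<in> A" and u: "u \<in> TB U" "fst u \<in> cdom c"
    and g: "tensor_field02_along A U g" and cyc: "cyclic_curvature_condition A \<Gamma> U g"
  shows "(\<Sum>l\<in>UNIV. curv A \<Gamma> c l i j u * comp02 A c g l k u)
    + (\<Sum>l\<in>UNIV. curv A \<Gamma> c l j k u * comp02 A c g l i u)
    + (\<Sum>l\<in>UNIV. curv A \<Gamma> c l k i u * comp02 A c g l j u) = 0"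
proof -
  obtain X where X: "vector_field_along A U X" "X u c = axis i 1"
    using vector_field_extension[OF U c u, of "axis i 1"] by blast
  obtain Y where Y: "vector_field_along A U Y" "Y u c = axis j 1"
    using vector_field_extension[OF U c u, of "axis j 1"] by blast
  obtain Z where Z: "vector_field_along A U Z" "Z u c = axis k 1"
    using vector_field_extension[OF U c u, of "axis k 1"] by blast
  have ts: "X u \<in> tangent_space A (fst u)" "Y u \<in> tangent_space A (fst u)" "Z u \<in> tangent_space A (fst u)"
    using X Y Z u(1) unfolding vector_field_along_def by blast+
  have "u \<in> TB (U \<inter> cdom c)" using u by (simp add: TB_iff)
  then have "g u (curvature A \<Gamma> c u (X u) (Y u)) (Z u) + g u (curvature A \<Gamma> c u (Y u) (Z u)) (X u)
      + g u (curvature A \<Gamma> c u (Z u) (X u)) (Y u) = 0"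
    using cyc X(1) Y(1) Z(1) c unfolding cyclic_curvature_condition_def by blast
  then show ?thesis
    unfolding curvature_tri[OF g c u ts(1)] curvature_tri[OF g c u ts(2)] curvature_tri[OF g c u ts(3)]
      tri_cyclic_sum X Y Z tri_axis .
qed

end


section \<open>Second-order fields and curves in coordinates\<close>

locale sode_manifold = manifold A
  for A :: "('q::t2_space, real ^ 'n::finite) chart set" +
  fixes \<Gamma> :: "('q, 'n) sode"
  assumes sode: "second_order_field A \<Gamma>"
begin

definition fc :: "('q, real ^ 'n) chart \<Rightarrow> (real ^ 'n) \<times> (real ^ 'n) \<Rightarrow> real ^ 'n" where
  "fc c = force A \<Gamma> c \<circ> chart_inv (I c)"

lemma smooth_fc:
  assumes c: "c \<in> A"
  shows "smooth_on (Wd c V) (fc c)"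
proof -
  have "smooth_on (cmap (I c) ` cdom (I c)) ((\<lambda>u. \<Gamma> u (I c)) \<circ> chart_inv (I c))"
    using sode c unfolding second_order_field_def vector_field_def tangent_atlas_def by blast
  then have "smooth_on (Wd c (cdom c)) ((\<lambda>u. \<Gamma> u (I c)) \<circ> chart_inv (I c))"
    using cmap_I_image[OF c, of "cdom c"] by (simp only: cdom_I Int_absorb)
  then have "smooth_on (Wd c (cdom c)) (\<lambda>x. snd (((\<lambda>u. \<Gamma> u (I c)) \<circ> chart_inv (I c)) x))"
    by (intro smooth_on_snd open_Wd c open_cdom)
  then have "smooth_on (Wd c (cdom c)) (fc c)"
    by (simp add: fc_def force_def o_def)
  then show ?thesis by (rule smooth_on_subset) (auto simp: Wd_def)
qed

lemma sode_coords: "c \<in> A \<Longrightarrow> open V \<Longrightarrow> sode_coords (Wd c V) (fc c)"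
  by unfold_locales (auto intro: open_Wd smooth_fc)

lemma fc_force: "c \<in> A \<Longrightarrow> u \<in> TB (cdom c) \<Longrightarrow> fc c (cmap c (fst u), snd u c) = force A \<Gamma> c u"
  by (simp add: fc_def cinv_I)

lemma Gamma_chart:
  assumes "c \<in> A" "u \<in> TB (cdom c)"
  shows "\<Gamma> u (I c) = (snd u c, force A \<Gamma> c u)"
  using sode assms unfolding second_order_field_def force_def by (simp add: prod_eq_iff)

text \<open>As a vector field on the tangent bundle, \<Gamma> is transported by the Jacobian of
  \<open>\<Phi>\<close>; this encodes the transformation law of the forces.\<close>

lemma Gamma_change:
  assumes c: "c \<in> A" "c' \<in> A" and u: "u \<in> TB (cdom c)" "u \<in> TB (cdom c')"
  shows "\<Gamma> u (I c') = pd (\<Gamma> u (I c)) (\<Phi> c c') (cmap c (fst u), snd u c)"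
proof -
  have "u \<in> (\<Union>d\<in>tangent_atlas A. cdom d)" using u(1) c(1) unfolding tangent_atlas_def by force
  then have "\<Gamma> u \<in> tangent_space (tangent_atlas A) u"
    using sode unfolding second_order_field_def vector_field_def by blast
  moreover have "I c \<in> tangent_atlas A" "I c' \<in> tangent_atlas A" using c by (auto simp: tangent_atlas_def)
  moreover have "u \<in> cdom (I c) \<inter> cdom (I c')" using u by simp
  ultimately have "\<Gamma> u (I c') = frechet_derivative (cmap (I c') \<circ> chart_inv (I c)) (at (cmap (I c) u)) (\<Gamma> u (I c))"
    unfolding tangent_space_def by blast
  then show ?thesis by (simp only: pd_def \<Phi>_def cmap_I)
qed

lemma conn_N: "c \<in> A \<Longrightarrow> conn A \<Gamma> c j i u = sode_coords.N (fc c) j i (cmap c (fst u), snd u c)"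
proof -
  assume c: "c \<in> A"
  interpret C: sode_coords "Wd c UNIV" "fc c" by (rule sode_coords[OF c open_UNIV])
  show ?thesis unfolding conn_def C.N_def ddv_dv by (simp add: fc_def o_def)
qed

lemma loc_conn:
  assumes "c \<in> A" "x \<in> Wd c V"
  shows "(conn A \<Gamma> c j i \<circ> chart_inv (I c)) x = sode_coords.N (fc c) j i x"
proof (rule Wd_E[OF assms])
  fix u assume "x = (cmap c (fst u), snd u c)" "chart_inv (I c) x = u"
  then show ?thesis by (simp add: conn_N[OF assms(1)])
qed

lemma ddh_dh: "c \<in> A \<Longrightarrow> ddh A \<Gamma> c i F u = sode_coords.dh (fc c) i (F \<circ> chart_inv (I c)) (cmap c (fst u), snd u c)"
proof -
  assume c: "c \<in> A"
  interpret C: sode_coords "Wd c UNIV" "fc c" by (rule sode_coords[OF c open_UNIV])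
  show ?thesis unfolding ddh_def C.dh_def conn_N[OF c] ddv_dv ddq_dq ..
qed

lemma ddv_conn:
  assumes c: "c \<in> A" and u: "u \<in> TB (cdom c)"
  shows "ddv A c k (conn A \<Gamma> c l i) u = dv k (sode_coords.N (fc c) l i) (cmap c (fst u), snd u c)"
  unfolding ddv_dv dv_def
  by (rule pd_transform[OF open_Wd[OF c open_cdom[OF c]] Wd_I[OF u]])
     (use u loc_conn[OF c] in \<open>auto simp: TB_iff\<close>)

lemma curv_curvN:
  assumes c: "c \<in> A" and u: "u \<in> TB (cdom c)"
  shows "curv A \<Gamma> c k i j u = sode_coords.curvN (fc c) k i j (cmap c (fst u), snd u c)"
proof -
  interpret C: sode_coords "Wd c (cdom c)" "fc c" by (rule sode_coords[OF c open_cdom[OF c]])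
  have x: "(cmap c (fst u), snd u c) \<in> Wd c (cdom c)" by (rule Wd_I[OF u]) (use u in \<open>simp add: TB_iff\<close>)
  have "C.dh j (conn A \<Gamma> c k i \<circ> chart_inv (I c)) (cmap c (fst u), snd u c) =
      C.dh j (C.N k i) (cmap c (fst u), snd u c)" for i j
    by (rule C.transform(3)[OF loc_conn[OF c] x])
  then show ?thesis unfolding curv_def C.curvN_def ddh_dh[OF c] by simp
qed

section \<open>Curves, their lifts and the two systems of equations\<close>

definition vd :: "(real \<Rightarrow> 'q) \<Rightarrow> ('q, real ^ 'n) chart \<Rightarrow> real \<Rightarrow> real ^ 'n" where
  "vd \<gamma> c t = vector_derivative (cmap c \<circ> \<gamma>) (at t)"

definition vdd :: "(real \<Rightarrow> 'q) \<Rightarrow> ('q, real ^ 'n) chart \<Rightarrow> real \<Rightarrow> real ^ 'n" where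
  "vdd \<gamma> c t = vector_derivative (vd \<gamma> c) (at t)"

abbreviation "lift \<equiv> lift_curve A"

lemma fst_lift [simp]: "fst (lift \<gamma> t) = \<gamma> t"
  by (simp add: lift_curve_def)

lemma snd_lift: "c \<in> A \<Longrightarrow> \<gamma> t \<in> cdom c \<Longrightarrow> snd (lift \<gamma> t) c = vd \<gamma> c t"
  by (simp add: lift_curve_def vd_def)

context
  fixes S :: "real set" and \<gamma> :: "real \<Rightarrow> 'q"
  assumes S: "open S" and \<gamma>: "smooth_curve A S \<gamma>"
begin

lemma open_curve_preimage: "open V \<Longrightarrow> open {t \<in> S. \<gamma> t \<in> V}"
  using continuous_open_preimage[of S \<gamma> V] S \<gamma> unfolding smooth_curve_def
  by (simp add: vimage_def Int_def)

lemma curve_derivatives: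
  assumes c: "c \<in> A" and t: "t \<in> S" "\<gamma> t \<in> cdom c"
  shows curve_vd: "((\<lambda>s. cmap c (\<gamma> s)) has_vector_derivative vd \<gamma> c t) (at t)"
    and curve_vdd: "(vd \<gamma> c has_vector_derivative vdd \<gamma> c t) (at t)"
proof -
  let ?T = "{t \<in> S. \<gamma> t \<in> cdom c}"
  have T: "open ?T" by (rule open_curve_preimage[OF open_cdom[OF c]])
  have s: "smooth_on ?T (cmap c \<circ> \<gamma>)" using \<gamma> c unfolding smooth_curve_def by blast
  have 1: "((cmap c \<circ> \<gamma>) has_vector_derivative vd \<gamma> c t) (at t)" if "t \<in> ?T" for t
    using smooth_on_imp_differentiable[OF s that] unfolding vd_def by (simp add: vector_derivative_works)
  show "((\<lambda>s. cmap c (\<gamma> s)) has_vector_derivative vd \<gamma> c t) (at t)" using 1[of t] t by (simp add: o_def)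
  have "vd \<gamma> c t = pd 1 (cmap c \<circ> \<gamma>) t" if "t \<in> ?T" for t
    using pd_eqI[OF 1[OF that, unfolded has_vector_derivative_def]] by simp
  then have "smooth_on ?T (vd \<gamma> c)"
    using smooth_on_cong[OF T, of "vd \<gamma> c" "pd 1 (cmap c \<circ> \<gamma>)"] smooth_on_pd[OF s] by blast
  from smooth_on_imp_differentiable[OF this, of t] t
  show "(vd \<gamma> c has_vector_derivative vdd \<gamma> c t) (at t)"
    unfolding vdd_def by (simp add: vector_derivative_works)
qed

lemma curve_compose:
  assumes c: "c \<in> A" and t: "t \<in> S" "\<gamma> t \<in> cdom c" and F: "F differentiable (at (cmap c (\<gamma> t)))"
  shows "((\<lambda>s. F (cmap c (\<gamma> s))) has_vector_derivative pd (vd \<gamma> c t) F (cmap c (\<gamma> t))) (at t)"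
proof -
  interpret linear "\<lambda>v. pd v F (cmap c (\<gamma> t))" by (rule linear_pd[OF F])
  show ?thesis
    using has_derivative_compose[OF curve_vd[OF c t, unfolded has_vector_derivative_def] has_derivative_pd[OF F]]
    unfolding has_vector_derivative_def scale .
qed

lemma curve_compose2:
  assumes c: "c \<in> A" and t: "t \<in> S" "\<gamma> t \<in> cdom c" and F: "F differentiable (at (cmap c (\<gamma> t), vd \<gamma> c t))"
  shows "((\<lambda>s. F (cmap c (\<gamma> s), vd \<gamma> c s)) has_vector_derivative
    pd (vd \<gamma> c t, vdd \<gamma> c t) F (cmap c (\<gamma> t), vd \<gamma> c t)) (at t)"
proof -
  interpret linear "\<lambda>v. pd v F (cmap c (\<gamma> t), vd \<gamma> c t)" by (rule linear_pd[OF F])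
  have "((\<lambda>s. (cmap c (\<gamma> s), vd \<gamma> c s)) has_derivative (\<lambda>h. h *\<^sub>R (vd \<gamma> c t, vdd \<gamma> c t))) (at t)"
    using has_vector_derivative_Pair[OF curve_derivatives[OF c t]] by (simp add: has_vector_derivative_def)
  from has_derivative_compose[OF this has_derivative_pd[OF F]]
  show ?thesis unfolding has_vector_derivative_def scale .
qed

lemma vd_change:
  assumes c: "c \<in> A" "c' \<in> A" and t: "t \<in> S" "\<gamma> t \<in> cdom c" "\<gamma> t \<in> cdom c'"
  shows "vd \<gamma> c' t = J c c' (\<gamma> t) (vd \<gamma> c t)"
proof -
  have "((\<lambda>s. tr c c' (cmap c (\<gamma> s))) has_vector_derivative J c c' (\<gamma> t) (vd \<gamma> c t)) (at t)"
    unfolding J_def by (rule curve_compose[OF c(1) t(1,2) tr_differentiable[OF c t(2,3)]])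
  then have "((\<lambda>s. cmap c' (\<gamma> s)) has_vector_derivative J c c' (\<gamma> t) (vd \<gamma> c t)) (at t)"
    by (rule has_vector_derivative_transform_within_open[OF _ open_curve_preimage[OF open_cdom[OF c(1)]]])
       (use t tr_cmap[OF c(1), of _ c'] in auto)
  from vector_derivative_unique_at[OF curve_vd[OF c(2) t(1,3)] this] show ?thesis .
qed

lemma lift_in_TB: "t \<in> S \<Longrightarrow> \<gamma> t \<in> V \<Longrightarrow> lift \<gamma> t \<in> TB V"
  unfolding TB_iff tangent_space_J
  by (auto simp: snd_lift intro: vd_change) (auto simp: lift_curve_def)

lemma force_lift:
  assumes "c \<in> A" "t \<in> S" "\<gamma> t \<in> cdom c"
  shows "force A \<Gamma> c (lift \<gamma> t) = fc c (cmap c (\<gamma> t), vd \<gamma> c t)"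
  using fc_force[OF assms(1) lift_in_TB[OF assms(2,3)]] snd_lift[OF assms(1), of \<gamma> t] assms(3) by simp

text \<open>The derivative of the lifted curve and the value of \<Gamma> are both transported by the
  Jacobian of \<open>\<Phi>\<close>, so their equality in one chart gives equality in
  another.\<close>

lemma sode_change:
  assumes c: "c \<in> A" "c' \<in> A" and t: "t \<in> S" "\<gamma> t \<in> cdom c" "\<gamma> t \<in> cdom c'"
    and sol: "vdd \<gamma> c t = force A \<Gamma> c (lift \<gamma> t)"
  shows "vdd \<gamma> c' t = force A \<Gamma> c' (lift \<gamma> t)"
proof -
  let ?u = "lift \<gamma> t"
  have u: "?u \<in> TB (cdom c)" "?u \<in> TB (cdom c')" using lift_in_TB t by auto
  have x: "(cmap c (\<gamma> t), vd \<gamma> c t) \<in> Wd c (cdom c')"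
    using Wd_I[of ?u "cdom c'" c] u t by (simp add: snd_lift c)
  have "((\<lambda>s. \<Phi> c c' (cmap c (\<gamma> s), vd \<gamma> c s)) has_vector_derivative
      pd (vd \<gamma> c t, vdd \<gamma> c t) (\<Phi> c c') (cmap c (\<gamma> t), vd \<gamma> c t)) (at t)"
    by (rule curve_compose2[OF c(1) t(1,2) smooth_on_imp_differentiable[OF smooth_\<Phi>[OF c] x]])
  moreover have "pd (vd \<gamma> c t, vdd \<gamma> c t) (\<Phi> c c') (cmap c (\<gamma> t), vd \<gamma> c t) = (snd ?u c', force A \<Gamma> c' ?u)"
    using Gamma_change[OF c u] Gamma_chart[OF c(1) u(1)] Gamma_chart[OF c(2) u(2)]
    by (simp add: snd_lift c t sol)
  ultimately have "((\<lambda>s. \<Phi> c c' (cmap c (\<gamma> s), vd \<gamma> c s)) has_vector_derivative (snd ?u c', force A \<Gamma> c' ?u)) (at t)"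
    by simp
  then have "((\<lambda>s. (cmap c' (\<gamma> s), vd \<gamma> c' s)) has_vector_derivative (snd ?u c', force A \<Gamma> c' ?u)) (at t)"
  proof (rule has_vector_derivative_transform_within_open[OF _ open_curve_preimage[OF
          open_Int[OF open_cdom[OF c(1)] open_cdom[OF c(2)]]]])
    show "t \<in> {t \<in> S. \<gamma> t \<in> cdom c \<inter> cdom c'}" using t by simp
    fix s assume s: "s \<in> {t \<in> S. \<gamma> t \<in> cdom c \<inter> cdom c'}"
    then show "\<Phi> c c' (cmap c (\<gamma> s), vd \<gamma> c s) = (cmap c' (\<gamma> s), vd \<gamma> c' s)"
      using \<Phi>_cmap[OF c(1), of "lift \<gamma> s" c'] lift_in_TB[of s "cdom c"] by (simp add: snd_lift c)
  qed
  then have "(vd \<gamma> c' t, vdd \<gamma> c' t) = (snd ?u c', force A \<Gamma> c' ?u)"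
    using vector_derivative_unique_at[OF has_vector_derivative_Pair[OF curve_derivatives[OF c(2) t(1,3)]]] by simp
  then show ?thesis by simp
qed

lemma satisfies_sode_iff:
  assumes c: "c \<in> A" and t: "t \<in> S" "\<gamma> t \<in> cdom c"
  shows "satisfies_sode A \<Gamma> \<gamma> t \<longleftrightarrow> vdd \<gamma> c t = fc c (cmap c (\<gamma> t), vd \<gamma> c t)"
proof -
  have "satisfies_sode A \<Gamma> \<gamma> t \<longleftrightarrow> (\<forall>c\<in>A. \<gamma> t \<in> cdom c \<longrightarrow> vdd \<gamma> c t = force A \<Gamma> c (lift \<gamma> t))"
    unfolding satisfies_sode_def vdd_def vd_def[abs_def] ..
  also have "\<dots> \<longleftrightarrow> vdd \<gamma> c t = force A \<Gamma> c (lift \<gamma> t)"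
    using sode_change[OF c _ t] c t(2) by blast
  finally show ?thesis unfolding force_lift[OF c t] .
qed

lemma ddv_lift_derivative:
  assumes c: "c \<in> A" and t: "t \<in> S" "\<gamma> t \<in> cdom c" "\<gamma> t \<in> V" and V: "open V"
    and L: "smooth_function (tangent_atlas A) (TB V) L"
  defines "x \<equiv> (cmap c (\<gamma> t), vd \<gamma> c t)"
  shows "((\<lambda>s. ddv A c i L (lift \<gamma> s)) has_real_derivative
      (\<Sum>k\<in>UNIV. vd \<gamma> c t $ k * dq k (dv i (L \<circ> chart_inv (I c))) x)
      + (\<Sum>k\<in>UNIV. vdd \<gamma> c t $ k * dv k (dv i (L \<circ> chart_inv (I c))) x)) (at t)"
proof -
  let ?F = "dv i (L \<circ> chart_inv (I c))"
  have x: "x \<in> Wd c V"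
    using Wd_I[OF lift_in_TB[OF t(1,3)], of c] t by (simp add: snd_lift c x_def)
  have "smooth_on (Wd c V) ?F"
    unfolding dv_def by (rule smooth_on_pd) (use L c smooth_function_iff in blast)
  then have F: "?F differentiable (at x)" using x by (rule smooth_on_imp_differentiable)
  have "((\<lambda>s. ?F (cmap c (\<gamma> s), vd \<gamma> c s)) has_vector_derivative pd (vd \<gamma> c t, vdd \<gamma> c t) ?F x) (at t)"
    unfolding x_def by (rule curve_compose2[OF c t(1,2) F[unfolded x_def]])
  then have "((\<lambda>s. ddv A c i L (lift \<gamma> s)) has_vector_derivative pd (vd \<gamma> c t, vdd \<gamma> c t) ?F x) (at t)"
    by (rule has_vector_derivative_transform_within_open[OF _ open_curve_preimage[OF open_cdom[OF c]]])
       (use t c in \<open>auto simp: ddv_dv snd_lift\<close>)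
  then show ?thesis
    unfolding pd_pair_expand[OF F] has_real_derivative_iff_has_vector_derivative .
qed

definition ELc where
  "ELc L D c i t = deriv (\<lambda>s. ddv A c i L (lift \<gamma> s)) t - ddq A c i L (lift \<gamma> t) - ddv A c i D (lift \<gamma> t)"

text \<open>The defects form a covector. The product rule applied to \<open>ddv_change\<close>
  differentiates the Jacobian in time, and this cancels the extra vertical term of
  \<open>ddq_change\<close>.\<close>

lemma ELc_change:
  assumes c: "c \<in> A" "c' \<in> A" and t: "t \<in> S" "\<gamma> t \<in> cdom c" "\<gamma> t \<in> cdom c'" "\<gamma> t \<in> V" and V: "open V"
    and L: "smooth_function (tangent_atlas A) (TB V) L" and D: "smooth_function (tangent_atlas A) (TB V) D"
  shows "ELc L D c i t = (\<Sum>k\<in>UNIV. J c c' (\<gamma> t) (axis i 1) $ k * ELc L D c' k t)"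
proof -
  let ?T = "{s \<in> S. \<gamma> s \<in> V \<inter> cdom c \<inter> cdom c'}"
  let ?P = "\<lambda>k s. ddv A c' k L (lift \<gamma> s)"
  let ?b = "\<lambda>k s. pd (axis i 1) (tr c c') (cmap c (\<gamma> s)) $ k"
  let ?b' = "\<lambda>k. pd (vd \<gamma> c t) (pd (axis i 1) (tr c c')) (cmap c (\<gamma> t)) $ k"
  have T: "open ?T" by (rule open_curve_preimage) (intro open_Int V open_cdom c)
  have P: "(?P k has_real_derivative deriv (?P k) t) (at t)" for k
    using DERIV_imp_deriv[OF ddv_lift_derivative[OF c(2) t(1,3,4) V L]]
      ddv_lift_derivative[OF c(2) t(1,3,4) V L] by metis
  have "pd (axis i 1) (tr c c') differentiable (at (cmap c (\<gamma> t)))"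
    by (rule smooth_on_imp_differentiable[OF smooth_on_pd[OF smooth_tr[OF c]]]) (use t in simp)
  from curve_compose[OF c(1) t(1,2) this]
  have b: "(?b k has_real_derivative ?b' k) (at t)" for k
    unfolding has_real_derivative_iff_has_vector_derivative has_vector_derivative_def
    using bounded_linear.has_derivative[OF bounded_linear_vec_nth] by fastforce
  have "((\<lambda>s. \<Sum>k\<in>UNIV. ?b k s * ?P k s) has_real_derivative
      (\<Sum>k\<in>UNIV. ?b' k * ?P k t + deriv (?P k) t * ?b k t)) (at t)"
    by (intro DERIV_sum DERIV_mult b P)
  moreover have "(\<Sum>k\<in>UNIV. ?b k s * ?P k s) = ddv A c i L (lift \<gamma> s)" if "s \<in> ?T" for s
    using ddv_change[OF c V _ _ _ L, of "lift \<gamma> s" i] that lift_in_TB[of s V] by (simp add: J_def)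
  ultimately have "((\<lambda>s. ddv A c i L (lift \<gamma> s)) has_real_derivative
      (\<Sum>k\<in>UNIV. ?b' k * ?P k t + deriv (?P k) t * ?b k t)) (at t)"
    using has_field_derivative_transform_within_open[OF _ T, of "\<lambda>s. \<Sum>k\<in>UNIV. ?b k s * ?P k s"] t by simp
  then have "deriv (\<lambda>s. ddv A c i L (lift \<gamma> s)) t = (\<Sum>k\<in>UNIV. ?b' k * ?P k t) + (\<Sum>k\<in>UNIV. ?b k t * deriv (?P k) t)"
    by (subst DERIV_imp_deriv) (auto simp: sum.distrib mult.commute)
  moreover note ddq_change[OF c V lift_in_TB[OF t(1,4)] _ _ L, of i]
    ddv_change[OF c V lift_in_TB[OF t(1,4)] _ _ D, of i]
  ultimately show ?thesis
    unfolding ELc_def right_diff_distrib sum_subtractf using t by (simp add: snd_lift c J_def)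
qed

lemma satisfies_EL_iff:
  assumes c: "c \<in> A" and t: "t \<in> S" "\<gamma> t \<in> cdom c" "\<gamma> t \<in> V" and V: "open V"
    and L: "smooth_function (tangent_atlas A) (TB V) L" and D: "smooth_function (tangent_atlas A) (TB V) D"
  shows "satisfies_dissipative_EL A L D \<gamma> t \<longleftrightarrow> (\<forall>i. ELc L D c i t = 0)"
proof
  assume "satisfies_dissipative_EL A L D \<gamma> t"
  then show "\<forall>i. ELc L D c i t = 0"
    unfolding satisfies_dissipative_EL_def ELc_def using c t by simp
next
  assume 0: "\<forall>i. ELc L D c i t = 0"
  have "ELc L D c' i t = 0" if "c' \<in> A" "\<gamma> t \<in> cdom c'" for c' i
    using ELc_change[OF that(1) c t(1) that(2) t(2,3) V L D, of i] 0 by simp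
  then show "satisfies_dissipative_EL A L D \<gamma> t"
    unfolding satisfies_dissipative_EL_def ELc_def by simp
qed

text \<open>The defect splits into the Hessian applied to the deviation of the acceleration from the
  force, and a remainder depending on position and velocity only. On solutions of the given system
  the first part vanishes, which isolates the pointwise identity; given that identity, an invertible
  Hessian makes the two systems equivalent.\<close>

lemma ELc_coords:
  assumes c: "c \<in> A" and t: "t \<in> S" "\<gamma> t \<in> cdom c" "\<gamma> t \<in> V" and V: "open V"
    and L: "smooth_function (tangent_atlas A) (TB V) L"
  defines "x \<equiv> (cmap c (\<gamma> t), vd \<gamma> c t)" and "l \<equiv> L \<circ> chart_inv (I c)"
  shows "ELc L D c i t = (\<Sum>k\<in>UNIV. dv k (dv i l) x * (vdd \<gamma> c t $ k - fc c x $ k))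
    + (sode_coords.EL (fc c) l i x - dv i (D \<circ> chart_inv (I c)) x)"
proof -
  interpret C: sode_coords "Wd c V" "fc c" by (rule sode_coords[OF c V])
  have "deriv (\<lambda>s. ddv A c i L (lift \<gamma> s)) t = (\<Sum>k\<in>UNIV. vd \<gamma> c t $ k * dq k (dv i l) x)
      + (\<Sum>k\<in>UNIV. vdd \<gamma> c t $ k * dv k (dv i l) x)"
    unfolding x_def l_def by (rule DERIV_imp_deriv[OF ddv_lift_derivative[OF c t V L]])
  moreover have "ddq A c i L (lift \<gamma> t) = dq i l x" "ddv A c i D (lift \<gamma> t) = dv i (D \<circ> chart_inv (I c)) x"
    using t by (simp_all add: ddq_dq ddv_dv snd_lift c x_def l_def)
  ultimately show ?thesis
    unfolding ELc_def C.EL_def by (simp add: x_def sum.distrib right_diff_distrib sum_subtractf mult.commute)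
qed

end

end


section \<open>Dissipative systems\<close>

context sode_manifold
begin

lemma DH_components:
  assumes c: "c \<in> A" and u: "u \<in> TB (cdom c)"
  shows "ddh A \<Gamma> c k (comp02 A c g i j) u
     - (\<Sum>l\<in>UNIV. comp02 A c g l j u * ddv A c k (conn A \<Gamma> c l i) u)
     - (\<Sum>l\<in>UNIV. comp02 A c g i l u * ddv A c k (conn A \<Gamma> c l j) u)
   = sode_coords.DH (fc c) (\<lambda>i j. comp02 A c g i j \<circ> chart_inv (I c)) k i j (cmap c (fst u), snd u c)"
proof -
  interpret C: sode_coords "Wd c (cdom c)" "fc c" by (rule sode_coords[OF c open_cdom[OF c]])
  show ?thesis unfolding ddh_dh[OF c] ddv_conn[OF c u] C.DH_def by (simp add: cinv_I[OF c u])
qed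

text \<open>The Euler-Lagrange identity holds at every point because a solution curve passes
  through it.\<close>

lemma EL_identity:
  assumes U: "open U"
    and L: "smooth_function (tangent_atlas A) (TB U) L" and D: "smooth_function (tangent_atlas A) (TB U) D"
    and same: "same_solutions A U (satisfies_dissipative_EL A L D) (satisfies_sode A \<Gamma>)"
    and c: "c \<in> A" and x: "x \<in> Wd c U"
  shows "sode_coords.EL (fc c) (L \<circ> chart_inv (I c)) i x = dv i (D \<circ> chart_inv (I c)) x"
proof -
  \<comment> \<open>The first-order system q' = v, v' = f(q,v) on the coordinate image.\<close>
  define F where "F = (\<lambda>x. (snd x, fc c x))"
  have oW: "open (Wd c U)" by (rule open_Wd[OF c U])
  have F: "smooth_on (Wd c U) F" unfolding F_def by (intro smooth_intros oW smooth_fc c)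
  obtain \<delta> z where \<delta>: "\<delta> > 0" and z0: "z 0 = x" and zW: "\<And>t. t \<in> {-\<delta><..<\<delta>} \<Longrightarrow> z t \<in> Wd c U"
    and z': "\<And>t. t \<in> {-\<delta><..<\<delta>} \<Longrightarrow> (z has_vector_derivative F (z t)) (at t)"
    using ODE_solution[OF oW F x] by blast
  define S where "S = {-\<delta><..<\<delta>}"
  define \<gamma> where "\<gamma> = (\<lambda>t. chart_inv c (fst (z t)))"
  have S: "open S" "is_interval S" by (auto simp: S_def is_interval_oo)
  have zc: "z t \<in> Wd c U" if "t \<in> S" for t using zW that by (simp add: S_def)
  have p: "\<gamma> t \<in> U \<and> \<gamma> t \<in> cdom c \<and> cmap c (\<gamma> t) = fst (z t)" if t: "t \<in> S" for t
    using zc[OF t] cinv_cmap[OF c] by (auto simp: Wd_def \<gamma>_def)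
  have sz: "smooth_on S z"
    by (rule smooth_on_solution[OF oW F S(1)]) (use zW z' in \<open>auto simp: S_def\<close>)
  have cont: "continuous_on S \<gamma>"
    unfolding \<gamma>_def
  proof (rule continuous_on_compose2[OF cont_cinv[OF c]])
    show "continuous_on S (\<lambda>t. fst (z t))"
      by (intro continuous_on_fst smooth_on_imp_continuous_on[OF sz])
    have "fst (z t) \<in> cmap c ` cdom c" if "t \<in> S" for t
      using zc[OF that] by (auto simp: Wd_def)
    then show "(\<lambda>t. fst (z t)) ` S \<subseteq> cmap c ` cdom c" by blast
  qed
  have curve: "smooth_curve A S \<gamma>"
    unfolding smooth_curve_def
  proof (intro conjI ballI cont)
    fix c' assume c': "c' \<in> A"
    let ?T = "{t \<in> S. \<gamma> t \<in> cdom c'}"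
    have T: "open ?T"
      using continuous_open_preimage[OF cont S(1) open_cdom[OF c']] by (simp add: vimage_def Int_def)
    have "smooth_on ?T (\<lambda>t. tr c c' (fst (z t)))"
    proof (rule smooth_on_compose[OF T _ smooth_tr[OF c c']])
      show "smooth_on ?T (\<lambda>t. fst (z t))" by (intro smooth_on_fst T smooth_on_subset[OF sz]) auto
      show "(\<lambda>t. fst (z t)) ` ?T \<subseteq> cmap c ` (cdom c' \<inter> cdom c)"
      proof (rule image_subsetI)
        fix t assume t: "t \<in> ?T"
        then show "fst (z t) \<in> cmap c ` (cdom c' \<inter> cdom c)"
          using p[of t] by (intro image_eqI[of _ _ "\<gamma> t"]) auto
      qed
    qed
    then show "smooth_on ?T (cmap c' \<circ> \<gamma>)" by (simp add: tr_def \<gamma>_def o_def)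
  qed
  have vdz: "vd \<gamma> c t = snd (z t)" if t: "t \<in> S" for t
  proof -
    have "((\<lambda>s. fst (z s)) has_vector_derivative fst (F (z t))) (at t)"
      using bounded_linear.has_vector_derivative[OF bounded_linear_fst z'] t by (simp add: S_def)
    then have "((\<lambda>s. cmap c (\<gamma> s)) has_vector_derivative snd (z t)) (at t)"
      by (rule has_vector_derivative_transform_within_open[OF _ S(1) t, THEN has_vector_derivative_eq_rhs])
         (use p in \<open>auto simp: F_def\<close>)
    then show ?thesis using vector_derivative_unique_at curve_vd[OF S(1) curve c t] p[OF t] by blast
  qed
  have vddz: "vdd \<gamma> c t = fc c (z t)" if t: "t \<in> S" for t
  proof -
    have "((\<lambda>s. snd (z s)) has_vector_derivative snd (F (z t))) (at t)"
      using bounded_linear.has_vector_derivative[OF bounded_linear_snd z'] t by (simp add: S_def)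
    then have "(vd \<gamma> c has_vector_derivative fc c (z t)) (at t)"
      by (rule has_vector_derivative_transform_within_open[OF _ S(1) t, THEN has_vector_derivative_eq_rhs])
         (use vdz in \<open>auto simp: F_def\<close>)
    then show ?thesis using vector_derivative_unique_at curve_vdd[OF S(1) curve c t] p[OF t] by blast
  qed
  have zt: "(cmap c (\<gamma> t), vd \<gamma> c t) = z t" if "t \<in> S" for t
    using p[OF that] vdz[OF that] by (simp add: prod_eq_iff)
  have "satisfies_sode A \<Gamma> \<gamma> t" if t: "t \<in> S" for t
    using satisfies_sode_iff[OF S(1) curve c t] p[OF t] zt[OF t] vddz[OF t] by simp
  moreover have "\<gamma> ` S \<subseteq> U" using p by blast
  ultimately have "\<forall>t\<in>S. satisfies_dissipative_EL A L D \<gamma> t"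
    using same S curve unfolding same_solutions_def by blast
  moreover have t0: "0 \<in> S" using \<delta> by (simp add: S_def)
  ultimately have "ELc \<gamma> L D c i 0 = 0"
    using satisfies_EL_iff[OF S(1) curve c t0 _ _ U L D] p[OF t0] by blast
  \<comment> \<open>The acceleration equals the force along the curve, so the Hessian term of
    \<open>ELc_coords\<close> vanishes and the remainder at time 0 is the identity at
    \<open>x\<close>.\<close>
  then show ?thesis
    using ELc_coords[OF S(1) curve c t0 _ _ U L, of D i] p[OF t0] zt[OF t0] vddz[OF t0] z0 by simp
qed

text \<open>Written in the coordinates of the single chart \<open>c\<close>; by
  \<open>hessian_change\<close> it has the same form in every other chart that meets its
  domain.\<close>

definition hess_tensor :: "('q, real ^ 'n) chart \<Rightarrow> (('q, 'n) npoint \<Rightarrow> real) \<Rightarrow> ('q, 'n) tensor02" where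
  "hess_tensor c L u x y = (\<Sum>i\<in>UNIV. \<Sum>j\<in>UNIV. ddv A c i (ddv A c j L) u * x c $ i * y c $ j)"

lemma comp02_hess_tensor:
  assumes "c0 \<in> A" "c \<in> A" "open V" "u \<in> TB V" "fst u \<in> cdom c0" "fst u \<in> cdom c"
    and "smooth_function (tangent_atlas A) (TB V) L"
  shows "comp02 A c (hess_tensor c0 L) i j u = ddv A c i (ddv A c j L) u"
  unfolding hessian_change[OF assms(2,1,3,4,6,5,7)] comp02_def hess_tensor_def
  using assms by (simp add: tangent_vec_J mult_ac)

text \<open>The tensor is the fibre Hessian of \<open>L\<close>. Since \<open>EL_identity\<close> is
  available in every chart, each condition is verified directly in the chart in which it is
  stated.\<close>

lemma dissipative_imp_tensor:
  assumes U: "open U" "p \<in> U"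
    and L: "smooth_function (tangent_atlas A) (TB U) L" and D: "smooth_function (tangent_atlas A) (TB U) D"
    and reg: "regular_function A U L"
    and same: "same_solutions A U (satisfies_dissipative_EL A L D) (satisfies_sode A \<Gamma>)"
  shows "\<exists>U. open U \<and> p \<in> U \<and> (\<exists>g.
       tensor_field02_along A U g \<and> symmetric02 A U g \<and> nonsingular02 A U g \<and>
       symmetric_derivative A U (DV02 A) g \<and>
       symmetric_derivative A U (DH02 A \<Gamma>) g \<and>
       cyclic_curvature_condition A \<Gamma> U g)"
proof -
  obtain c0 where c0: "c0 \<in> A" "p \<in> cdom c0" using cover by blast
  \<comment> \<open>Shrinking into one chart domain allows the tensor to be defined through the
    coordinates of \<open>c0\<close>.\<close>
  define U' where "U' = U \<inter> cdom c0"
  have U': "open U'" "p \<in> U'" "U' \<subseteq> U" "U' \<subseteq> cdom c0" using U c0 open_cdom[OF c0(1)] by (auto simp: U'_def)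
  define g where "g = hess_tensor c0 L"
  have comp: "comp02 A c g i j u = ddv A c i (ddv A c j L) u" if "c \<in> A" "u \<in> TB U'" "fst u \<in> cdom c" for c i j u
    unfolding g_def by (rule comp02_hess_tensor[OF c0(1) that(1) U(1) _ _ that(3) L])
      (use that(2) U' in \<open>auto simp: TB_iff\<close>)
  define l where "l = (\<lambda>c. L \<circ> chart_inv (I c))"
  have loc: "(comp02 A c g i j \<circ> chart_inv (I c)) x = dv i (dv j (l c)) x" if c: "c \<in> A" and x: "x \<in> Wd c U'" for c i j x
  proof (rule Wd_E[OF c x])
    fix u assume u: "u \<in> TB (U' \<inter> cdom c)" "x = (cmap c (fst u), snd u c)" "chart_inv (I c) x = u"
    then have "u \<in> TB U'" "fst u \<in> cdom c" "u \<in> TB (cdom c)" by (auto simp: TB_iff)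
    then show ?thesis using comp[OF c, of u i j] ddv_ddv[OF c, of u i j L] u by (simp add: l_def)
  qed
  have Ul: "smooth_on (Wd c U') (l c)" "smooth_on (Wd c U') (D \<circ> chart_inv (I c))" if "c \<in> A" for c
    using smooth_function_subset[OF L U'(3)] smooth_function_subset[OF D U'(3)] that
    unfolding smooth_function_iff l_def by blast+
  have EL: "sode_coords.EL (fc c) (l c) i x = dv i (D \<circ> chart_inv (I c)) x" if "c \<in> A" "x \<in> Wd c U'" for c i x
    unfolding l_def using EL_identity[OF U(1) L D same that(1)] Wd_mono[OF U'(3)] that(2) by blast
  have tensor: "tensor_field02_along A U' g"
    unfolding tensor_field02_along_def
  proof (intro conjI ballI allI)
    fix u x y z and a b :: real
    show "g u (\<lambda>c. a *\<^sub>R x c + b *\<^sub>R y c) z = a * g u x z + b * g u y z"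
      "g u z (\<lambda>c. a *\<^sub>R x c + b *\<^sub>R y c) = a * g u z x + b * g u z y"
      unfolding g_def hess_tensor_def by (simp_all add: algebra_simps sum.distrib sum_distrib_left)
  next
    fix c i j assume c: "c \<in> A"
    let ?V = "U' \<inter> cdom c"
    have V: "open ?V" using U' open_cdom[OF c] by blast
    have "smooth_function (tangent_atlas A) (TB (U' \<inter> cdom c)) (ddv A c j L)"
      by (rule smooth_function_ddv[OF c U'(1) smooth_function_subset[OF L U'(3)]])
    from smooth_function_ddv[OF c V this]
    have "smooth_function (tangent_atlas A) (TB ?V) (ddv A c i (ddv A c j L))" by (simp add: Int_assoc)
    then show "smooth_function (tangent_atlas A) (TB ?V) (comp02 A c g i j)"
      using smooth_function_cong[OF V, of "comp02 A c g i j" "ddv A c i (ddv A c j L)"] comp[OF c]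
      by (simp add: TB_iff)
  qed
  have hsym: "ddv A c0 i (ddv A c0 j L) u = ddv A c0 j (ddv A c0 i L) u" if u: "u \<in> TB U'" for i j u
  proof -
    interpret C: sode_coords "Wd c0 U'" "fc c0" by (rule sode_coords[OF c0(1) U'(1)])
    have "u \<in> TB (cdom c0)" "fst u \<in> cdom c0" using u U'(4) by (auto simp: TB_iff)
    then show ?thesis
      using C.dv_dv[OF Ul(1)[OF c0(1)] Wd_I[OF u], of i j] by (simp add: ddv_ddv[OF c0(1)] l_def)
  qed
  have sym: "symmetric02 A U' g"
    unfolding symmetric02_def
  proof (intro ballI)
    fix u x y assume u: "u \<in> TB U'"
    show "g u x y = g u y x"
      unfolding g_def hess_tensor_def
      by (subst sum.swap) (use hsym[OF u] in \<open>simp add: mult_ac\<close>)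
  qed
  have nonsing: "nonsingular02 A U' g"
    unfolding nonsingular02_def
  proof (intro ballI)
    fix c u assume c: "c \<in> A" and u: "u \<in> TB (U' \<inter> cdom c)"
    then have "u \<in> TB (U \<inter> cdom c)" using U' by (auto simp: TB_iff)
    then have "invertible (\<chi> i j. ddv A c i (ddv A c j L) u)"
      using reg c unfolding regular_function_def by blast
    then show "invertible (\<chi> i j. comp02 A c g i j u)" using comp[OF c, of u] u by (simp add: TB_iff)
  qed
  have DV: "symmetric_derivative A U' (DV02 A) g"
    unfolding symmetric_derivative_def
  proof (intro allI impI ballI)
    fix X Y Z c u assume c: "c \<in> A" and u: "u \<in> TB (U' \<inter> cdom c)"
    then have u': "u \<in> TB U'" "fst u \<in> cdom c" by (auto simp: TB_iff)
    interpret C: sode_coords "Wd c U'" "fc c" by (rule sode_coords[OF c U'(1)])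
    note x = Wd_I[OF u']
    have T: "ddv A c k (comp02 A c g i j) u = dv k (dv i (dv j (l c))) (cmap c (fst u), snd u c)" for k i j
      unfolding ddv_dv by (rule C.transform(2)[OF loc[OF c] x])
    have s1: "ddv A c k (comp02 A c g i j) u = ddv A c i (comp02 A c g k j) u" for k i j
      unfolding T by (rule C.dv_dv[OF C.smooth_dv[OF Ul(1)[OF c]] x])
    have s2: "ddv A c k (comp02 A c g i j) u = ddv A c k (comp02 A c g j i) u" for k i j
      unfolding T by (rule C.transform(2)[OF C.dv_dv[OF Ul(1)[OF c]] x])
    show "DV02 A c X g u (Y u) (Z u) = DV02 A c Y g u (X u) (Z u) \<and>
        DV02 A c X g u (Y u) (Z u) = DV02 A c X g u (Z u) (Y u)"
      unfolding DV02_tri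
      by (intro conjI tri_swap12 tri_swap23 s1 s2)
  qed
  have DH: "symmetric_derivative A U' (DH02 A \<Gamma>) g"
    unfolding symmetric_derivative_def
  proof (intro allI impI ballI)
    fix X Y Z c u assume c: "c \<in> A" and u: "u \<in> TB (U' \<inter> cdom c)"
    then have u': "u \<in> TB U'" "fst u \<in> cdom c" "u \<in> TB (cdom c)" by (auto simp: TB_iff)
    interpret C: sode_coords "Wd c U'" "fc c" by (rule sode_coords[OF c U'(1)])
    note x = Wd_I[OF u'(1,2)]
    have T: "C.DH (\<lambda>i j. comp02 A c g i j \<circ> chart_inv (I c)) k i j (cmap c (fst u), snd u c) =
        C.DH (\<lambda>i j. dv i (dv j (l c))) k i j (cmap c (fst u), snd u c)" for k i j
      by (rule C.DH_cong[OF loc[OF c] x])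
    note h = C.helmholtz_necessary(1,2)[OF Ul[OF c] EL[OF c] x]
    show "DH02 A \<Gamma> c X g u (Y u) (Z u) = DH02 A \<Gamma> c Y g u (X u) (Z u) \<and>
        DH02 A \<Gamma> c X g u (Y u) (Z u) = DH02 A \<Gamma> c X g u (Z u) (Y u)"
      unfolding DH02_tri DH_components[OF c u'(3)] T
      by (intro conjI tri_swap12 tri_swap23 h)
  qed
  have cyc: "cyclic_curvature_condition A \<Gamma> U' g"
    unfolding cyclic_curvature_condition_def
  proof (intro allI impI ballI)
    fix X Y Z c u assume v: "vector_field_along A U' X" "vector_field_along A U' Y" "vector_field_along A U' Z"
      and c: "c \<in> A" and u: "u \<in> TB (U' \<inter> cdom c)"
    then have u': "u \<in> TB U'" "fst u \<in> cdom c" "u \<in> TB (cdom c)" by (auto simp: TB_iff)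
    interpret C: sode_coords "Wd c U'" "fc c" by (rule sode_coords[OF c U'(1)])
    note x = Wd_I[OF u'(1,2)]
    have ts: "X u \<in> tangent_space A (fst u)" "Y u \<in> tangent_space A (fst u)" "Z u \<in> tangent_space A (fst u)"
      using v u'(1) unfolding vector_field_along_def by blast+
    have T: "(\<Sum>l\<in>UNIV. curv A \<Gamma> c l i j u * comp02 A c g l k u) =
        (\<Sum>m\<in>UNIV. C.curvN m i j (cmap c (fst u), snd u c) * dv m (dv k (l c)) (cmap c (fst u), snd u c))" for i j k
      using loc[OF c x] by (simp add: curv_curvN[OF c u'(3)] cinv_I[OF c u'(3)])
    show "g u (curvature A \<Gamma> c u (X u) (Y u)) (Z u) + g u (curvature A \<Gamma> c u (Y u) (Z u)) (X u)
        + g u (curvature A \<Gamma> c u (Z u) (X u)) (Y u) = 0"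
      unfolding curvature_tri[OF tensor c u'(1,2) ts(1)] curvature_tri[OF tensor c u'(1,2) ts(2)]
        curvature_tri[OF tensor c u'(1,2) ts(3)] tri_cyclic_sum T
      using C.helmholtz_necessary(3)[OF Ul[OF c] EL[OF c] x] by (simp add: tri_def)
  qed
  show ?thesis using U'(1,2) tensor sym nonsing DV DH cyc by blast
qed

text \<open>The functions are constructed in one chart around \<open>p\<close> and pulled back.
  Regularity passes to the other charts by the tensor law of the Hessian, and the equations by that
  of their defects.\<close>

lemma tensor_imp_dissipative:
  assumes U: "open U" "p \<in> U" and g: "tensor_field02_along A U g" "symmetric02 A U g" "nonsingular02 A U g"
    and DV: "symmetric_derivative A U (DV02 A) g" and DH: "symmetric_derivative A U (DH02 A \<Gamma>) g"
    and cyc: "cyclic_curvature_condition A \<Gamma> U g"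
  shows "\<exists>U. open U \<and> p \<in> U \<and> (\<exists>L D.
     smooth_function (tangent_atlas A) (TB U) L \<and> smooth_function (tangent_atlas A) (TB U) D \<and>
     regular_function A U L \<and>
     same_solutions A U (satisfies_dissipative_EL A L D) (satisfies_sode A \<Gamma>))"
proof -
  obtain c0 where c0: "c0 \<in> A" "p \<in> cdom c0" using cover by blast
  have "open (cmap c0 ` (U \<inter> cdom c0))" "cmap c0 p \<in> cmap c0 ` (U \<inter> cdom c0)"
    using open_cmap_image[OF c0(1) U(1)] U c0 by auto
  \<comment> \<open>A ball in the chart provides the convex base over which the closed 2-form is
    exact.\<close>
  then obtain r where r: "r > 0" "ball (cmap c0 p) r \<subseteq> cmap c0 ` (U \<inter> cdom c0)"
    using open_contains_ball by blast
  define B where "B = ball (cmap c0 p) r"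
  define U' where "U' = cdom c0 \<inter> cmap c0 -` B"
  have U': "open U'" "p \<in> U'" "U' \<subseteq> cdom c0"
    using continuous_open_preimage[OF cont_cmap[OF c0(1)] open_cdom[OF c0(1)]] c0 r by (auto simp: U'_def B_def)
  have U'U: "U' \<subseteq> U"
  proof
    fix q assume q: "q \<in> U'"
    then obtain q' where "q' \<in> U" "q' \<in> cdom c0" "cmap c0 q = cmap c0 q'" using r(2) by (auto simp: U'_def B_def)
    then have "q = q'" using q cinv_cmap[OF c0(1)] U'(3) by (metis subsetD)
    then show "q \<in> U" using \<open>q' \<in> U\<close> by simp
  qed
  have "cmap c0 ` (U' \<inter> cdom c0) = B" using r(2) by (auto simp: U'_def B_def)
  then have WB: "Wd c0 U' = B \<times> UNIV" by (simp add: Wd_def)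
  have B: "open B" "convex B" "B \<noteq> {}" using r(1) by (auto simp: B_def)
  let ?ci = "chart_inv (I c0)"
  define G where "G = (\<lambda>i j. comp02 A c0 g i j \<circ> ?ci)"
  interpret C: sode_coords "Wd c0 U'" "fc c0" by (rule sode_coords[OF c0(1) U'(1)])
  have pt: "\<exists>u. u \<in> TB U' \<and> u \<in> TB U \<and> u \<in> TB (cdom c0) \<and> fst u \<in> cdom c0 \<and> x = (cmap c0 (fst u), snd u c0) \<and> ?ci x = u"
    if "x \<in> Wd c0 U'" for x
  proof (rule Wd_E[OF c0(1) that])
    fix u assume "u \<in> TB (U' \<inter> cdom c0)" "x = (cmap c0 (fst u), snd u c0)" "?ci x = u"
    then show ?thesis using U'U by (intro exI[of _ u]) (auto simp: TB_iff)
  qed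
  have G: "smooth_on (Wd c0 U') (G i j)" for i j
  proof -
    have "smooth_function (tangent_atlas A) (TB (U \<inter> cdom c0)) (comp02 A c0 g i j)"
      using g(1) c0(1) unfolding tensor_field02_along_def by blast
    then have "smooth_on (Wd c0 (U \<inter> cdom c0)) (G i j)" using c0(1) unfolding smooth_function_iff G_def by blast
    then show ?thesis by (rule smooth_on_subset) (use U'U U'(3) in \<open>auto intro!: Wd_mono\<close>)
  qed
  have Gsym: "G i j x = G j i x" if x: "x \<in> Wd c0 U'" for i j x
  proof -
    obtain u where u: "u \<in> TB U" "fst u \<in> cdom c0" "?ci x = u" using pt[OF x] by blast
    then show ?thesis
      using g(2) tangent_vec_in[OF c0(1) u(2)] unfolding symmetric02_def G_def comp02_def by simp
  qed
  have GDV: "dv k (G i j) x = dv i (G k j) x" if x: "x \<in> Wd c0 U'" for i j k x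
  proof -
    obtain u where u: "u \<in> TB U" "fst u \<in> cdom c0" "x = (cmap c0 (fst u), snd u c0)" using pt[OF x] by blast
    from symmetric_derivative_components[OF U(1) c0(1) u(1,2) DV DV02_tri, of k i j]
    show ?thesis unfolding ddv_dv G_def u(3) .
  qed
  have GDH: "C.DH G k i j x = C.DH G i k j x" if x: "x \<in> Wd c0 U'" for i j k x
  proof -
    obtain u where u: "u \<in> TB U" "fst u \<in> cdom c0" "x = (cmap c0 (fst u), snd u c0)" "u \<in> TB (cdom c0)"
      using pt[OF x] by blast
    from symmetric_derivative_components[OF U(1) c0(1) u(1,2) DH DH02_tri, of k i j]
    show ?thesis unfolding DH_components[OF c0(1) u(4)] G_def u(3) .
  qed
  have Gcyc: "(\<Sum>l\<in>UNIV. C.curvN l i j x * G l k x) + (\<Sum>l\<in>UNIV. C.curvN l j k x * G l i x)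
      + (\<Sum>l\<in>UNIV. C.curvN l k i x * G l j x) = 0" if x: "x \<in> Wd c0 U'" for i j k x
  proof -
    obtain u where u: "u \<in> TB U" "fst u \<in> cdom c0" "x = (cmap c0 (fst u), snd u c0)" "u \<in> TB (cdom c0)"
        "?ci x = u" using pt[OF x] by blast
    from cyclic_curvature_components[OF U(1) c0(1) u(1,2) g(1) cyc, of i j k]
    show ?thesis unfolding curv_curvN[OF c0(1) u(4)] G_def comp_apply u(5) unfolding u(3) .
  qed
  obtain l d where l: "smooth_on (Wd c0 U') l" and d: "smooth_on (Wd c0 U') d"
    and hess: "\<And>i j x. x \<in> Wd c0 U' \<Longrightarrow> dv i (dv j l) x = G i j x"
    and EL: "\<And>i x. x \<in> Wd c0 U' \<Longrightarrow> C.EL l i x = dv i d x"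
    using C.helmholtz_sufficient[OF WB B G Gsym GDV GDH Gcyc] by blast
  define lift' where "lift' = (\<lambda>(h :: (real ^ 'n) \<times> (real ^ 'n) \<Rightarrow> real) (u :: ('q, 'n) npoint). h (cmap c0 (fst u), snd u c0))"
  have lift': "(lift' h \<circ> ?ci) x = h x" if x: "x \<in> Wd c0 U'" for h x
    using pt[OF x] by (auto simp: lift'_def)
  have sl: "smooth_function (tangent_atlas A) (TB U') (lift' h)" if "smooth_on (Wd c0 U') h" for h
    by (rule smooth_function_chart[OF c0(1) U'(1,3)])
       (use that smooth_on_cong[OF C.W, of "lift' h \<circ> ?ci" h] lift' in blast)
  define L where "L = lift' l"
  define D where "D = lift' d"
  have L: "smooth_function (tangent_atlas A) (TB U') L" and D: "smooth_function (tangent_atlas A) (TB U') D"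
    unfolding L_def D_def using sl l d by blast+
  have dvL: "dv i (dv j (L \<circ> ?ci)) x = G i j x" if x: "x \<in> Wd c0 U'" for i j x
  proof -
    have "dv j (L \<circ> ?ci) y = dv j l y" if "y \<in> Wd c0 U'" for y j
      unfolding L_def by (rule C.transform(2)[OF lift' that])
    then have "dv i (dv j (L \<circ> ?ci)) x = dv i (dv j l) x" by (rule C.transform(2)[OF _ x])
    then show ?thesis using hess[OF x] by simp
  qed
  have ELL: "C.EL (L \<circ> ?ci) i x = dv i (D \<circ> ?ci) x" if x: "x \<in> Wd c0 U'" for i x
  proof -
    have 1: "dv j (L \<circ> ?ci) y = dv j l y" if "y \<in> Wd c0 U'" for y j
      unfolding L_def by (rule C.transform(2)[OF lift' that])
    have 2: "dq k (dv j (L \<circ> ?ci)) x = dq k (dv j l) x" for j k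
      by (rule C.transform(1)[OF 1 x])
    have 5: "dv k (dv j (L \<circ> ?ci)) x = dv k (dv j l) x" for j k
      by (rule C.transform(2)[OF 1 x])
    have 3: "dq j (L \<circ> ?ci) x = dq j l x" for j unfolding L_def by (rule C.transform(1)[OF lift' x])
    have 4: "dv j (D \<circ> ?ci) x = dv j d x" for j unfolding D_def by (rule C.transform(2)[OF lift' x])
    show ?thesis using EL[OF x, of i] unfolding C.EL_def 2 5 3 4 .
  qed
  have hessL: "ddv A c0 i (ddv A c0 j L) u = comp02 A c0 g i j u" if u: "u \<in> TB U'" for i j u
  proof -
    have u': "u \<in> TB (cdom c0)" "fst u \<in> cdom c0" using u U'(3) by (auto simp: TB_iff)
    show ?thesis
      unfolding ddv_ddv[OF c0(1) u'(1)] dvL[OF Wd_I[OF u u'(2)]] G_def by (simp add: cinv_I[OF c0(1) u'(1)])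
  qed
  have reg: "regular_function A U' L"
    unfolding regular_function_def
  proof (intro ballI)
    fix c u assume c: "c \<in> A" and u: "u \<in> TB (U' \<inter> cdom c)"
    have u': "u \<in> TB U'" "u \<in> TB U" "fst u \<in> cdom c" "fst u \<in> cdom c0" "u \<in> TB (U \<inter> cdom c)"
      using u U'U U'(3) by (auto simp: TB_iff)
    \<comment> \<open>In the chart \<open>c0\<close> this is \<open>hessL\<close>. Both sides
      transform by the same Jacobians, so it holds in \<open>c\<close> too.\<close>
    have "ddv A c i (ddv A c j L) u = comp02 A c g i j u" for i j
    proof -
      have "comp02 A c g i j u = (\<Sum>k\<in>UNIV. \<Sum>m\<in>UNIV. comp02 A c0 g k m u
          * J c c0 (fst u) (axis i 1) $ k * J c c0 (fst u) (axis j 1) $ m)"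
        unfolding comp02_def[of A c]
        using tensor_expand[OF g(1) c0(1) u'(2,4) tangent_vec_in[OF c u'(3)] tangent_vec_in[OF c u'(3)]] c0(1) u'(4)
        by (simp add: tangent_vec_J)
      then show ?thesis
        unfolding hessian_change[OF c c0(1) U'(1) u'(1,3,4) L] hessL[OF u'(1)] by (simp add: mult_ac)
    qed
    then show "invertible (\<chi> i j. ddv A c i (ddv A c j L) u)"
      using g(3) c u'(5) unfolding nonsingular02_def by simp
  qed
  have same: "same_solutions A U' (satisfies_dissipative_EL A L D) (satisfies_sode A \<Gamma>)"
    unfolding same_solutions_def
  \<comment> \<open>The two systems are shown to agree at each time separately, which is more than
    equality of their solution sets.\<close>
  proof (intro allI impI ball_cong refl)
    fix S :: "real set" and \<gamma> t
    assume S: "open S" and curve: "smooth_curve A S \<gamma>" and im: "\<gamma> ` S \<subseteq> U'" and t: "t \<in> S"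
    have \<gamma>t: "\<gamma> t \<in> U'" "\<gamma> t \<in> cdom c0" using im t U'(3) by auto
    let ?u = "lift \<gamma> t"
    let ?x = "(cmap c0 (\<gamma> t), vd \<gamma> c0 t)"
    have u: "?u \<in> TB U'" by (rule lift_in_TB[OF S curve t \<gamma>t(1)])
    have x: "?x \<in> Wd c0 U'" using Wd_I[OF u, of c0] \<gamma>t by (simp add: snd_lift c0)
    \<comment> \<open>By \<open>ELL\<close> the remainder in \<open>ELc_coords\<close> vanishes, so
      the defects are the components of \<open>M *v w\<close>, with \<open>w\<close> the deviation
      of the acceleration from the force.\<close>
    define M where "M = (\<chi> i j. comp02 A c0 g i j ?u)"
    define w where "w = vdd \<gamma> c0 t - fc c0 ?x"
    have "?u \<in> TB (U \<inter> cdom c0)" using u U'U \<gamma>t by (auto simp: TB_iff)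
    then have "invertible M" using g(3) c0(1) unfolding nonsingular02_def M_def by blast
    then obtain M' where M': "M' ** M = mat 1" unfolding invertible_def by blast
    have GM: "G k i ?x = M $ i $ k" for i k
    proof -
      have "?ci ?x = ?u" using cinv_I[OF c0(1), of ?u] u \<gamma>t by (simp add: TB_iff snd_lift c0)
      then show ?thesis using Gsym[OF x, of k i] by (simp add: G_def M_def)
    qed
    have "ELc \<gamma> L D c0 i t = (M *v w) $ i" for i
      unfolding ELc_coords[OF S curve c0(1) t \<gamma>t(2,1) U'(1) L] ELL[OF x] dvL[OF x] GM
      by (simp add: matrix_vector_mult_def w_def)
    then have "(\<forall>i. ELc \<gamma> L D c0 i t = 0) \<longleftrightarrow> M *v w = 0" by (simp add: vec_eq_iff)
    also have "\<dots> \<longleftrightarrow> w = 0"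
    proof
      assume "M *v w = 0"
      then have "M' *v (M *v w) = 0" by simp
      then show "w = 0" by (simp add: matrix_vector_mul_assoc M')
    qed simp
    finally show "satisfies_dissipative_EL A L D \<gamma> t \<longleftrightarrow> satisfies_sode A \<Gamma> \<gamma> t"
      unfolding satisfies_EL_iff[OF S curve c0(1) t \<gamma>t(2,1) U'(1) L D]
        satisfies_sode_iff[OF S curve c0(1) t \<gamma>t(2)] w_def by simp
  qed
  show ?thesis using U'(1,2) L D reg same by blast
qed

end

theorem theorem3:
  fixes A :: "('q::{t2_space, second_countable_topology}, real ^ 'n::finite) chart set"
    and \<Gamma> :: "('q, 'n) sode"
  assumes "smooth_atlas A" and "second_order_field A \<Gamma>"
  shows "locally_dissipative A \<Gamma> \<longleftrightarrow>
    (\<forall>p. \<exists>U. open U \<and> p \<in> U \<and> (\<exists>g.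
       tensor_field02_along A U g \<and> symmetric02 A U g \<and> nonsingular02 A U g \<and>
       symmetric_derivative A U (DV02 A) g \<and>
       symmetric_derivative A U (DH02 A \<Gamma>) g \<and>
       cyclic_curvature_condition A \<Gamma> U g))"
proof -
  interpret sode_manifold A \<Gamma> by unfold_locales (fact assms)+
  show ?thesis
    unfolding locally_dissipative_def
  proof (intro iffI allI)
    fix p assume "\<forall>p. \<exists>U. open U \<and> p \<in> U \<and> (\<exists>L D.
       smooth_function (tangent_atlas A) (TB U) L \<and> smooth_function (tangent_atlas A) (TB U) D \<and>
       regular_function A U L \<and>
       same_solutions A U (satisfies_dissipative_EL A L D) (satisfies_sode A \<Gamma>))"
    then obtain U L D where "open U" "p \<in> U" "smooth_function (tangent_atlas A) (TB U) L"
      "smooth_function (tangent_atlas A) (TB U) D" "regular_function A U L"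
      "same_solutions A U (satisfies_dissipative_EL A L D) (satisfies_sode A \<Gamma>)" by meson
    then show "\<exists>U. open U \<and> p \<in> U \<and> (\<exists>g.
       tensor_field02_along A U g \<and> symmetric02 A U g \<and> nonsingular02 A U g \<and>
       symmetric_derivative A U (DV02 A) g \<and> symmetric_derivative A U (DH02 A \<Gamma>) g \<and>
       cyclic_curvature_condition A \<Gamma> U g)" by (rule dissipative_imp_tensor)
  next
    fix p assume "\<forall>p. \<exists>U. open U \<and> p \<in> U \<and> (\<exists>g.
       tensor_field02_along A U g \<and> symmetric02 A U g \<and> nonsingular02 A U g \<and>
       symmetric_derivative A U (DV02 A) g \<and> symmetric_derivative A U (DH02 A \<Gamma>) g \<and>
       cyclic_curvature_condition A \<Gamma> U g)"
    then obtain U g where "open U" "p \<in> U" "tensor_field02_along A U g" "symmetric02 A U g" "nonsingular02 A U g"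
       "symmetric_derivative A U (DV02 A) g" "symmetric_derivative A U (DH02 A \<Gamma>) g"
       "cyclic_curvature_condition A \<Gamma> U g" by meson
    then show "\<exists>U. open U \<and> p \<in> U \<and> (\<exists>L D.
       smooth_function (tangent_atlas A) (TB U) L \<and> smooth_function (tangent_atlas A) (TB U) D \<and>
       regular_function A U L \<and>
       same_solutions A U (satisfies_dissipative_EL A L D) (satisfies_sode A \<Gamma>))"
      by (rule tensor_imp_dissipative)
  qed
qed

end
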